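(* Let $0<p<1$ and $r\in\mathbb{N}$. There is a constant $C$, independent of $f$ and $n$, such that the following holds. Let $f$ be a function on $\mathbb{T}$ such that $f^{(r-1)}\in AC(\mathbb{T})$ and $$\sum_{\nu=1}^\infty \nu^{-p}E_\nu(f^{(r)})_p^p<\infty .$$ Then for any $n\in\mathbb{N}$, $$E_n(f)_p\le \frac{C}{n^r}\left(E_n(f^{(r)})_p+n^{1-\frac1p}\left(\sum_{\nu=n+1}^\infty \nu^{-p}E_\nu(f^{(r)})_p^p\right)^{\frac1p}\right).$$
   Context: $\mathbb{T}\cong[0,2\pi)$ is the unit circle, and functions on $\mathbb{T}$ are identified with $2\pi$-periodic functions. $L_p(\mathbb{T})$ is the space of measurable $f$ with $\|f\|_p=\left(\int_{\mathbb{T}}|f(x)|^p\,dx\right)^{1/p}<\infty$. $AC(\mathbb{T})$ is the set of absolutely continuous ($2\pi$-periodic) functions; when $f^{(r-1)}\in AC(\mathbb{T})$, $f^{(r)}$ denotes the (a.e. defined, integrable) derivative of $f^{(r-1)}$. $\mathcal{T}_n$ is the set of all trigonometric polynomials of degree at most $n$, and $E_n(f)_p=\inf_{T\in\mathcal{T}_n}\|f-T\|_p$. *)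

theory Defs
  imports "HOL-Analysis.Analysis"
begin

text \<open>
  Functions on the circle are \<open>2\<pi>\<close>-periodic functions \<open>real \<Rightarrow> complex\<close>; norms are computed over
  one period. Real-valued functions are included: for real \<open>f\<close>, approximating by complex or by
  real trigonometric polynomials gives the same \<open>E\<^sub>n(f)\<^sub>p\<close>, since \<open>\<bar>f - Re T\<bar> \<le> \<bar>f - T\<bar>\<close>.
\<close>

definition periodic2pi :: "(real \<Rightarrow> complex) \<Rightarrow> bool" where
  "periodic2pi f \<longleftrightarrow> (\<forall>x. f (x + 2 * pi) = f x)"

text \<open>
  The Bochner integral is \<open>0\<close> for non-integrable functions, so this is the usual \<open>L\<^sub>p\<close> quasi-norm
  only if \<open>\<bar>f\<bar>\<^sup>p\<close> is integrable. For \<open>0 < p < 1\<close> this covers every \<open>f\<close> that is integrable over a period,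
  in particular absolutely continuous functions, their derivatives, and trigonometric polynomials.
\<close>

definition Lp_norm :: "real \<Rightarrow> (real \<Rightarrow> complex) \<Rightarrow> real" where
  "Lp_norm p f = (LINT x|lebesgue_on {0..2 * pi}. norm (f x) powr p) powr (1 / p)"

definition trig_polys :: "nat \<Rightarrow> (real \<Rightarrow> complex) set" where
  "trig_polys n = {T. \<exists>c :: int \<Rightarrow> complex. \<forall>x. T x = (\<Sum>k = - int n..int n. c k * cis (of_int k * x))}"

definition best_approx :: "real \<Rightarrow> nat \<Rightarrow> (real \<Rightarrow> complex) \<Rightarrow> real" where
  "best_approx p n f = (INF T\<in>trig_polys n. Lp_norm p (\<lambda>x. f x - T x))"

definition abs_cont_on :: "real \<Rightarrow> real \<Rightarrow> (real \<Rightarrow> complex) \<Rightarrow> bool" where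
  "abs_cont_on s t f \<longleftrightarrow>
     (\<forall>\<epsilon>>0. \<exists>\<delta>>0. \<forall>I :: (real \<times> real) set.
        finite I \<and> (\<forall>(a, b)\<in>I. s \<le> a \<and> a < b \<and> b \<le> t) \<and>
        pairwise (\<lambda>(a, b) (c, d). {a<..<b} \<inter> {c<..<d} = {}) I \<and>
        (\<Sum>(a, b)\<in>I. b - a) < \<delta>
        \<longrightarrow> (\<Sum>(a, b)\<in>I. norm (f b - f a)) < \<epsilon>)"

definition AC_circle :: "(real \<Rightarrow> complex) set" where
  "AC_circle = {f. periodic2pi f \<and> abs_cont_on 0 (2 * pi) f}"

text \<open>
  \<open>nth_derivative k f\<close> is \<open>f\<^sup>(\<^sup>k\<^sup>)\<close> taken pointwise; its value is unspecified where the derivative does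
  not exist. If \<open>f\<^sup>(\<^sup>r\<^sup>-\<^sup>1\<^sup>)\<close> is absolutely continuous, this concerns only a null set for \<open>k = r\<close>.
\<close>

definition nth_derivative :: "nat \<Rightarrow> (real \<Rightarrow> complex) \<Rightarrow> real \<Rightarrow> complex" where
  "nth_derivative k f = ((\<lambda>g x. vector_derivative g (at x)) ^^ k) f"

text \<open>
  For \<open>r \<ge> 1\<close>: \<open>f\<close> is a function on the circle whose derivatives up to order \<open>r - 1\<close> exist everywhere
  and \<open>f\<^sup>(\<^sup>r\<^sup>-\<^sup>1\<^sup>)\<close> is absolutely continuous.
\<close>

definition derivative_in_AC :: "nat \<Rightarrow> (real \<Rightarrow> complex) \<Rightarrow> bool" where
  "derivative_in_AC r f \<longleftrightarrow>
     periodic2pi f \<and>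
     (\<forall>k<r - 1. \<forall>x. nth_derivative k f differentiable (at x)) \<and>
     nth_derivative (r - 1) f \<in> AC_circle"

end

theory Submission
  imports Defs "HOL-Library.Real_Mod"
begin

text \<open>
  The quasi-norm of \<open>L\<^sub>p\<close> for \<open>0 < p < 1\<close> is not subadditive, but its \<open>p\<close>-th power is, so the whole
  argument runs with \<open>p\<close>-th powers, and only at the end is a root taken.

  Write \<open>g = f\<^sup>(\<^sup>r\<^sup>)\<close>. Choose trigonometric polynomials \<open>T\<^sub>k\<close> of degree \<open>n 2\<^sup>k\<close> that approximate \<open>g\<close>
  almost as well as possible in \<open>L\<^sub>p\<close>. Finiteness of the series makes \<open>T\<^sub>k\<close> converge to \<open>g\<close> even in
  \<open>L\<^sub>1\<close>: by Nikolskii's inequality the \<open>L\<^sub>1\<close>-norms of the differences \<open>U\<^sub>k = T\<^sub>k\<^sub>+\<^sub>1 - T\<^sub>k\<close> are summable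
  (lemmas \<open>nikolskii_L1\<close> and \<open>L1_limit_from_p_convergence\<close>). Hence integrating \<open>T\<^sub>k\<close> term by term \<open>r\<close>
  times, each time without the mean value, gives polynomials that converge to \<open>f\<close> uniformly
  (\<open>iterated_primitive_approximation\<close>), and it suffices to approximate the \<open>r\<close>-fold antiderivatives of the \<open>U\<^sub>k\<close> by polynomials of degree \<open>n\<close>,
  for that of \<open>T\<^sub>0\<close> already has this degree.

  The central estimate (\<open>antiderivative_approximation\<close>) bounds the error for an antiderivative of a
  polynomial \<open>U\<close> of degree \<open>N \<ge> n\<close> by \<open>n\<^sup>-\<^sup>r (N/n)\<^sup>1\<^sup>/\<^sup>p\<^sup>-\<^sup>1 \<parallel>U\<parallel>\<^sub>p\<close>, up to a constant. The frequencies
  between \<open>n\<close> and \<open>N\<close> are cut smoothly into dyadic bands. On the band at \<open>m\<close>, \<open>r\<close>-fold integration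
  is convolution with a kernel of height \<open>m\<^sup>1\<^sup>-\<^sup>r\<close> that is concentrated on an interval of length \<open>1/m\<close>
  (\<open>kernel_p_integral\<close>). Young's inequality fails for \<open>p < 1\<close>; its substitute is that the
  convolution of two trigonometric polynomials equals an equidistant quadrature sum, to which
  subadditivity of the \<open>p\<close>-th power applies, and averaging over the position of the nodes turns the
  sampled values of \<open>U\<close> into \<open>\<parallel>U\<parallel>\<^sub>p\<close> (\<open>convolution_p_integral\<close>). The powers of \<open>m\<close> add up
  geometrically, so the lowest band decides. Summing over \<open>k\<close> and comparing the dyadic sum with the
  full series (\<open>dyadic_sum_le\<close>) gives the theorem.

  That \<open>f\<^sup>(\<^sup>r\<^sup>-\<^sup>1\<^sup>)\<close> is the integral of \<open>g\<close> is Lebesgue's form of the fundamental theorem of calculus for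
  absolutely continuous functions (\<open>abs_cont_derivative\<close>). Differentiability almost everywhere comes
  from Vitali's covering theorem, the integral formula from a gauge argument.
\<close>

section \<open>Absolutely continuous functions\<close>

abbreviation total_length :: "(real \<times> real) set \<Rightarrow> real" where
  "total_length I \<equiv> \<Sum>(a, b)\<in>I. b - a"

abbreviation variation :: "(real \<Rightarrow> real) \<Rightarrow> (real \<times> real) set \<Rightarrow> real" where
  "variation F I \<equiv> \<Sum>(a, b)\<in>I. \<bar>F b - F a\<bar>"

definition interval_family :: "real \<Rightarrow> real \<Rightarrow> (real \<times> real) set \<Rightarrow> bool" where
  "interval_family s t I \<longleftrightarrow> finite I \<and> (\<forall>(a, b)\<in>I. s \<le> a \<and> a < b \<and> b \<le> t) \<and>
     pairwise (\<lambda>(a, b) (c, d). {a<..<b} \<inter> {c<..<d} = {}) I"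

text \<open>
  The codomain is arbitrary so that the real and the imaginary part of a function, to which the
  order-theoretic arguments apply, fall under the same definition.
\<close>
definition abs_cont :: "real \<Rightarrow> real \<Rightarrow> (real \<Rightarrow> 'a::real_normed_vector) \<Rightarrow> bool" where
  "abs_cont s t f \<longleftrightarrow> (\<forall>\<epsilon>>0. \<exists>\<delta>>0. \<forall>I. interval_family s t I \<and> total_length I < \<delta>
     \<longrightarrow> (\<Sum>(a, b)\<in>I. norm (f b - f a)) < \<epsilon>)"

lemma abs_cont_on_eq: "abs_cont_on s t f \<longleftrightarrow> abs_cont s t f"
  by (simp add: abs_cont_on_def abs_cont_def interval_family_def conj_assoc)

lemma interval_family_finite: "interval_family s t I \<Longrightarrow> finite I"
  by (simp add: interval_family_def)

lemma interval_familyD: "interval_family s t I \<Longrightarrow> (a, b) \<in> I \<Longrightarrow> s \<le> a \<and> a < b \<and> b \<le> t"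
  by (auto simp: interval_family_def)

lemma interval_family_disjoint:
  "interval_family s t I \<Longrightarrow> (a, b) \<in> I \<Longrightarrow> (c, d) \<in> I \<Longrightarrow> (a, b) \<noteq> (c, d) \<Longrightarrow> {a<..<b} \<inter> {c<..<d} = {}"
  unfolding interval_family_def pairwise_def by fastforce

lemma interval_familyI:
  assumes "finite I" "\<And>a b. (a, b) \<in> I \<Longrightarrow> s \<le> a \<and> a < b \<and> b \<le> t"
    "\<And>a b c d. (a, b) \<in> I \<Longrightarrow> (c, d) \<in> I \<Longrightarrow> (a, b) \<noteq> (c, d) \<Longrightarrow> {a<..<b} \<inter> {c<..<d} = {}"
  shows "interval_family s t I"
proof -
  have "pairwise (\<lambda>(a, b) (c, d). {a<..<b} \<inter> {c<..<d} = {}) I"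
  proof (rule pairwiseI)
    fix i j assume "i \<in> I" "j \<in> I" "i \<noteq> j"
    then show "(case i of (a, b) \<Rightarrow> \<lambda>(c, d). {a<..<b} \<inter> {c<..<d} = {}) j"
      using assms(3)[of "fst i" "snd i" "fst j" "snd j"] by (simp add: prod_eq_iff case_prod_beta)
  qed
  then show ?thesis using assms(1,2) unfolding interval_family_def by blast
qed

lemma interval_family_length:
  assumes "interval_family s t I" "s \<le> t"
  shows "total_length I \<le> t - s"
proof -
  have fin: "finite I" using assms by (rule_tac interval_family_finite)
  have "total_length I = (\<Sum>i\<in>I. measure lebesgue {fst i<..<snd i})"
    by (rule sum.cong) (auto dest: interval_familyD[OF assms(1)])
  also have "\<dots> = measure lebesgue (\<Union>i\<in>I. {fst i<..<snd i})"
    by (rule measure_UNION'[symmetric, OF fin])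
       (use interval_family_disjoint[OF assms(1)] in \<open>force simp: pairwise_def disjnt_def\<close>)+
  also have "\<dots> \<le> measure lebesgue {s..t}"
    by (rule measure_mono_fmeasurable)
       (use interval_familyD[OF assms(1)] fin in \<open>fastforce intro!: sets.finite_UN\<close>)+
  finally show ?thesis using assms by simp
qed

text \<open>
  If \<open>S\<close> is not negligible, sets covering it have measure at least some \<open>e > 0\<close>, and by Vitali's
  covering theorem every fine cover by intervals contains finitely many disjoint ones of total
  length above \<open>e / 2\<close>. The bound depends on \<open>S\<close> alone, so it may be fixed before the property \<open>P\<close>
  that defines the cover is chosen.
\<close>
lemma vitali_finite_subfamily:
  fixes S :: "real set"
  assumes "\<not> negligible S"
  obtains \<eta> where "\<eta> > 0"
    "\<And>Z P s t. negligible Z \<Longrightarrow>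
       (\<And>x e. x \<in> S - Z \<Longrightarrow> 0 < e \<Longrightarrow> \<exists>u v. s \<le> u \<and> u < v \<and> v \<le> t \<and> x \<in> {u..v} \<and> v - u < e \<and> P u v) \<Longrightarrow>
       \<exists>Q. interval_family s t Q \<and> (\<forall>(u, v)\<in>Q. P u v) \<and>
           pairwise (\<lambda>(a, b) (c, d). {a..b} \<inter> {c..d} = {}) Q \<and> total_length Q > \<eta>"
proof -
  obtain e where e: "e > 0" "\<And>T. S \<subseteq> T \<Longrightarrow> T \<in> lmeasurable \<Longrightarrow> measure lebesgue T \<ge> e"
    using assms by (auto simp: negligible_outer not_less)
  show ?thesis
  proof (rule that[of "e / 2"])
    show "e / 2 > 0" using e by simp
    fix Z :: "real set" and P s t
    assume Z: "negligible Z"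
      and fine: "\<And>x e. x \<in> S - Z \<Longrightarrow> 0 < e \<Longrightarrow> \<exists>u v. s \<le> u \<and> u < v \<and> v \<le> t \<and> x \<in> {u..v} \<and> v - u < e \<and> P u v"
    define K where "K = {(u, v). s \<le> u \<and> u < v \<and> v \<le> t \<and> P u v}"
    define m where "m = (\<lambda>(u, v). (u + v) / (2::real))"
    define r where "r = (\<lambda>(u, v). (v - u) / (2::real))"
    have cb: "cball (m i) (r i) = {fst i..snd i}" for i
      by (cases i) (simp add: m_def r_def cball_eq_atLeastAtMost field_simps)
    have cov: "\<exists>i. i \<in> K \<and> x \<in> cball (m i) (r i) \<and> r i < d" if "x \<in> S - Z" "0 < d" for x d
    proof -
      obtain u v where "s \<le> u \<and> u < v \<and> v \<le> t \<and> x \<in> {u..v} \<and> v - u < d \<and> P u v"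
        using fine \<open>x \<in> S - Z\<close> \<open>0 < d\<close> by blast
      then show ?thesis
        unfolding cb by (intro exI[of _ "(u, v)"]) (auto simp: K_def r_def)
    qed
    have rpos: "0 < r i" if "i \<in> K" for i using that by (auto simp: K_def r_def)
    obtain C where C: "countable C" "C \<subseteq> K"
        "pairwise (\<lambda>i j. disjnt (cball (m i) (r i)) (cball (m j) (r j))) C"
        "negligible (S - Z - (\<Union>i\<in>C. cball (m i) (r i)))"
      using Vitali_covering_theorem_cballs[OF rpos cov] by blast
    define D where "D = (\<lambda>i. {fst i..snd i}) ` C"
    have Dsub: "\<Union>D \<subseteq> {s..t}" using C(2) by (fastforce simp: D_def K_def)
    have Dc: "countable D" using C(1) by (simp add: D_def)
    have Dm: "\<Union>D \<in> lmeasurable"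
    proof (rule bounded_set_imp_lmeasurable)
      show "bounded (\<Union>D)" using Dsub bounded_closed_interval bounded_subset by blast
      show "\<Union>D \<in> sets lebesgue" using Dc by (intro sets.countable_Union) (auto simp: D_def)
    qed
    define N where "N = Z \<union> (S - Z - \<Union>D)"
    have neg: "negligible N"
      using negligible_Un[OF Z C(4)] unfolding D_def cb N_def .
    have cov: "S \<subseteq> \<Union>D \<union> N" unfolding N_def by blast
    have "e \<le> measure lebesgue (\<Union>D \<union> N)"
      by (rule e(2)[OF cov fmeasurable.Un[OF Dm negligible_imp_measurable[OF neg]]])
    also have "\<dots> = measure lebesgue (\<Union>D)"
      using neg Dm by (intro measure_Un_null_set) (auto simp: negligible_iff_null_sets fmeasurableD)
    finally have eD: "e \<le> measure lebesgue (\<Union>D)" .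
    have bound: "measure lebesgue (\<Union>D') \<le> measure lebesgue {s..t}" if "D' \<subseteq> D" "finite D'" for D'
      using that Dsub by (intro measure_mono_fmeasurable sets.finite_Union) (auto simp: D_def)
    have "d \<in> lmeasurable" if "d \<in> D" for d using that by (auto simp: D_def)
    then obtain D' where D': "D' \<subseteq> D" "finite D'" "measure lebesgue (\<Union>D) - e / 2 < measure lebesgue (\<Union>D')"
      using measure_countable_Union_approachable[OF Dc half_gt_zero[OF e(1)] _ bound] by blast
    obtain Q where Q: "Q \<subseteq> C" "finite Q" "D' = (\<lambda>i. {fst i..snd i}) ` Q"
      using finite_subset_image[OF D'(2) D'(1)[unfolded D_def]] by blast
    have dj: "pairwise (\<lambda>i j. disjnt {fst i..snd i} {fst j..snd j}) Q"
      using pairwise_subset[OF C(3) Q(1)] unfolding cb .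
    have dj2: "{a..b} \<inter> {c..d} = {}" if "(a, b) \<in> Q" "(c, d) \<in> Q" "(a, b) \<noteq> (c, d)" for a b c d
      using pairwiseD[OF dj that] by (simp add: disjnt_def)
    have QK: "s \<le> u \<and> u < v \<and> v \<le> t \<and> P u v" if "(u, v) \<in> Q" for u v
      using that Q(1) C(2) unfolding K_def by blast
    have "total_length Q = (\<Sum>i\<in>Q. measure lebesgue {fst i..snd i})"
      by (intro sum.cong) (auto dest: QK)
    also have "\<dots> = measure lebesgue (\<Union>D')"
      using measure_UNION'[OF Q(2) _ dj, of lebesgue] Q(3) by simp
    finally have "total_length Q > e / 2" using D'(3) eD by simp
    moreover have "interval_family s t Q"
    proof (rule interval_familyI)
      fix a b c d assume "(a, b) \<in> Q" "(c, d) \<in> Q" "(a, b) \<noteq> (c, d)"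
      from dj2[OF this] show "{a<..<b} \<inter> {c<..<d} = {}"
        by (auto simp: disjoint_iff)
    qed (use Q(2) QK in auto)
    moreover have "pairwise (\<lambda>(a, b) (c, d). {a..b} \<inter> {c..d} = {}) Q"
      using pairwiseD[OF dj] by (intro pairwiseI) (simp add: disjnt_def case_prod_beta)
    moreover have "\<forall>(u, v)\<in>Q. P u v" using QK by auto
    ultimately show "\<exists>Q. interval_family s t Q \<and> (\<forall>(u, v)\<in>Q. P u v) \<and>
           pairwise (\<lambda>(a, b) (c, d). {a..b} \<inter> {c..d} = {}) Q \<and> total_length Q > e / 2"
      by blast
  qed
qed

text \<open>
  The increment of \<open>F\<close> over \<open>[a, b]\<close> is the sum of its increments over the steps in \<open>Q\<close> and over the
  gaps between them. A step that descends must be regained elsewhere, so it adds twice its size to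
  the variation. The induction splits off the rightmost step.
\<close>
lemma decreasing_steps_add_variation:
  fixes F :: "real \<Rightarrow> real"
  assumes "finite Q" "\<And>u v. (u, v) \<in> Q \<Longrightarrow> a \<le> u \<and> u < v \<and> v \<le> b \<and> F v - F u \<le> - c * (v - u)"
    and "pairwise (\<lambda>(a, b) (c, d). {a..b} \<inter> {c..d} = {}) Q" and "a \<le> b"
  shows "\<exists>R. interval_family a b R \<and> F b - F a + 2 * c * total_length Q \<le> variation F R"
  using assms
proof (induction "card Q" arbitrary: Q b)
  case 0
  then have [simp]: "Q = {}" by simp
  show ?case
  proof (cases "a < b")
    case True
    then show ?thesis by (intro exI[of _ "{(a, b)}"]) (auto simp: interval_family_def)
  next
    case False
    then have "a = b" using 0 by simp
    then show ?thesis by (intro exI[of _ "{}"]) (auto simp: interval_family_def)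
  qed
next
  case (Suc n)
  then have ne: "snd ` Q \<noteq> {}" by auto
  obtain u v where uv: "(u, v) \<in> Q" "v = Max (snd ` Q)"
    using Max_in[OF _ ne] Suc.prems(1) by force
  have vmax: "d \<le> v" if "(c', d) \<in> Q" for c' d
    using that uv Suc.prems(1) by (metis Max_ge finite_imageI image_eqI snd_conv)
  define Q' where "Q' = Q - {(u, v)}"
  have Qeq: "Q = insert (u, v) Q'" "(u, v) \<notin> Q'" "finite Q'" using uv Suc.prems(1) by (auto simp: Q'_def)
  have auvb: "a \<le> u" "u < v" "v \<le> b" "F v - F u \<le> - c * (v - u)" using Suc.prems(2)[OF uv(1)] by auto
  have left: "d \<le> u" if "(c', d) \<in> Q'" for c' d
  proof -
    have q: "(c', d) \<in> Q" "(c', d) \<noteq> (u, v)" using that by (auto simp: Q'_def)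
    have "{c'..d} \<inter> {u..v} = {}"
      using Suc.prems(3) q uv(1) by (fastforce simp: pairwise_def)
    moreover have "c' < d" "d \<le> v" using Suc.prems(2)[OF q(1)] vmax q by auto
    ultimately show "d \<le> u" by (metis atLeastAtMost_iff disjoint_iff linorder_le_cases order_refl less_imp_le)
  qed
  have "\<exists>R. interval_family a u R \<and> F u - F a + 2 * c * total_length Q' \<le> variation F R"
  proof (rule Suc.hyps(1))
    show "n = card Q'" using Suc.hyps(2) Qeq by simp
    show "pairwise (\<lambda>(a, b) (c, d). {a..b} \<inter> {c..d} = {}) Q'"
      using Suc.prems(3) by (rule pairwise_subset) (auto simp: Q'_def)
    show "a \<le> x \<and> x < y \<and> y \<le> u \<and> F y - F x \<le> - c * (y - x)" if "(x, y) \<in> Q'" for x y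
      using Suc.prems(2)[of x y] left[OF that] that by (auto simp: Q'_def)
  qed (use Qeq auvb in auto)
  then obtain R where R: "interval_family a u R"
    "F u - F a + 2 * c * total_length Q' \<le> variation F R" by blast
  note RD = interval_familyD[OF R(1)]
  have finR: "finite R" using R(1) by (rule interval_family_finite)
  define R' where "R' = insert (u, v) R \<union> (if v < b then {(v, b)} else {})"
  have n1: "(u, v) \<notin> R" and n2: "(v, b) \<notin> insert (u, v) R" using RD auvb by fastforce+
  have sumR': "variation F R' = variation F R + \<bar>F v - F u\<bar> + \<bar>F b - F v\<bar>"
    using finR n1 n2 auvb by (auto simp: R'_def)
  have "interval_family a b R'"
  proof (rule interval_familyI)
    show "finite R'" using finR by (auto simp: R'_def)
    show "a \<le> x \<and> x < y \<and> y \<le> b" if "(x, y) \<in> R'" for x y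
      using that RD[of x y] auvb by (auto simp: R'_def split: if_splits)
    show "{x<..<y} \<inter> {x'<..<y'} = {}" if "(x, y) \<in> R'" "(x', y') \<in> R'" "(x, y) \<noteq> (x', y')" for x y x' y'
      using that RD[of x y] RD[of x' y'] auvb interval_family_disjoint[OF R(1), of x y x' y']
      by (auto simp: R'_def disjoint_iff split: if_splits)
  qed
  moreover have "F b - F a + 2 * c * total_length Q \<le> variation F R'"
    using R(2) auvb(4) Qeq unfolding sumR' by (simp add: algebra_simps)
  ultimately show ?case by blast
qed

lemma sum_UN_le:
  fixes f :: "'a \<Rightarrow> real"
  assumes "finite D" "\<And>i. i \<in> D \<Longrightarrow> finite (q i)" "\<And>i j. i \<in> D \<Longrightarrow> j \<in> q i \<Longrightarrow> 0 \<le> f j"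
  shows "sum f (\<Union>i\<in>D. q i) \<le> (\<Sum>i\<in>D. sum f (q i))"
  using assms
proof (induction D rule: finite_induct)
  case (insert i D)
  have "sum f (q i \<union> (\<Union>i\<in>D. q i)) = sum f (q i) + sum f (\<Union>i\<in>D. q i) - sum f (q i \<inter> (\<Union>i\<in>D. q i))"
    using insert by (intro sum_Un) auto
  moreover have "sum f (q i \<inter> (\<Union>i\<in>D. q i)) \<ge> 0" using insert by (intro sum_nonneg) auto
  ultimately show ?case using insert by fastforce
qed simp

text \<open>
  Suppose the set is not negligible, and let \<open>D\<close> be a family whose variation comes within \<open>c \<eta>\<close> of the
  supremum. In each interval of \<open>D\<close> insert disjoint steps that go against the increment over this
  interval, and outside \<open>D\<close> any steep steps. Their total length can be made larger than \<open>\<eta>\<close>, so the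
  refined family has variation above the supremum.
\<close>
lemma oscillation_negligible:
  fixes F :: "real \<Rightarrow> real"
  assumes BV: "\<And>I. interval_family s t I \<Longrightarrow> variation F I \<le> B"
    and c: "c > 0" and E: "E \<subseteq> {s<..<t}"
    and dn: "\<And>x e. x \<in> E \<Longrightarrow> e > 0 \<Longrightarrow> \<exists>u v. u < v \<and> x \<in> {u..v} \<and> v - u < e \<and> F v - F u \<le> - c * (v - u)"
    and up: "\<And>x e. x \<in> E \<Longrightarrow> e > 0 \<Longrightarrow> \<exists>u v. u < v \<and> x \<in> {u..v} \<and> v - u < e \<and> F v - F u \<ge> c * (v - u)"
  shows "negligible E"
proof (rule ccontr)
  assume "\<not> negligible E"
  then obtain \<eta> where eta: "\<eta> > 0" and
    vit: "\<And>Z P s t. negligible Z \<Longrightarrow>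
       (\<And>x e. x \<in> E - Z \<Longrightarrow> 0 < e \<Longrightarrow> \<exists>u v. s \<le> u \<and> u < v \<and> v \<le> t \<and> x \<in> {u..v} \<and> v - u < e \<and> P u v) \<Longrightarrow>
       \<exists>Q. interval_family s t Q \<and> (\<forall>(u, v)\<in>Q. P u v) \<and>
           pairwise (\<lambda>(a, b) (c, d). {a..b} \<inter> {c..d} = {}) Q \<and> total_length Q > \<eta>"
    by (rule vitali_finite_subfamily) blast
  define var where "var = (\<lambda>I. \<Sum>(a, b)\<in>I. \<bar>F b - F a\<bar>)"
  define V where "V = Sup (var ` {I. interval_family s t I})"
  have bdd: "bdd_above (var ` {I. interval_family s t I})"
    using BV by (auto simp: var_def intro!: bdd_aboveI2)
  have leV: "var I \<le> V" if "interval_family s t I" for I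
    unfolding V_def using that bdd by (auto intro!: cSup_upper)
  have "var ` {I. interval_family s t I} \<noteq> {}"
    by (auto simp: interval_family_def intro!: exI[of _ "{}"])
  then obtain D where D: "interval_family s t D" "var D > V - c * \<eta>"
    using less_cSup_iff[OF _ bdd, of "V - c * \<eta>"] c eta
    by (auto simp: V_def[symmetric])
  note DD = interval_familyD[OF D(1)]
  have finD: "finite D" using D(1) by (rule interval_family_finite)
  define Z where "Z = fst ` D \<union> snd ` D"
  have finZ: "finite Z" using finD by (simp add: Z_def)
  \<comment> \<open>inside an interval of D the increment goes against that of the interval; elsewhere any large increment does\<close>
  define P where "P = (\<lambda>u v. (\<exists>(a, b)\<in>D. a \<le> u \<and> v \<le> b \<and>
       (if F a \<le> F b then F v - F u \<le> - c * (v - u) else F v - F u \<ge> c * (v - u))) \<or>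
       ((\<forall>(a, b)\<in>D. {a<..<b} \<inter> {u<..<v} = {}) \<and> F v - F u \<ge> c * (v - u)))"
  have fine: "\<exists>u v. s \<le> u \<and> u < v \<and> v \<le> t \<and> x \<in> {u..v} \<and> v - u < e \<and> P u v"
    if x: "x \<in> E - Z" and e: "0 < e" for x e
  proof -
    have xst: "s < x" "x < t" using x E by auto
    show ?thesis
    proof (cases "\<exists>(a, b)\<in>D. x \<in> {a<..<b}")
      case True
      then obtain a b where ab: "(a, b) \<in> D" "a < x" "x < b" by auto
      define e' where "e' = Min {e, x - a, b - x}"
      have e': "e' > 0" "e' \<le> e" "e' \<le> x - a" "e' \<le> b - x" using e ab by (auto simp: e'_def)
      have "\<exists>u v. u < v \<and> x \<in> {u..v} \<and> v - u < e' \<and>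
         (if F a \<le> F b then F v - F u \<le> - c * (v - u) else F v - F u \<ge> c * (v - u))"
        using dn[of x e'] up[of x e'] x e'(1) by auto
      then obtain u v where uv: "u < v" "x \<in> {u..v}" "v - u < e'"
         "if F a \<le> F b then F v - F u \<le> - c * (v - u) else F v - F u \<ge> c * (v - u)" by blast
      have "a \<le> u" "v \<le> b" using uv e' by auto
      then have "P u v" unfolding P_def using ab(1) uv(4) by blast
      with uv e' DD[OF ab(1)] \<open>a \<le> u\<close> \<open>v \<le> b\<close> show ?thesis
        by (intro exI[of _ u] exI[of _ v]) auto
    next
      case False
      have "open (- (\<Union>(a, b)\<in>D. {a..b}))"
        using finD by (intro open_Compl closed_UN) auto
      moreover have "x \<notin> {a..b}" if "(a, b) \<in> D" for a b
        using False x that by (force simp: Z_def image_iff)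
      then have "x \<in> - (\<Union>(a, b)\<in>D. {a..b})" by auto
      ultimately obtain d where d: "d > 0" "ball x d \<subseteq> - (\<Union>(a, b)\<in>D. {a..b})"
        by (meson open_contains_ball)
      define e' where "e' = Min {e, d, x - s, t - x}"
      have e': "e' > 0" "e' \<le> e" "e' \<le> d" "e' \<le> x - s" "e' \<le> t - x" using e d xst by (auto simp: e'_def)
      obtain u v where uv: "u < v" "x \<in> {u..v}" "v - u < e'" "F v - F u \<ge> c * (v - u)"
        using up[of x e'] x e'(1) by auto
      have sub: "{u<..<v} \<subseteq> ball x d" using uv e' by (auto simp: dist_real_def)
      have "{a<..<b} \<inter> {u<..<v} = {}" if "(a, b) \<in> D" for a b
      proof -
        have "{a..b} \<subseteq> (\<Union>(a, b)\<in>D. {a..b})" using that by blast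
        then have "{a<..<b} \<subseteq> (\<Union>(a, b)\<in>D. {a..b})"
          using greaterThanLessThan_subseteq_atLeastAtMost_iff[of a b a b] by blast
        then show ?thesis using sub d(2) by blast
      qed
      then have "P u v" unfolding P_def using uv(4) by blast
      with uv e' show ?thesis by (intro exI[of _ u] exI[of _ v]) auto
    qed
  qed
  obtain Q where Q: "interval_family s t Q" "\<forall>(u, v)\<in>Q. P u v"
     "pairwise (\<lambda>(a, b) (c, d). {a..b} \<inter> {c..d} = {}) Q" "total_length Q > \<eta>"
    using vit[OF negligible_finite[OF finZ] fine] by blast
  note QD = interval_familyD[OF Q(1)]
  have finQ: "finite Q" using Q(1) by (rule interval_family_finite)
  define q where "q = (\<lambda>i. {j \<in> Q. fst i \<le> fst j \<and> snd j \<le> snd i \<and> 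
     (if F (fst i) \<le> F (snd i) then F (snd j) - F (fst j) \<le> - c * (snd j - fst j) else F (snd j) - F (fst j) \<ge> c * (snd j - fst j))})"
  define q0 where "q0 = {j \<in> Q. (\<forall>(a, b)\<in>D. {a<..<b} \<inter> {fst j<..<snd j} = {}) \<and> F (snd j) - F (fst j) \<ge> c * (snd j - fst j)}"
  have Qcov: "Q \<subseteq> q0 \<union> (\<Union>i\<in>D. q i)"
  proof
    fix j assume j: "j \<in> Q"
    then have "P (fst j) (snd j)" using Q(2) by auto
    then show "j \<in> q0 \<union> (\<Union>i\<in>D. q i)"
      unfolding P_def
    proof (elim disjE bexE)
      fix i assume i: "i \<in> D" and "case i of (a, b) \<Rightarrow> a \<le> fst j \<and> snd j \<le> b \<and>
       (if F a \<le> F b then F (snd j) - F (fst j) \<le> - c * (snd j - fst j) else F (snd j) - F (fst j) \<ge> c * (snd j - fst j))"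
      then have "j \<in> q i" using j by (auto simp: q_def split: prod.splits if_splits)
      then show ?thesis using i by blast
    next
      assume "(\<forall>(a, b)\<in>D. {a<..<b} \<inter> {fst j<..<snd j} = {}) \<and> c * (snd j - fst j) \<le> F (snd j) - F (fst j)"
      then have "j \<in> q0" using j by (simp add: q0_def)
      then show ?thesis by blast
    qed
  qed
  define len where "len = (\<lambda>I. \<Sum>(u, v)\<in>I. v - (u::real))"
  have ex: "\<exists>R. interval_family (fst i) (snd i) R \<and> \<bar>F (snd i) - F (fst i)\<bar> + 2 * c * len (q i) \<le> var R" if "i \<in> D" for i
  proof -
    have le: "fst i \<le> snd i" using DD[of "fst i" "snd i"] that by simp
    have pw: "pairwise (\<lambda>(a, b) (c, d). {a..b} \<inter> {c..d} = {}) (q i)"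
      using Q(3) by (rule pairwise_subset) (auto simp: q_def)
    have fq: "finite (q i)" using finQ by (simp add: q_def)
    show ?thesis
    proof (cases "F (fst i) \<le> F (snd i)")
      case True
      have "\<exists>R. interval_family (fst i) (snd i) R \<and> 
         F (snd i) - F (fst i) + 2 * c * total_length (q i) \<le> variation F R"
        by (rule decreasing_steps_add_variation[OF fq _ pw le]) (use True QD in \<open>auto simp: q_def\<close>)
      then show ?thesis using True by (simp add: var_def len_def)
    next
      case False
      have "\<exists>R. interval_family (fst i) (snd i) R \<and> 
         (- F (snd i)) - (- F (fst i)) + 2 * c * total_length (q i) \<le> (\<Sum>(u, v)\<in>R. \<bar>(- F v) - (- F u)\<bar>)"
        by (rule decreasing_steps_add_variation[OF fq _ pw le, of "\<lambda>x. - F x"]) (use False QD in \<open>auto simp: q_def\<close>)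
      then show ?thesis using False by (simp add: var_def len_def abs_minus_commute)
    qed
  qed
  then obtain R where R: "\<And>i. i \<in> D \<Longrightarrow> interval_family (fst i) (snd i) (R i)"
     "\<And>i. i \<in> D \<Longrightarrow> \<bar>F (snd i) - F (fst i)\<bar> + 2 * c * len (q i) \<le> var (R i)" by metis
  define W where "W = q0 \<union> (\<Union>i\<in>D. R i)"
  have finR: "finite (R i)" if "i \<in> D" for i using R(1)[OF that] by (rule interval_family_finite)
  have finq: "finite (q i)" "finite q0" for i using finQ by (auto simp: q_def q0_def)
  have RDsub: "fst i \<le> u \<and> u < v \<and> v \<le> snd i" if "(u, v) \<in> R i" "i \<in> D" for i u v
    using interval_familyD[OF R(1)[OF that(2)] that(1)] .
  have cross: "{u<..<v} \<inter> {u'<..<v'} = {}" if "i \<in> D" "i' \<in> D" "i \<noteq> i'" "(u, v) \<in> R i" "(u', v') \<in> R i'" for i i' u v u' v'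
  proof -
    have "{fst i<..<snd i} \<inter> {fst i'<..<snd i'} = {}"
      using interval_family_disjoint[OF D(1), of "fst i" "snd i" "fst i'" "snd i'"] that by (simp add: prod_eq_iff)
    moreover have "{u<..<v} \<subseteq> {fst i<..<snd i}" "{u'<..<v'} \<subseteq> {fst i'<..<snd i'}"
      using RDsub[OF that(4,1)] RDsub[OF that(5,2)] by auto
    ultimately show ?thesis by blast
  qed
  have cross0: "{u<..<v} \<inter> {u'<..<v'} = {}" if "i \<in> D" "(u, v) \<in> R i" "(u', v') \<in> q0" for i u v u' v'
  proof -
    have "{fst i<..<snd i} \<inter> {u'<..<v'} = {}"
      using that unfolding q0_def by (auto split: prod.splits)
    moreover have "{u<..<v} \<subseteq> {fst i<..<snd i}" using RDsub[OF that(2,1)] by auto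
    ultimately show ?thesis by blast
  qed
  have W: "interval_family s t W"
  proof (rule interval_familyI)
    show "finite W" using finR finq finD by (auto simp: W_def)
    show "s \<le> a \<and> a < b \<and> b \<le> t" if ab: "(a, b) \<in> W" for a b
    proof (cases "(a, b) \<in> q0")
      case True then show ?thesis using QD by (auto simp: q0_def)
    next
      case False
      then obtain i where i: "i \<in> D" "(a, b) \<in> R i" using ab by (auto simp: W_def)
      show ?thesis using RDsub[OF i(2,1)] DD[of "fst i" "snd i"] i(1) by auto
    qed
    show "{a<..<b} \<inter> {x<..<y} = {}" if w: "(a, b) \<in> W" "(x, y) \<in> W" "(a, b) \<noteq> (x, y)" for a b x y
    proof -
      consider "(a, b) \<in> q0" "(x, y) \<in> q0" | i where "i \<in> D" "(a, b) \<in> R i" "(x, y) \<in> q0"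
        | i where "i \<in> D" "(x, y) \<in> R i" "(a, b) \<in> q0"
        | i i' where "i \<in> D" "(a, b) \<in> R i" "i' \<in> D" "(x, y) \<in> R i'"
        using w(1,2) unfolding W_def by blast
      then show ?thesis
      proof cases
        case 1
        then show ?thesis using interval_family_disjoint[OF Q(1), of a b x y] w by (auto simp: q0_def)
      next
        case 2 then show ?thesis using cross0 by blast
      next
        case 3 then show ?thesis using cross0[of _ x y a b] by (simp add: Int_commute)
      next
        case (4 i i')
        then show ?thesis
          using cross interval_family_disjoint[OF R(1), of i a b x y] w by (cases "i = i'") auto
      qed
    qed
  qed
  have dj: "R i \<inter> R j = {}" if ij: "i \<in> D" "j \<in> D" "i \<noteq> j" for i j
  proof (rule ccontr)
    assume "R i \<inter> R j \<noteq> {}"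
    then obtain u v where uv: "(u, v) \<in> R i" "(u, v) \<in> R j" by auto
    have "{u<..<v} = {}" using cross[OF ij uv] by simp
    then show False using RDsub[OF uv(1) ij(1)] by simp
  qed
  have dj0: "q0 \<inter> (\<Union>i\<in>D. R i) = {}"
  proof (rule ccontr)
    assume "q0 \<inter> (\<Union>i\<in>D. R i) \<noteq> {}"
    then obtain u v i where uv: "i \<in> D" "(u, v) \<in> R i" "(u, v) \<in> q0" by auto
    have "{u<..<v} = {}" using cross0[OF uv] by simp
    then show False using RDsub[OF uv(2,1)] by simp
  qed
  have "var W = var q0 + var (\<Union>i\<in>D. R i)"
    unfolding W_def var_def using finR finq finD dj0 by (intro sum.union_disjoint) auto
  also have "var (\<Union>i\<in>D. R i) = (\<Sum>i\<in>D. var (R i))"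
    unfolding var_def using finD finR dj by (intro sum.UNION_disjoint) auto
  finally have varW: "var W = var q0 + (\<Sum>i\<in>D. var (R i))" .
  have "c * len q0 = (\<Sum>j\<in>q0. c * (snd j - fst j))"
    by (simp add: len_def sum_distrib_left case_prod_beta)
  also have "\<dots> \<le> var q0"
    unfolding var_def by (rule sum_mono) (auto simp: q0_def)
  finally have v0: "c * len q0 \<le> var q0" .
  have nn: "0 \<le> snd j - fst j" if "j \<in> Q" for j using QD[of "fst j" "snd j"] that by simp
  have lenq: "0 \<le> len (q i)" for i unfolding len_def case_prod_beta by (rule sum_nonneg) (use nn in \<open>auto simp: q_def\<close>)
  have "len Q \<le> len (q0 \<union> (\<Union>i\<in>D. q i))"
    unfolding len_def case_prod_beta
    using finq finD Qcov nn by (intro sum_mono2) (auto simp: q_def q0_def)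
  also have "\<dots> \<le> len q0 + len (\<Union>i\<in>D. q i)"
    unfolding len_def case_prod_beta
    by (subst sum_Un) (use finq finD nn in \<open>auto intro!: sum_nonneg simp: q0_def\<close>)
  also have "len (\<Union>i\<in>D. q i) \<le> (\<Sum>i\<in>D. len (q i))"
    unfolding len_def case_prod_beta
    by (rule sum_UN_le) (use finq finD nn in \<open>auto simp: q_def\<close>)
  finally have lenQ: "len Q \<le> len q0 + (\<Sum>i\<in>D. len (q i))" by simp
  have "V \<ge> var W" using leV[OF W] .
  also have "var W \<ge> c * len q0 + (\<Sum>i\<in>D. \<bar>F (snd i) - F (fst i)\<bar> + 2 * c * len (q i))"
    unfolding varW using v0 R(2) by (intro add_mono sum_mono)
  also have "c * len q0 + (\<Sum>i\<in>D. \<bar>F (snd i) - F (fst i)\<bar> + 2 * c * len (q i))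
     = var D + c * (len q0 + (\<Sum>i\<in>D. len (q i))) + c * (\<Sum>i\<in>D. len (q i))"
    by (simp add: var_def sum.distrib case_prod_beta algebra_simps sum_distrib_left)
  also have "\<dots> \<ge> var D + c * len Q + 0"
    using lenQ c lenq by (intro add_mono mult_left_mono mult_nonneg_nonneg sum_nonneg) auto
  finally have "V \<ge> var D + c * len Q" by simp
  moreover have "c * len Q > c * \<eta>" using Q(4) c by (simp add: len_def)
  ultimately show False using D(2) by simp
qed

text \<open>
  Disjoint intervals of total length above \<open>\<eta>\<close> on which all slopes are at least \<open>M\<close> produce a
  variation above \<open>M \<eta>\<close>, which exceeds every bound as \<open>M\<close> grows.
\<close>
lemma infinite_slope_negligible:
  fixes F :: "real \<Rightarrow> real"
  assumes BV: "\<And>I. interval_family s t I \<Longrightarrow> variation F I \<le> B"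
    and E: "E \<subseteq> {s<..<t}"
    and slope: "\<And>x e M. x \<in> E \<Longrightarrow> e > 0 \<Longrightarrow> \<exists>u v. u < v \<and> x \<in> {u..v} \<and> v - u < e \<and> \<bar>F v - F u\<bar> \<ge> M * (v - u)"
  shows "negligible E"
proof (rule ccontr)
  assume "\<not> negligible E"
  then obtain \<eta> where eta: "\<eta> > 0" and
    vit: "\<And>Z P s t. negligible Z \<Longrightarrow>
       (\<And>x e. x \<in> E - Z \<Longrightarrow> 0 < e \<Longrightarrow> \<exists>u v. s \<le> u \<and> u < v \<and> v \<le> t \<and> x \<in> {u..v} \<and> v - u < e \<and> P u v) \<Longrightarrow>
       \<exists>Q. interval_family s t Q \<and> (\<forall>(u, v)\<in>Q. P u v) \<and>
           pairwise (\<lambda>(a, b) (c, d). {a..b} \<inter> {c..d} = {}) Q \<and> total_length Q > \<eta>"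
    by (rule vitali_finite_subfamily) blast
  define M where "M = (\<bar>B\<bar> + 1) / \<eta>"
  have M: "M > 0" "M * \<eta> = \<bar>B\<bar> + 1" using eta by (auto simp: M_def)
  have fine: "\<exists>u v. s \<le> u \<and> u < v \<and> v \<le> t \<and> x \<in> {u..v} \<and> v - u < e \<and> \<bar>F v - F u\<bar> \<ge> M * (v - u)"
    if "x \<in> E - {}" "0 < e" for x e
  proof -
    define e' where "e' = Min {e, x - s, t - x}"
    have e': "e' > 0" "e' \<le> e" "e' \<le> x - s" "e' \<le> t - x" using that E by (auto simp: e'_def)
    have xE: "x \<in> E" using that(1) by simp
    obtain u v where uv: "u < v" "x \<in> {u..v}" "v - u < e'" "\<bar>F v - F u\<bar> \<ge> M * (v - u)"
      using slope[OF xE e'(1), of M] by (elim exE conjE) (rule that)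
    then show ?thesis using e' by (intro exI[of _ u] exI[of _ v]) auto
  qed
  obtain Q where Q: "interval_family s t Q" "\<forall>(u, v)\<in>Q. \<bar>F v - F u\<bar> \<ge> M * (v - u)" "total_length Q > \<eta>"
  proof -
    define P where "P = (\<lambda>u v. \<bar>F v - F u\<bar> \<ge> M * (v - u))"
    have "\<exists>u v. s \<le> u \<and> u < v \<and> v \<le> t \<and> x \<in> {u..v} \<and> v - u < e \<and> P u v"
      if "x \<in> E - {}" "0 < e" for x e using fine[OF that] unfolding P_def .
    from vit[OF negligible_empty this] obtain Q where
      "interval_family s t Q" "\<forall>(u, v)\<in>Q. P u v" "total_length Q > \<eta>" by blast
    then show ?thesis by (intro that) (simp_all only: P_def)
  qed
  have "\<bar>B\<bar> + 1 < M * total_length Q" using M Q(3) by (metis mult_less_cancel_left_pos)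
  also have "\<dots> = (\<Sum>(u, v)\<in>Q. M * (v - u))" by (simp add: sum_distrib_left case_prod_beta)
  also have "\<dots> \<le> variation F Q" using Q(2) by (intro sum_mono) auto
  also have "\<dots> \<le> B" using BV[OF Q(1)] .
  finally show False by simp
qed

lemma frequently_slope_interval:
  fixes F :: "real \<Rightarrow> real"
  assumes "\<exists>\<^sub>F y in at x. R ((F y - F x) / (y - x))" "e > 0"
  obtains u v where "u < v" "x \<in> {u..v}" "v - u < e" "R ((F v - F u) / (v - u))"
proof -
  obtain y where y: "y \<noteq> x" "dist y x < e" "R ((F y - F x) / (y - x))"
    using assms unfolding frequently_def eventually_at by auto
  show thesis
  proof (cases "x < y")
    case True
    then show ?thesis using y by (intro that[of x y]) (auto simp: dist_real_def)
  next
    case False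
    have "(F y - F x) / (y - x) = (F x - F y) / (x - y)"
      using y(1) by (simp add: divide_simps) (simp add: algebra_simps)
    then show ?thesis using y False by (intro that[of y x]) (auto simp: dist_real_def)
  qed
qed

text \<open>
  Where the derivative does not exist, either the difference quotients are unbounded, or their lower
  and upper limits are separated by two rational numbers \<open>p < q\<close>. Subtracting a line of slope
  \<open>(p + q) / 2\<close> turns the second alternative into the oscillation treated above, and there are only
  countably many pairs \<open>(p, q)\<close>.
\<close>
lemma bounded_variation_differentiable_AE:
  fixes F :: "real \<Rightarrow> real"
  assumes BV: "\<And>I. interval_family s t I \<Longrightarrow> variation F I \<le> B"
  shows "negligible {x \<in> {s<..<t}. \<not> F differentiable (at x)}"
proof -
  define sl where "sl = (\<lambda>x y. (F y - F x) / (y - x))"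
  define E where "E = (\<lambda>(p::real, q::real). {x \<in> {s<..<t}. (\<exists>\<^sub>F y in at x. sl x y < p) \<and> (\<exists>\<^sub>F y in at x. sl x y > q)})"
  define E' where "E' = {x \<in> {s<..<t}. \<forall>M. \<exists>\<^sub>F y in at x. \<bar>sl x y\<bar> \<ge> M}"
  have negE: "negligible (E (p, q))" if "p < q" for p q
  proof (cases "s \<le> t")
    case False
    then show ?thesis by (simp add: E_def)
  next
    case True
    define m where "m = (p + q) / 2"
    define c where "c = (q - p) / 2"
    define G where "G = (\<lambda>x. F x - m * x)"
    have c: "c > 0" using that by (simp add: c_def)
    show ?thesis
    proof (rule oscillation_negligible[of s t G "B + \<bar>m\<bar> * (t - s)" c])
      fix I assume I: "interval_family s t I"
      have "variation G I \<le> (\<Sum>(a, b)\<in>I. \<bar>F b - F a\<bar> + \<bar>m\<bar> * (b - a))"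
      proof (intro sum_mono, clarify)
        fix a b assume "(a, b) \<in> I"
        then have "a < b" using interval_familyD[OF I] by blast
        then have "\<bar>m\<bar> * (b - a) = \<bar>m * (b - a)\<bar>" by (simp add: abs_mult)
        then show "\<bar>G b - G a\<bar> \<le> \<bar>F b - F a\<bar> + \<bar>m\<bar> * (b - a)"
          by (simp add: G_def algebra_simps)
      qed
      also have "\<dots> = variation F I + \<bar>m\<bar> * total_length I"
        by (simp add: case_prod_beta sum.distrib sum_distrib_left)
      also have "\<dots> \<le> B + \<bar>m\<bar> * (t - s)"
        using BV[OF I] interval_family_length[OF I True] by (intro add_mono mult_left_mono) auto
      finally show "variation G I \<le> B + \<bar>m\<bar> * (t - s)" .
    next
      fix x e :: real assume x: "x \<in> E (p, q)" and e: "e > 0"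
      have f: "\<exists>\<^sub>F y in at x. (F y - F x) / (y - x) < p" "\<exists>\<^sub>F y in at x. (F y - F x) / (y - x) > q"
        using x by (auto simp: E_def sl_def)
      obtain u v where uv: "u < v" "x \<in> {u..v}" "v - u < e" "(F v - F u) / (v - u) < p"
        using frequently_slope_interval[OF f(1) e] .
      have "F v - F u \<le> p * (v - u)" using uv by (simp add: divide_less_eq)
      then have "G v - G u \<le> - c * (v - u)" by (simp add: G_def m_def c_def field_simps)
      then show "\<exists>u v. u < v \<and> x \<in> {u..v} \<and> v - u < e \<and> G v - G u \<le> - c * (v - u)" using uv by blast
      obtain u v where uv: "u < v" "x \<in> {u..v}" "v - u < e" "(F v - F u) / (v - u) > q"
        using frequently_slope_interval[OF f(2) e] .
      have "F v - F u \<ge> q * (v - u)" using uv by (simp add: less_divide_eq)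
      then have "G v - G u \<ge> c * (v - u)" by (simp add: G_def m_def c_def field_simps)
      then show "\<exists>u v. u < v \<and> x \<in> {u..v} \<and> v - u < e \<and> G v - G u \<ge> c * (v - u)" using uv by blast
    qed (use c in \<open>auto simp: E_def\<close>)
  qed
  have negE': "negligible E'"
  proof (rule infinite_slope_negligible[of s t F B])
    fix x e M :: real assume x: "x \<in> E'" and e: "e > 0"
    have f: "\<exists>\<^sub>F y in at x. \<bar>(F y - F x) / (y - x)\<bar> \<ge> M" using x by (auto simp: E'_def sl_def)
    obtain u v where uv: "u < v" "x \<in> {u..v}" "v - u < e" "\<bar>(F v - F u) / (v - u)\<bar> \<ge> M"
      using frequently_slope_interval[of "\<lambda>z. \<bar>z\<bar> \<ge> M" F x, OF f e] .
    then have "\<bar>F v - F u\<bar> \<ge> M * (v - u)" by (simp add: le_divide_eq abs_divide)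
    then show "\<exists>u v. u < v \<and> x \<in> {u..v} \<and> v - u < e \<and> \<bar>F v - F u\<bar> \<ge> M * (v - u)"
      using uv(1-3) by (intro exI[of _ u] exI[of _ v]) simp
  qed (use BV in \<open>auto simp: E'_def\<close>)
  define T where "T = {(p, q). p \<in> \<rat> \<and> q \<in> \<rat> \<and> p < (q::real)}"
  \<comment> \<open>the pairs of rational bounds for which the lower and the upper limit are separated\<close>
  have "T \<subseteq> \<rat> \<times> \<rat>" by (auto simp: T_def)
  then have "countable T" by (rule countable_subset) (intro countable_SIGMA countable_rat)
  then have "negligible (\<Union>(E ` T))"
    by (intro negligible_countable_Union countable_image) (auto simp: T_def intro: negE)
  then have neg: "negligible (E' \<union> \<Union>(E ` T))" using negE' by (rule negligible_Un[rotated])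
  have "F differentiable (at x)" if x: "x \<in> {s<..<t}" "x \<notin> E' \<union> \<Union>(E ` T)" for x
  proof -
    obtain M where M: "\<forall>\<^sub>F y in at x. \<bar>sl x y\<bar> < M"
      using x by (auto simp: E'_def not_frequently not_le)
    define l where "l = Liminf (at x) (\<lambda>y. ereal (sl x y))"
    define u where "u = Limsup (at x) (\<lambda>y. ereal (sl x y))"
    have "l \<le> u" unfolding l_def u_def by (rule Liminf_le_Limsup) simp
    have lM: "ereal (- M) \<le> l" unfolding l_def using M by (intro Liminf_bounded) (auto elim: eventually_mono)
    have uM: "u \<le> ereal M" unfolding u_def using M by (intro Limsup_bounded) (auto elim: eventually_mono)
    have "\<not> l < u"
    proof
      assume "l < u"
      moreover obtain a b where ab: "l = ereal a" "u = ereal b"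
        using \<open>l < u\<close> lM uM by (cases l; cases u) auto
      ultimately have "a < b" by simp
      then obtain p where p: "p \<in> \<rat>" "a < p" "p < b" using Rats_dense_in_real by blast
      then obtain q where q: "q \<in> \<rat>" "p < q" "q < b" using Rats_dense_in_real by blast
      have "\<exists>\<^sub>F y in at x. sl x y < p"
      proof (rule ccontr)
        assume "\<not> ?thesis"
        then have "\<forall>\<^sub>F y in at x. ereal p \<le> ereal (sl x y)" by (simp add: not_frequently not_less)
        then have "ereal p \<le> l" unfolding l_def by (rule Liminf_bounded)
        then show False using p ab by simp
      qed
      moreover have "\<exists>\<^sub>F y in at x. sl x y > q"
      proof (rule ccontr)
        assume "\<not> ?thesis"
        then have "\<forall>\<^sub>F y in at x. ereal (sl x y) \<le> ereal q" by (simp add: not_frequently not_less)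
        then have "u \<le> ereal q" unfolding u_def by (rule Limsup_bounded)
        then show False using q ab by simp
      qed
      ultimately have "x \<in> E (p, q)" using x by (auto simp: E_def)
      then show False using x(2) p q by (auto simp: T_def)
    qed
    then have lu: "l = u" using \<open>l \<le> u\<close> by simp
    obtain d where d: "l = ereal d" using lu lM uM by (cases l) auto
    have "((\<lambda>y. ereal (sl x y)) \<longlongrightarrow> ereal d) (at x)"
      using lu d unfolding l_def u_def by (simp add: tendsto_iff_Liminf_eq_Limsup)
    then have "(sl x \<longlongrightarrow> d) (at x)" by simp
    then have "(F has_real_derivative d) (at x)"
      by (simp add: has_field_derivative_iff sl_def)
    then show ?thesis using real_differentiable_def by blast
  qed
  then have "{x \<in> {s<..<t}. \<not> F differentiable (at x)} \<subseteq> E' \<union> \<Union>(E ` T)" by blast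
  then show ?thesis using neg negligible_subset by blast
qed

lemma interval_family_mono:
  "interval_family s t I \<Longrightarrow> s' \<le> s \<Longrightarrow> t \<le> t' \<Longrightarrow> interval_family s' t' I"
  unfolding interval_family_def by fastforce

text \<open>
  On an interval shorter than the \<open>\<delta>\<close> that belongs to \<open>\<epsilon> = 1\<close>, every family is short enough for the
  definition of absolute continuity to apply to it directly.
\<close>
lemma abs_cont_locally_bounded_variation:
  assumes "abs_cont s t F"
  obtains \<delta> where "\<delta> > 0" "\<And>s' t' I. s \<le> s' \<Longrightarrow> s' \<le> t' \<Longrightarrow> t' \<le> t \<Longrightarrow> t' - s' < \<delta> \<Longrightarrow> interval_family s' t' I
     \<Longrightarrow> (\<Sum>(a, b)\<in>I. norm (F b - F a)) \<le> 1"
proof -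
  obtain \<delta> where d: "\<delta> > 0" "\<And>I. interval_family s t I \<and> total_length I < \<delta> \<Longrightarrow> (\<Sum>(a, b)\<in>I. norm (F b - F a)) < 1"
    using assms unfolding abs_cont_def by (metis zero_less_one)
  show thesis
  proof (rule that[OF d(1)])
    fix s' t' I assume h: "s \<le> s'" "s' \<le> t'" "t' \<le> t" "t' - s' < \<delta>" "interval_family s' t' I"
    have "interval_family s t I" using h by (auto intro: interval_family_mono)
    moreover have "total_length I < \<delta>" using interval_family_length[OF h(5,2)] h(4) by linarith
    ultimately show "(\<Sum>(a, b)\<in>I. norm (F b - F a)) \<le> 1" using d(2)[of I] by simp
  qed
qed

lemma abs_cont_real_differentiable_AE:
  fixes F :: "real \<Rightarrow> real"
  assumes "abs_cont s t F"
  shows "negligible {x \<in> {s<..<t}. \<not> F differentiable (at x)}"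
proof -
  obtain \<delta> where d: "\<delta> > 0" "\<And>s' t' I. s \<le> s' \<Longrightarrow> s' \<le> t' \<Longrightarrow> t' \<le> t \<Longrightarrow> t' - s' < \<delta> \<Longrightarrow> interval_family s' t' I
     \<Longrightarrow> (\<Sum>(a, b)\<in>I. norm (F b - F a)) \<le> 1"
    using abs_cont_locally_bounded_variation[OF assms] by metis
  define h where "h = \<delta> / 2"
  have h: "h > 0" using d by (simp add: h_def)
  define N where "N = (\<lambda>k::nat. {x \<in> {s + real k * h <..< min t (s + (real k + 1) * h)}. \<not> F differentiable (at x)})"
  have "negligible (N k)" for k
  proof (cases "s + real k * h \<le> t")
    case False
    then have "N k = {}" by (auto simp: N_def)
    then show ?thesis by simp
  next
    case True
    have "(real k + 1) * h = real k * h + h" by (simp add: algebra_simps)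
    moreover have "h < \<delta>" using d(1) by (simp add: h_def)
    ultimately have "min t (s + (real k + 1) * h) - (s + real k * h) < \<delta>" "s + real k * h \<le> min t (s + (real k + 1) * h)"
      using True h by linarith+
    then show ?thesis unfolding N_def
      using True d(2)[of "s + real k * h" "min t (s + (real k + 1) * h)"] h
      by (intro bounded_variation_differentiable_AE[where B = 1]) auto
  qed
  then have "negligible (\<Union>(range N))" by (intro negligible_countable_Union) auto
  moreover have "negligible (range (\<lambda>k::nat. s + real k * h))"
    by (auto simp: negligible_iff_null_sets intro!: null_sets_completionI countable_imp_null_set_lborel)
  ultimately have "negligible (\<Union>(range N) \<union> range (\<lambda>k::nat. s + real k * h))"
    by (rule negligible_Un)
  moreover have "{x \<in> {s<..<t}. \<not> F differentiable (at x)} \<subseteq> \<Union>(range N) \<union> range (\<lambda>k::nat. s + real k * h)"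
  proof clarify
    fix x assume x: "x \<in> {s<..<t}" "\<not> F differentiable (at x)" "x \<notin> range (\<lambda>k::nat. s + real k * h)"
    define k where "k = nat \<lfloor>(x - s) / h\<rfloor>"
    have nn: "0 \<le> (x - s) / h" using x h by simp
    have "real k \<le> (x - s) / h" "(x - s) / h < real k + 1"
      using nn unfolding k_def by linarith+
    then have "s + real k * h \<le> x" "x < s + (real k + 1) * h"
      using h by (simp_all add: field_simps)
    moreover have "x \<noteq> s + real k * h" using x(3) by auto
    ultimately have "x \<in> N k" using x by (auto simp: N_def)
    then show "x \<in> \<Union>(range N)" by blast
  qed
  ultimately show ?thesis using negligible_subset by blast
qed

lemma abs_cont_dominated:
  assumes "abs_cont s t F" "\<And>x y. norm (G x - G y) \<le> norm (F x - F y)"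
  shows "abs_cont s t G"
  unfolding abs_cont_def
proof (intro allI impI)
  fix e :: real assume "e > 0"
  then obtain d where d: "d > 0" "\<And>I. interval_family s t I \<and> total_length I < d \<Longrightarrow> (\<Sum>(a, b)\<in>I. norm (F b - F a)) < e"
    using assms(1) unfolding abs_cont_def by metis
  have "(\<Sum>(a, b)\<in>I. norm (G b - G a)) \<le> (\<Sum>(a, b)\<in>I. norm (F b - F a))" for I
    using assms(2) by (intro sum_mono) (auto simp: case_prod_beta)
  with d show "\<exists>d>0. \<forall>I. interval_family s t I \<and> total_length I < d \<longrightarrow> (\<Sum>(a, b)\<in>I. norm (G b - G a)) < e"
    by (meson le_less_trans)
qed

lemma abs_cont_differentiable_AE:
  fixes F :: "real \<Rightarrow> complex"
  assumes "abs_cont s t F"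
  shows "negligible {x \<in> {s<..<t}. \<not> F differentiable (at x)}"
proof -
  let ?R = "\<lambda>x. Re (F x)" and ?I = "\<lambda>x. Im (F x)"
  have "abs_cont s t ?R" "abs_cont s t ?I"
    by (rule abs_cont_dominated[OF assms]; metis abs_Re_le_cmod abs_Im_le_cmod minus_complex.simps real_norm_def)+
  then have neg: "negligible ({x \<in> {s<..<t}. \<not> ?R differentiable (at x)} \<union> {x \<in> {s<..<t}. \<not> ?I differentiable (at x)})"
    by (intro negligible_Un abs_cont_real_differentiable_AE)
  have "F differentiable (at x)" if RI: "?R differentiable (at x)" "?I differentiable (at x)" for x
  proof -
    obtain a b where ab: "(?R has_vector_derivative a) (at x)" "(?I has_vector_derivative b) (at x)"
      using RI[unfolded vector_derivative_works] by blast
    from ab[THEN bounded_linear.has_vector_derivative[OF bounded_linear_of_real]]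
    have "((\<lambda>x. complex_of_real (?R x) + \<i> * complex_of_real (?I x)) has_vector_derivative (of_real a + \<i> * of_real b)) (at x)"
      by (intro has_vector_derivative_add has_vector_derivative_mult_right)
    then show ?thesis
      unfolding complex_eq[symmetric] by (rule differentiableI_vector)
  qed
  then show ?thesis
    by (intro negligible_subset[OF neg]) blast
qed

text \<open>
  The straddle lemma of gauge integration: a derivative at \<open>x\<close> controls increments over all small
  intervals around \<open>x\<close>, not only over those with \<open>x\<close> as an end point.
\<close>
lemma straddle_inequality:
  fixes F :: "real \<Rightarrow> 'a::real_normed_vector"
  assumes "(F has_vector_derivative D) (at x)" "e > 0"
  obtains d where "d > 0" "\<And>u v. u \<le> x \<Longrightarrow> x \<le> v \<Longrightarrow> u \<in> ball x d \<Longrightarrow> v \<in> ball x d \<Longrightarrow>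
     norm ((v - u) *\<^sub>R D - (F v - F u)) \<le> e * (v - u)"
proof -
  obtain d where d: "d > 0" "\<And>y. norm (y - x) < d \<Longrightarrow> norm (F y - F x - (y - x) *\<^sub>R D) \<le> e * norm (y - x)"
    using assms unfolding has_vector_derivative_def has_derivative_at_alt by blast
  show thesis
  proof (rule that[OF d(1)])
    fix u v assume uv: "u \<le> x" "x \<le> v" "u \<in> ball x d" "v \<in> ball x d"
    have "norm (F u - F x - (u - x) *\<^sub>R D) \<le> e * (x - u)" "norm (F v - F x - (v - x) *\<^sub>R D) \<le> e * (v - x)"
      using d(2)[of u] d(2)[of v] uv by (auto simp: dist_real_def)
    moreover have eq: "(v - u) *\<^sub>R D - (F v - F u) = (F u - F x - (u - x) *\<^sub>R D) - (F v - F x - (v - x) *\<^sub>R D)"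
      by (simp add: algebra_simps)
    moreover have "norm ((F u - F x - (u - x) *\<^sub>R D) - (F v - F x - (v - x) *\<^sub>R D))
        \<le> norm (F u - F x - (u - x) *\<^sub>R D) + norm (F v - F x - (v - x) *\<^sub>R D)"
      by (rule norm_triangle_ineq4)
    ultimately have "norm ((v - u) *\<^sub>R D - (F v - F u)) \<le> e * (x - u) + e * (v - x)"
      unfolding eq by linarith
    then show "norm ((v - u) *\<^sub>R D - (F v - F u)) \<le> e * (v - u)" by (simp add: algebra_simps)
  qed
qed

lemma tagged_division_real_interval:
  fixes p :: "(real \<times> real set) set"
  assumes "p tagged_division_of {s..t}" "(x, K) \<in> p"
  shows "K = {Inf K..Sup K}" "Inf K \<le> x" "x \<le> Sup K" "s \<le> Inf K" "Sup K \<le> t" "measure lborel K = Sup K - Inf K"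
proof -
  obtain a b where ab: "K = cbox a b" using assms tagged_division_ofD(4) by blast
  moreover have xK: "x \<in> K" "K \<subseteq> {s..t}" using assms tagged_division_ofD(2,3) by blast+
  ultimately have "a \<le> b" "K = {a..b}" by auto
  moreover have "Inf K = a" "Sup K = b" using \<open>K = {a..b}\<close> \<open>a \<le> b\<close> by auto
  ultimately show "K = {Inf K..Sup K}" "Inf K \<le> x" "x \<le> Sup K" "s \<le> Inf K" "Sup K \<le> t" "measure lborel K = Sup K - Inf K"
    using xK by auto
qed

text \<open>
  Degenerate intervals of a tagged division carry no increment; dropping them and the tags yields a
  family in the sense of absolute continuity, with the same sums.
\<close>
lemma tagged_subfamily:
  fixes p :: "(real \<times> real set) set"
  assumes p: "p tagged_division_of {s..t}" and q: "q \<subseteq> p"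
  defines "I \<equiv> (\<lambda>(x, K). (Inf K, Sup K)) ` {i \<in> q. Inf (snd i) < Sup (snd i)}"
  shows "interval_family s t I"
    and "\<And>g :: real \<Rightarrow> real \<Rightarrow> 'a::comm_monoid_add. (\<And>u. g u u = 0) \<Longrightarrow> (\<Sum>(u, v)\<in>I. g u v) = (\<Sum>(x, K)\<in>q. g (Inf K) (Sup K))"
proof -
  let ?q = "{i \<in> q. Inf (snd i) < Sup (snd i)}"
  have finp: "finite p" using p by blast
  then have finq: "finite q" using q finite_subset by blast
  note K = tagged_division_real_interval[OF p]
  have disj: "{Inf K<..<Sup K} \<inter> {Inf L<..<Sup L} = {}" if "(x, K) \<in> q" "(y, L) \<in> q" "(x, K) \<noteq> (y, L)" for x K y L
  proof -
    have "interior K \<inter> interior L = {}" using tagged_division_ofD(5)[OF p] that q by blast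
    moreover have "K = {Inf K..Sup K}" "L = {Inf L..Sup L}" using K(1) that q by blast+
    ultimately show ?thesis by (metis interior_atLeastAtMost_real)
  qed
  have inj: "inj_on (\<lambda>(x, K). (Inf K, Sup K)) ?q"
  proof (rule inj_onI, clarsimp)
    fix x K y L
    assume h: "(x, K) \<in> q" "(y, L) \<in> q" "Inf K = Inf L" "Sup K = Sup L" "Inf L < Sup L"
    show "x = y \<and> K = L"
    proof (rule ccontr)
      assume "\<not> ?thesis"
      then have "{Inf L<..<Sup L} \<inter> {Inf L<..<Sup L} = {}" using disj[OF h(1,2)] h(3,4) by auto
      then show False using h(5) by simp
    qed
  qed
  show "interval_family s t I"
  proof (rule interval_familyI)
    show "finite I" using finq by (simp add: I_def)
    show "s \<le> a \<and> a < b \<and> b \<le> t" if ab: "(a, b) \<in> I" for a b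
    proof -
      obtain x L where "(x, L) \<in> q" "Inf L < Sup L" "a = Inf L" "b = Sup L" using ab by (auto simp: I_def)
      then show ?thesis using K(4,5) q by blast
    qed
    show "{a<..<b} \<inter> {c<..<d} = {}" if ab: "(a, b) \<in> I" "(c, d) \<in> I" "(a, b) \<noteq> (c, d)" for a b c d
    proof -
      obtain x L where 1: "(x, L) \<in> q" "a = Inf L" "b = Sup L" using ab(1) by (auto simp: I_def)
      obtain y M where 2: "(y, M) \<in> q" "c = Inf M" "d = Sup M" using ab(2) by (auto simp: I_def)
      have "(x, L) \<noteq> (y, M)" using 1 2 ab(3) by auto
      then show ?thesis using disj[OF 1(1) 2(1)] 1 2 by simp
    qed
  qed
  fix g :: "real \<Rightarrow> real \<Rightarrow> 'a" assume g: "\<And>u. g u u = 0"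
  have "(\<Sum>(u, v)\<in>I. g u v) = (\<Sum>i\<in>?q. g (Inf (snd i)) (Sup (snd i)))"
    unfolding I_def by (subst sum.reindex[OF inj]) (simp add: case_prod_beta)
  also have "\<dots> = (\<Sum>i\<in>q. g (Inf (snd i)) (Sup (snd i)))"
  proof (rule sum.mono_neutral_left[OF finq])
    show "\<forall>i\<in>q - ?q. g (Inf (snd i)) (Sup (snd i)) = 0"
    proof
      fix i assume i: "i \<in> q - ?q"
      have "(fst i, snd i) \<in> p" using i q by auto
      then have "Inf (snd i) = Sup (snd i)" using K(2,3) i by fastforce
      then show "g (Inf (snd i)) (Sup (snd i)) = 0" using g by simp
    qed
  qed auto
  finally show "(\<Sum>(u, v)\<in>I. g u v) = (\<Sum>(x, K)\<in>q. g (Inf K) (Sup K))" by (simp add: case_prod_beta)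
qed

text \<open>
  Choose a gauge for which intervals tagged outside the exceptional null set satisfy the straddle
  inequality, while those tagged inside it lie in an open set of small measure. The latter
  contribute little by absolute continuity, and the former a small multiple of their length.
\<close>
lemma abs_cont_FTC:
  fixes F F' :: "real \<Rightarrow> 'a::euclidean_space"
  assumes ac: "abs_cont s t F" and st: "s \<le> t" and N: "negligible N"
    and deriv: "\<And>x. x \<in> {s<..<t} - N \<Longrightarrow> (F has_vector_derivative F' x) (at x)"
  shows "(F' has_integral F t - F s) {s..t}"
proof -
  define N' where "N' = N \<union> {s, t}"
  have N': "negligible N'" unfolding N'_def using N by (intro negligible_Un) auto
  define G where "G = (\<lambda>x. if x \<in> N' then 0 else F' x)"
  have Gint: "(G has_integral F t - F s) {s..t}"
    unfolding has_integral_real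
  proof (intro allI impI)
    fix e :: real assume e: "e > 0"
    obtain \<delta> where d: "\<delta> > 0" "\<And>I. interval_family s t I \<and> total_length I < \<delta> \<Longrightarrow> (\<Sum>(a, b)\<in>I. norm (F b - F a)) < e / 2"
      using ac e unfolding abs_cont_def by (metis half_gt_zero)
    obtain U where U: "open U" "N' \<subseteq> U" "U - N' \<in> lmeasurable" "emeasure lebesgue (U - N') < ennreal \<delta>"
      using sets_lebesgue_outer_open[OF _ d(1), of N'] N' negligible_imp_sets by blast
    have Um: "U \<in> lmeasurable"
    proof -
      have "U = (U - N') \<union> N'" using U(2) by blast
      then show ?thesis using fmeasurable.Un[OF U(3) negligible_imp_measurable[OF N']] by simp
    qed
    have "measure lebesgue U = measure lebesgue (U - N')"
      using N' Um by (simp add: measure_Diff_null_set negligible_iff_null_sets)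
    also have "\<dots> < \<delta>" using U(3,4) d(1) by (simp add: emeasure_eq_measure2 ennreal_less_iff)
    finally have mU: "measure lebesgue U < \<delta>" .
    \<comment> \<open>the summand 1 keeps the denominator positive for a degenerate interval\<close>
    define \<eta> where "\<eta> = e / (2 * (t - s + 1))"
    have eta: "\<eta> > 0" "\<eta> * (t - s) < e / 2"
      using e st by (auto simp: \<eta>_def field_simps)
    have "\<exists>d>0. (x \<in> N' \<longrightarrow> ball x d \<subseteq> U) \<and> (x \<in> {s<..<t} - N' \<longrightarrow> 
       (\<forall>u v. u \<le> x \<and> x \<le> v \<and> u \<in> ball x d \<and> v \<in> ball x d \<longrightarrow> norm ((v - u) *\<^sub>R F' x - (F v - F u)) \<le> \<eta> * (v - u)))" for x
    proof (cases "x \<in> N'")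
      case True
      then show ?thesis using U(1,2) by (metis DiffD2 open_contains_ball subsetD)
    next
      case False
      show ?thesis
      proof (cases "x \<in> {s<..<t}")
        case True
        have "(F has_vector_derivative F' x) (at x)" using deriv False True by (auto simp: N'_def)
        from straddle_inequality[OF this eta(1)] show ?thesis using False by metis
      next
        case F2: False
        show ?thesis using False F2 by (intro exI[of _ 1]) auto
      qed
    qed
    then obtain d' where d': "\<And>x. d' x > 0" "\<And>x. x \<in> N' \<Longrightarrow> ball x (d' x) \<subseteq> U"
      "\<And>x u v. x \<in> {s<..<t} - N' \<Longrightarrow> u \<le> x \<Longrightarrow> x \<le> v \<Longrightarrow> u \<in> ball x (d' x) \<Longrightarrow> v \<in> ball x (d' x)
        \<Longrightarrow> norm ((v - u) *\<^sub>R F' x - (F v - F u)) \<le> \<eta> * (v - u)"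
      by metis
    define \<gamma> where "\<gamma> = (\<lambda>x. ball x (d' x))"
    have gauge: "gauge \<gamma>" unfolding gauge_def \<gamma>_def using d'(1) by auto
    have sums: "norm ((\<Sum>(x, K)\<in>p. measure lborel K *\<^sub>R G x) - (F t - F s)) < e"
      if p: "p tagged_division_of {s..t}" and fine: "\<gamma> fine p" for p
    proof -
      note K = tagged_division_real_interval[OF p]
      have finp: "finite p" using p by blast
      define q where "q = {i \<in> p. fst i \<in> N'}"
      define I where "I = (\<lambda>(x, K). (Inf K, Sup K)) ` {i \<in> q. Inf (snd i) < Sup (snd i)}"
      have qp: "q \<subseteq> p" by (auto simp: q_def)
      note I = tagged_subfamily[OF p qp, folded I_def]
      have KU: "K \<subseteq> U" if "(x, K) \<in> q" for x K
        using that fine d'(2)[of x] unfolding q_def fine_def \<gamma>_def by fastforce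
      have "total_length I = (\<Sum>(x, K)\<in>q. Sup K - Inf K)" by (rule I(2)) simp
      also have "\<dots> = (\<Sum>(x, K)\<in>q. measure lborel K)"
        by (rule sum.cong) (use K(6) qp in auto)
      also have "\<dots> = (\<Sum>(a, b)\<in>I. measure lebesgue {a<..<b})"
        by (subst I(2)) (use K(6) qp K(2,3) in \<open>fastforce intro!: sum.cong\<close>)+
      also have "\<dots> = (\<Sum>i\<in>I. measure lebesgue {fst i<..<snd i})" by (simp add: case_prod_beta)
      also have "\<dots> = measure lebesgue (\<Union>i\<in>I. {fst i<..<snd i})"
        by (rule measure_UNION'[symmetric, OF interval_family_finite[OF I(1)]])
          (use interval_family_disjoint[OF I(1)] in \<open>force simp: pairwise_def disjnt_def\<close>)+
      also have "\<dots> \<le> measure lebesgue U"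
      proof (rule measure_mono_fmeasurable[OF _ _ Um])
        show "(\<Union>i\<in>I. {fst i<..<snd i}) \<subseteq> U"
        proof clarify
          fix a b y assume "(a, b) \<in> I" "y \<in> {fst (a, b)<..<snd (a, b)}"
          then obtain x L where L: "(x, L) \<in> q" "y \<in> {Inf L<..<Sup L}" by (auto simp: I_def)
          have "y \<in> {Inf L..Sup L}" using L(2) by simp
          then have "y \<in> L" using K(1)[of x L] qp L(1) by blast
          then show "y \<in> U" using KU L(1) by blast
        qed
        show "(\<Union>i\<in>I. {fst i<..<snd i}) \<in> sets lebesgue"
          using interval_family_finite[OF I(1)] by (intro sets.finite_UN) auto
      qed
      finally have "total_length I < \<delta>" using mU by linarith
      then have small: "(\<Sum>(a, b)\<in>I. norm (F b - F a)) < e / 2" using d(2) I(1) by blast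
      have bound: "norm (measure lborel K *\<^sub>R G x - (F (Sup K) - F (Inf K)))
          \<le> (if x \<in> N' then norm (F (Sup K) - F (Inf K)) else 0) + \<eta> * measure lborel K" if xK: "(x, K) \<in> p" for x K
      proof (cases "x \<in> N'")
        case True
        then show ?thesis using eta(1) by (simp add: G_def norm_minus_commute)
      next
        case False
        have "s \<le> x" "x \<le> t" using K(2-5)[OF xK] by linarith+
        then have x: "x \<in> {s<..<t} - N'" using False by (auto simp: N'_def)
        have "K \<subseteq> ball x (d' x)" using fine xK unfolding fine_def \<gamma>_def by blast
        moreover have "Inf K \<in> K" "Sup K \<in> K" using K(1,2,3)[OF xK] by (metis atLeastAtMost_iff order_refl order_trans)+
        ultimately have "norm ((Sup K - Inf K) *\<^sub>R F' x - (F (Sup K) - F (Inf K))) \<le> \<eta> * (Sup K - Inf K)"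
          using d'(3)[OF x K(2,3)[OF xK]] by blast
        then show ?thesis using False K(6)[OF xK] by (simp add: G_def)
      qed
      have "(\<Sum>(x, K)\<in>p. measure lborel K *\<^sub>R G x) - (F t - F s) = (\<Sum>(x, K)\<in>p. measure lborel K *\<^sub>R G x - (F (Sup K) - F (Inf K)))"
        unfolding additive_tagged_division_1[OF st p, of F, symmetric]
        by (simp add: sum_subtractf case_prod_beta)
      also have "norm \<dots> \<le> (\<Sum>(x, K)\<in>p. (if x \<in> N' then norm (F (Sup K) - F (Inf K)) else 0) + \<eta> * measure lborel K)"
        by (rule sum_norm_le) (use bound in auto)
      also have "\<dots> = (\<Sum>(x, K)\<in>p. if x \<in> N' then norm (F (Sup K) - F (Inf K)) else 0) + \<eta> * (\<Sum>(x, K)\<in>p. measure lborel K)"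
        by (simp add: case_prod_beta sum.distrib sum_distrib_left)
      also have "(\<Sum>(x, K)\<in>p. measure lborel K) = t - s"
        using additive_content_tagged_division[of p s t] p st by simp
      also have "(\<Sum>(x, K)\<in>p. if x \<in> N' then norm (F (Sup K) - F (Inf K)) else 0) = (\<Sum>(x, K)\<in>q. norm (F (Sup K) - F (Inf K)))"
        unfolding q_def case_prod_beta by (rule sum.inter_filter[OF finp, symmetric])
      also have "\<dots> = (\<Sum>(a, b)\<in>I. norm (F b - F a))" by (rule I(2)[symmetric]) simp
      finally show ?thesis using small eta(2) by linarith
    qed
    show "\<exists>\<gamma>. gauge \<gamma> \<and> (\<forall>p. p tagged_division_of {s..t} \<and> \<gamma> fine p \<longrightarrow>
        norm ((\<Sum>(x, K)\<in>p. measure lborel K *\<^sub>R G x) - (F t - F s)) < e)"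
    proof (intro exI[of _ \<gamma>] conjI allI impI)
      fix p assume "p tagged_division_of {s..t} \<and> \<gamma> fine p"
      then show "norm ((\<Sum>(x, K)\<in>p. measure lborel K *\<^sub>R G x) - (F t - F s)) < e"
        by (elim conjE) (rule sums)
    qed (rule gauge)
  qed
  show ?thesis
    by (rule has_integral_spike[OF N' _ Gint]) (simp add: G_def)
qed

lemma abs_cont_subinterval:
  "abs_cont s t F \<Longrightarrow> s \<le> s' \<Longrightarrow> t' \<le> t \<Longrightarrow> abs_cont s' t' F"
  unfolding abs_cont_def by (meson interval_family_mono)

lemma division_interval_family:
  fixes g :: "real set \<Rightarrow> real"
  assumes d: "d division_of {s..t}" and g: "\<And>x. g {x} = 0"
  obtains I where "interval_family s t I" "(\<Sum>K\<in>d. g K) = (\<Sum>(a, b)\<in>I. g {a..b})"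
proof -
  define p where "p = (\<lambda>K. (Inf K, K)) ` d"
  have inj: "inj_on (\<lambda>K. (Inf K, K)) d" by (simp add: inj_on_def)
  have K: "\<exists>a b. K = {a..b} \<and> a \<le> b" if "K \<in> d" for K
    using division_ofD(3,4)[OF d that] by (metis atLeastatMost_empty_iff box_real(2))
  have "p tagged_division_of {s..t}"
  proof (rule tagged_division_ofI)
    show "finite p" using d by (auto simp: p_def)
    fix x L assume L: "(x, L) \<in> p"
    then have Ld: "L \<in> d" "x = Inf L" by (auto simp: p_def)
    obtain a b where ab: "L = {a..b}" "a \<le> b" using K[OF Ld(1)] by blast
    show "x \<in> L" using Ld ab by simp
    show "L \<subseteq> {s..t}" using division_ofD(2)[OF d Ld(1)] .
    show "\<exists>a b. L = cbox a b" using ab by auto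
    show "interior L \<inter> interior M = {}" if "(y, M) \<in> p" "(x, L) \<noteq> (y, M)" for y M
      using division_ofD(5)[OF d Ld(1), of M] that Ld(2) by (auto simp: p_def)
  next
    show "\<Union> {K. \<exists>x. (x, K) \<in> p} = {s..t}"
    proof -
      have "{K. \<exists>x. (x, K) \<in> p} = d" by (auto simp: p_def)
      then show ?thesis using division_ofD(6)[OF d] by simp
    qed
  qed
  note I = tagged_subfamily[OF this order_refl]
  have "(\<Sum>(x, K)\<in>p. g {Inf K..Sup K}) = (\<Sum>K\<in>d. g {Inf K..Sup K})"
    unfolding p_def by (subst sum.reindex[OF inj]) simp
  also have "\<dots> = (\<Sum>K\<in>d. g K)"
    by (rule sum.cong) (use K in fastforce)+
  finally show thesis
    using that[OF I(1)] I(2)[of "\<lambda>a b. g {a..b}"] g by auto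
qed

text \<open>
  Over a short interval the integrals of \<open>F'\<close> along a division are increments of \<open>F\<close>, whose sum is
  bounded, so \<open>F'\<close> is absolutely integrable there; finitely many short intervals exhaust \<open>[s, t]\<close>.
\<close>
theorem abs_cont_derivative:
  fixes F :: "real \<Rightarrow> complex"
  defines "F' \<equiv> \<lambda>x. vector_derivative F (at x)"
  assumes ac: "abs_cont s t F"
  shows "\<And>x y. s \<le> x \<Longrightarrow> x \<le> y \<Longrightarrow> y \<le> t \<Longrightarrow> (F' has_integral F y - F x) {x..y}"
    and "F' absolutely_integrable_on {s..t}"
proof -
  have ftc: "(F' has_integral F y - F x) {x..y}" if "s \<le> x" "x \<le> y" "y \<le> t" for x y
  proof (rule abs_cont_FTC[OF abs_cont_subinterval[OF ac] _ abs_cont_differentiable_AE[OF ac]])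
    fix z assume "z \<in> {x<..<y} - {z \<in> {s<..<t}. \<not> F differentiable at z}"
    then have "F differentiable at z" using that by auto
    then show "(F has_vector_derivative F' z) (at z)"
      unfolding F'_def by (simp add: vector_derivative_works[symmetric])
  qed (use that in auto)
  then show "\<And>x y. s \<le> x \<Longrightarrow> x \<le> y \<Longrightarrow> y \<le> t \<Longrightarrow> (F' has_integral F y - F x) {x..y}" .
  obtain \<delta> where d: "\<delta> > 0" "\<And>s' t' I. s \<le> s' \<Longrightarrow> s' \<le> t' \<Longrightarrow> t' \<le> t \<Longrightarrow> t' - s' < \<delta> \<Longrightarrow> interval_family s' t' I
     \<Longrightarrow> (\<Sum>(a, b)\<in>I. norm (F b - F a)) \<le> 1"
    using abs_cont_locally_bounded_variation[OF ac] by metis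
  have loc: "F' absolutely_integrable_on {x..y}" if xy: "s \<le> x" "x \<le> y" "y \<le> t" "y - x < \<delta>" for x y
  proof -
    have "F' absolutely_integrable_on cbox x y"
    proof (rule bounded_variation_absolutely_integrable_interval)
      show "F' integrable_on cbox x y" using ftc xy by (auto intro: has_integral_integrable)
      fix D assume D: "D division_of cbox x y"
      obtain I where I: "interval_family x y I" "(\<Sum>K\<in>D. norm (integral K F')) = (\<Sum>(a, b)\<in>I. norm (integral {a..b} F'))"
        using division_interval_family[of D x y "\<lambda>K. norm (integral K F')"] D by auto
      have "(\<Sum>(a, b)\<in>I. norm (integral {a..b} F')) = (\<Sum>(a, b)\<in>I. norm (F b - F a))"
      proof (rule sum.cong, simp, clarify)
        fix a b assume "(a, b) \<in> I"
        then have "x \<le> a \<and> a < b \<and> b \<le> y" using interval_familyD[OF I(1)] by blast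
        then have "(F' has_integral F b - F a) {a..b}" using xy by (intro ftc) auto
        then show "norm (integral {a..b} F') = norm (F b - F a)" by (simp add: integral_unique)
      qed
      then show "(\<Sum>K\<in>D. norm (integral K F')) \<le> 1" using I d(2)[OF xy I(1)] by simp
    qed
    then show ?thesis by simp
  qed
  define h where "h = \<delta> / 2"
  have h: "h > 0" "h < \<delta>" using d(1) by (auto simp: h_def)
  have step: "F' absolutely_integrable_on {s..min t (s + real k * h)}" for k
  proof (induction k)
    case 0
    show ?case
    proof (cases "s \<le> t")
      case True
      then show ?thesis using loc[of s s] d(1) by simp
    qed (simp add: absolutely_integrable_on_def)
  next
    case (Suc k)
    show ?case
    proof (cases "s + real k * h \<le> t")
      case False
      then have "min t (s + real (Suc k) * h) = min t (s + real k * h)" using h by (simp add: algebra_simps)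
      then show ?thesis using Suc by simp
    next
      case True
      let ?y = "min t (s + real (Suc k) * h)"
      have y: "s + real k * h \<le> ?y" "?y - (s + real k * h) \<le> h" "s \<le> s + real k * h" using True h by (auto simp: algebra_simps min_def)
      have "F' absolutely_integrable_on {s + real k * h..?y}" using y h by (intro loc) auto
      moreover have "F' absolutely_integrable_on {s..s + real k * h}" using Suc True by (simp add: min_absorb2)
      ultimately have "F' absolutely_integrable_on {s..s + real k * h} \<union> {s + real k * h..?y}"
        by (intro set_integrable_Un) auto
      then show ?thesis using y by (simp add: ivl_disj_un_two_touch(4))
    qed
  qed
  obtain k :: nat where "real k * h > t - s" using h(1) by (metis reals_Archimedean3)
  then have "min t (s + real k * h) = t" by simp
  then show "F' absolutely_integrable_on {s..t}" using step[of k] by simp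
qed

section \<open>Smooth frequency cutoffs and the decay of their kernels\<close>

text \<open>
  Functions on the line with \<open>k\<close> continuous derivatives. Passing to the derivative in the recursion
  makes the closure properties below inductions on \<open>k\<close>.
\<close>
primrec Ck :: "nat \<Rightarrow> (real \<Rightarrow> real) \<Rightarrow> bool" where
  "Ck 0 f \<longleftrightarrow> continuous_on UNIV f"
| "Ck (Suc k) f \<longleftrightarrow> (\<exists>f'. (\<forall>x. (f has_real_derivative f' x) (at x)) \<and> Ck k f')"

lemma Ck_continuous: "Ck k f \<Longrightarrow> continuous_on UNIV f"
  by (cases k) (auto intro!: continuous_at_imp_continuous_on intro: DERIV_isCont)

lemma Ck_SucD: "Ck (Suc k) f \<Longrightarrow> Ck k f"
proof (induction k arbitrary: f)
  case 0
  then show ?case using Ck_continuous[of "Suc 0" f] by simp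
next
  case (Suc k)
  then obtain f' where f': "\<forall>x. (f has_real_derivative f' x) (at x)" "Ck (Suc k) f'" by auto
  then show ?case using Suc.IH by auto
qed

lemma Ck_const: "Ck k (\<lambda>x. c)"
proof (induction k arbitrary: c)
  case (Suc k)
  have "\<forall>x. ((\<lambda>x. c) has_real_derivative 0) (at x)" by (auto intro!: derivative_eq_intros)
  then show ?case unfolding Ck.simps using Suc[of 0] by (intro exI[of _ "\<lambda>x. 0"]) auto
qed auto

lemma Ck_ident: "Ck k (\<lambda>x. x)"
proof (cases k)
  case (Suc k')
  have "\<forall>x. ((\<lambda>x. x) has_real_derivative (1::real)) (at x)" by (auto intro!: derivative_eq_intros)
  then show ?thesis unfolding Suc Ck.simps using Ck_const[of k' 1] by (intro exI[of _ "\<lambda>x. 1"]) auto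
qed auto

lemma Ck_add: "Ck k f \<Longrightarrow> Ck k g \<Longrightarrow> Ck k (\<lambda>x. f x + g x)"
proof (induction k arbitrary: f g)
  case 0
  then show ?case by (auto intro: continuous_intros)
next
  case (Suc k)
  obtain f' g' where d: "\<forall>x. (f has_real_derivative f' x) (at x)" "Ck k f'"
    "\<forall>x. (g has_real_derivative g' x) (at x)" "Ck k g'"
    using Suc.prems by auto
  show ?case unfolding Ck.simps
    using d Suc.IH[OF d(2,4)] by (intro exI[of _ "\<lambda>x. f' x + g' x"]) (auto intro: DERIV_add)
qed

lemma Ck_mult: "Ck k f \<Longrightarrow> Ck k g \<Longrightarrow> Ck k (\<lambda>x. f x * g x)"
proof (induction k arbitrary: f g)
  case 0
  then show ?case by (auto intro: continuous_intros)
next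
  case (Suc k)
  obtain f' g' where d: "\<forall>x. (f has_real_derivative f' x) (at x)" "Ck k f'"
    "\<forall>x. (g has_real_derivative g' x) (at x)" "Ck k g'"
    using Suc.prems by auto
  have "Ck k (\<lambda>x. f' x * g x + g' x * f x)"
    using Suc.IH[OF d(2) Ck_SucD[OF Suc.prems(2)]] Suc.IH[OF d(4) Ck_SucD[OF Suc.prems(1)]] by (rule Ck_add)
  moreover have "\<forall>x. ((\<lambda>x. f x * g x) has_real_derivative f' x * g x + g' x * f x) (at x)"
    using d(1,3) by (auto intro: DERIV_mult)
  ultimately show ?case unfolding Ck.simps by (intro exI[of _ "\<lambda>x. f' x * g x + g' x * f x"]) auto
qed

lemma Ck_diff: "Ck k f \<Longrightarrow> Ck k g \<Longrightarrow> Ck k (\<lambda>x. f x - g x)"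
  using Ck_add[of k f "\<lambda>x. (-1) * g x"] Ck_mult[OF Ck_const[of k "-1"], of g] by simp

lemma Ck_power: "Ck k f \<Longrightarrow> Ck k (\<lambda>x. f x ^ n)"
  by (induction n) (auto intro: Ck_const Ck_mult)

lemma Ck_affine: "Ck k f \<Longrightarrow> Ck k (\<lambda>x. f (a * x + b))"
proof (induction k arbitrary: f)
  case 0
  then have "continuous_on UNIV f" by simp
  then have "continuous_on UNIV (\<lambda>x. f (a * x + b))"
    by (rule continuous_on_compose2) (auto intro: continuous_intros)
  then show ?case by simp
next
  case (Suc k)
  then obtain f' where d: "\<forall>x. (f has_real_derivative f' x) (at x)" "Ck k f'" by auto
  have "((\<lambda>x. f (a * x + b)) has_real_derivative a * f' (a * x + b)) (at x)" for x
    by (rule DERIV_chain2[where f = f and g = "\<lambda>x. a * x + b" and Db = a, THEN DERIV_cong])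
       (use d(1) in \<open>auto intro!: derivative_eq_intros\<close>)
  then show ?case unfolding Ck.simps
    using Ck_mult[OF Ck_const Suc.IH[OF d(2)]] by (intro exI[of _ "\<lambda>x. a * f' (a * x + b)"]) auto
qed

lemma Ck_inverse:
  assumes "Ck k f" "\<And>x. f x > 0"
  shows "Ck k (\<lambda>x. 1 / f x)"
  using assms(1)
proof (induction k)
  case 0
  then show ?case using assms(2) by (auto intro!: continuous_intros simp: less_imp_neq[symmetric])
next
  case (Suc k)
  then obtain f' where d: "\<forall>x. (f has_real_derivative f' x) (at x)" "Ck k f'" by auto
  have nz: "f x \<noteq> 0" for x using assms(2)[of x] by simp
  have "((\<lambda>x. 1 / f x) has_real_derivative (-1) * f' x * ((1 / f x) * (1 / f x))) (at x)" for x
    using d(1) nz[of x] by (auto intro!: derivative_eq_intros simp: field_simps)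
  moreover have "Ck k (\<lambda>x. (-1) * f' x * ((1 / f x) * (1 / f x)))"
    using Suc.IH[OF Ck_SucD[OF Suc.prems]] d(2) by (intro Ck_mult Ck_const)
  ultimately show ?case unfolding Ck.simps
    by (intro exI[of _ "\<lambda>x. (-1) * f' x * ((1 / f x) * (1 / f x))"]) auto
qed

lemma Ck_pos_part_power: "Ck k (\<lambda>x. max 0 x ^ Suc k)"
proof (induction k)
  case 0
  then show ?case by (auto intro!: continuous_intros)
next
  case (Suc k)
  have "((\<lambda>x. max 0 x ^ Suc (Suc k)) has_real_derivative real (Suc (Suc k)) * max 0 x ^ Suc k) (at x)" for x :: real
  proof (cases "x = 0")
    case True
    have "((\<lambda>h::real. max 0 h ^ Suc (Suc k) / h) \<longlongrightarrow> 0) (at 0)"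
    proof (rule Lim_null_comparison)
      show "((\<lambda>h::real. \<bar>h\<bar> ^ Suc k) \<longlongrightarrow> 0) (at 0)" by (auto intro!: tendsto_eq_intros)
      show "\<forall>\<^sub>F h::real in at 0. norm (max 0 h ^ Suc (Suc k) / h) \<le> \<bar>h\<bar> ^ Suc k"
      proof (intro always_eventually allI)
        fix h :: real
        show "norm (max 0 h ^ Suc (Suc k) / h) \<le> \<bar>h\<bar> ^ Suc k"
        proof (cases "h > 0")
          case False
          then have "max 0 h = 0" by simp
          then have "norm (max 0 h ^ Suc (Suc k) / h) = 0" by simp
          then show ?thesis using zero_le_power[OF abs_ge_zero[of h], of "Suc k"] by linarith
        qed (simp add: max_def)
      qed
    qed
    then show ?thesis using True by (simp add: DERIV_def)
  next
    case False
    show ?thesis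
    proof (cases "x > 0")
      case True
      have "((\<lambda>x::real. x ^ Suc (Suc k)) has_real_derivative real (Suc (Suc k)) * max 0 x ^ Suc k) (at x)"
        using DERIV_pow[of "Suc (Suc k)" x UNIV] True by (simp add: max_def)
      then show ?thesis
        by (rule DERIV_cong_ev[THEN iffD1, rotated 3])
           (use True in \<open>auto intro!: eventually_mono[OF eventually_nhds_in_open[of "{0<..}" x]]\<close>)
    next
      case neg: False
      have "((\<lambda>x::real. 0) has_real_derivative real (Suc (Suc k)) * max 0 x ^ Suc k) (at x)"
        using neg by (auto simp: max_def)
      then show ?thesis
        by (rule DERIV_cong_ev[THEN iffD1, rotated 3])
           (use neg False in \<open>auto intro!: eventually_mono[OF eventually_nhds_in_open[of "{..<0}" x]]\<close>)
    qed
  qed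
  then show ?case unfolding Ck.simps(2)
    using Ck_mult[OF Ck_const[of k "real (Suc (Suc k))"] Suc]
    by (intro exI[of _ "\<lambda>x. real (Suc (Suc k)) * max 0 x ^ Suc k"]) auto
qed

text \<open>
  The function \<open>u\<close> vanishes exactly on the nonpositive half-line, so \<open>u(t) / (u(t) + u(1 - t))\<close> is a
  smooth step from \<open>0\<close> to \<open>1\<close>; the cutoff is a product of two steps.
\<close>
lemma smooth_cutoff:
  obtains \<kappa> where "Ck k \<kappa>" "\<And>t. \<bar>t\<bar> \<le> 1 \<Longrightarrow> \<kappa> t = 1" "\<And>t. \<bar>t\<bar> \<ge> 2 \<Longrightarrow> \<kappa> t = 0"
proof -
  define u where "u = (\<lambda>x::real. max 0 x ^ Suc k)"
  have u: "Ck k u" unfolding u_def by (rule Ck_pos_part_power)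
  have u0: "u x = 0" if "x \<le> 0" for x using that by (simp add: u_def max_def)
  have upos: "u x > 0" if "x > 0" for x using that by (simp add: u_def)
  have unn: "u x \<ge> 0" for x by (simp add: u_def)
  define \<sigma> where "\<sigma> = (\<lambda>t. u (1 * t + 0) * (1 / (u (1 * t + 0) + u (-1 * t + 1))))"
  have pos: "u (1 * t + 0) + u (-1 * t + 1) > 0" for t
  proof (cases "t > 0")
    case True
    then show ?thesis using upos[of t] unn[of "-1 * t + 1"] by simp
  next
    case False
    then show ?thesis using upos[of "-1 * t + 1"] unn[of t] by simp
  qed
  have sm: "Ck k \<sigma>" unfolding \<sigma>_def
    by (intro Ck_mult Ck_inverse Ck_add Ck_affine u pos)
  have s1: "\<sigma> t = 1" if "t \<ge> 1" for t
    using that u0[of "-1 * t + 1"] upos[of t] by (simp add: \<sigma>_def)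
  have s0: "\<sigma> t = 0" if "t \<le> 0" for t using that u0 by (simp add: \<sigma>_def)
  show thesis
  proof (rule that[of "\<lambda>t. \<sigma> (-1 * t + 2) * \<sigma> (1 * t + 2)"])
    show "Ck k (\<lambda>t. \<sigma> (-1 * t + 2) * \<sigma> (1 * t + 2))" by (intro Ck_mult Ck_affine sm)
    show "\<sigma> (-1 * t + 2) * \<sigma> (1 * t + 2) = 1" if "\<bar>t\<bar> \<le> 1" for t
      using that s1[of "-1 * t + 2"] s1[of "1 * t + 2"] by simp
    show "\<sigma> (-1 * t + 2) * \<sigma> (1 * t + 2) = 0" if "\<bar>t\<bar> \<ge> 2" for t
      using that s0[of "-1 * t + 2"] s0[of "1 * t + 2"] by (cases "t \<ge> 0") auto
  qed
qed

text \<open>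
  The function \<open>\<Phi>\<close> is the multiplier of \<open>r\<close>-fold integration, up to a power of \<open>\<i>\<close>, restricted to a
  single dyadic band. The difference \<open>\<kappa>(t) - \<kappa>(2t)\<close> vanishes for \<open>\<bar>t\<bar> \<le> 1/2\<close>, which makes the
  division by \<open>t\<^sup>r\<close> harmless, and its dyadic dilates telescope.
\<close>
lemma smooth_dyadic_multiplier:
  fixes r :: nat
  obtains \<kappa> \<Phi> where "\<And>t. \<bar>t\<bar> \<le> 1 \<Longrightarrow> \<kappa> t = 1" "\<And>t. \<bar>t\<bar> \<ge> 2 \<Longrightarrow> \<kappa> t = 0"
    "Ck k \<Phi>" "\<And>t. \<bar>t\<bar> \<ge> 2 \<Longrightarrow> \<Phi> t = 0" "\<Phi> 0 = 0" "\<And>t. t \<noteq> 0 \<Longrightarrow> \<Phi> t = (\<kappa> t - \<kappa> (2 * t)) / t ^ r"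
proof -
  obtain \<kappa> where \<kappa>: "Ck k \<kappa>" "\<And>t. \<bar>t\<bar> \<le> 1 \<Longrightarrow> \<kappa> t = 1" "\<And>t. \<bar>t\<bar> \<ge> 2 \<Longrightarrow> \<kappa> t = 0"
    using smooth_cutoff by metis
  define u where "u = (\<lambda>x::real. max 0 x ^ Suc k)"
  have u: "Ck k u" unfolding u_def by (rule Ck_pos_part_power)
  define \<beta> where "\<beta> = (\<lambda>t. u (-1 * t + 1/2) * u (1 * t + 1/2))"
  have \<beta>: "Ck k \<beta>" unfolding \<beta>_def by (intro Ck_mult Ck_affine u)
  have \<beta>0: "\<beta> t = 0" if "\<bar>t\<bar> \<ge> 1/2" for t
    using that by (cases "t \<ge> 0") (auto simp: \<beta>_def u_def max_def)
  have pos: "t * t + \<beta> t > 0" for t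
  proof (cases "t = 0")
    case True
    then show ?thesis by (simp add: \<beta>_def u_def)
  next
    case False
    have "\<beta> t \<ge> 0" by (simp add: \<beta>_def u_def)
    moreover have "t * t > 0" using False by (auto simp: zero_less_mult_iff)
    ultimately show ?thesis by linarith
  qed
  \<comment> \<open>a smooth function on the whole line that agrees with the reciprocal away from the origin\<close>
  define q where "q = (\<lambda>t. t * (1 / (t * t + \<beta> t)))"
  have q: "Ck k q" unfolding q_def by (intro Ck_mult Ck_inverse Ck_add Ck_ident \<beta> pos)
  define \<Phi> where "\<Phi> = (\<lambda>t. (\<kappa> t - \<kappa> (2 * t + 0)) * q t ^ r)"
  show thesis
  proof (rule that[of \<kappa> \<Phi>])
    show "Ck k \<Phi>" unfolding \<Phi>_def by (intro Ck_mult Ck_diff Ck_power Ck_affine \<kappa>(1) q)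
    show "\<Phi> t = 0" if "\<bar>t\<bar> \<ge> 2" for t using that \<kappa>(3) by (simp add: \<Phi>_def)
    show "\<Phi> 0 = 0" by (simp add: \<Phi>_def)
    show "\<Phi> t = (\<kappa> t - \<kappa> (2 * t)) / t ^ r" if "t \<noteq> 0" for t
    proof (cases "\<bar>t\<bar> \<ge> 1/2")
      case True
      then have "q t = 1 / t" using \<beta>0 by (simp add: q_def)
      then have "q t ^ r = 1 / t ^ r" by (simp only: power_one_over)
      then show ?thesis by (simp add: \<Phi>_def)
    next
      case False
      then show ?thesis using \<kappa>(2)[of t] \<kappa>(2)[of "2 * t"] by (simp add: \<Phi>_def)
    qed
  qed (use \<kappa> in auto)
qed

definition bdiff :: "real \<Rightarrow> (real \<Rightarrow> real) \<Rightarrow> real \<Rightarrow> real" where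
  "bdiff h f = (\<lambda>t. f t - f (t - h))"

lemma bdiff_apply: "bdiff h f t = f t - f (t - h)"
  by (simp add: bdiff_def)

lemma bdiff_Suc: "(bdiff h ^^ Suc L) f t = (bdiff h ^^ L) f t - (bdiff h ^^ L) f (t - h)"
  by (simp only: funpow.simps o_apply bdiff_apply)

lemma bdiff_deriv:
  assumes "\<And>x. (f has_real_derivative f' x) (at x)"
  shows "((bdiff h ^^ L) f has_real_derivative (bdiff h ^^ L) f' x) (at x)"
proof (induction L arbitrary: x)
  case 0
  then show ?case using assms by simp
next
  case (Suc L)
  have "((\<lambda>t. (bdiff h ^^ L) f (t - h)) has_real_derivative (bdiff h ^^ L) f' (x - h)) (at x)"
    using Suc[of "x - h"] DERIV_shift[of "(bdiff h ^^ L) f" _ x "-h"] by simp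
  then have "((\<lambda>t. (bdiff h ^^ L) f t - (bdiff h ^^ L) f (t - h)) has_real_derivative
      (bdiff h ^^ L) f' x - (bdiff h ^^ L) f' (x - h)) (at x)"
    using DERIV_diff[OF Suc[of x]] by blast
  then show ?case unfolding bdiff_Suc[symmetric] .
qed

text \<open>
  By the mean value theorem each backward difference costs one derivative and gains one factor \<open>h\<close>.
\<close>
lemma bdiff_bound:
  assumes "Ck L f" "\<And>t. \<bar>t\<bar> \<ge> R \<Longrightarrow> f t = 0"
  obtains B where "B \<ge> 0" "\<And>h t. h > 0 \<Longrightarrow> \<bar>(bdiff h ^^ L) f t\<bar> \<le> B * h ^ L"
proof -
  have "\<exists>B\<ge>0. \<forall>h>0. \<forall>t. \<bar>(bdiff h ^^ L) f t\<bar> \<le> B * h ^ L"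
    using assms
  proof (induction L arbitrary: f R)
    case 0
    have "compact (f ` {-R..R})"
      using 0 by (intro compact_continuous_image) (auto intro: continuous_on_subset)
    then obtain B where B: "\<And>y. y \<in> f ` {-R..R} \<Longrightarrow> norm y \<le> B" "B > 0"
      using compact_imp_bounded bounded_pos by metis
    have "\<bar>f t\<bar> \<le> B" for t
    proof (cases "\<bar>t\<bar> \<ge> R")
      case True then show ?thesis using 0(2) B(2) by simp
    next
      case False
      then have "f t \<in> f ` {-R..R}" by (intro imageI) auto
      then show ?thesis using B(1) by force
    qed
    then show ?case using B(2) by (intro exI[of _ B]) auto
  next
    case (Suc L)
    obtain f' where d: "\<And>x. (f has_real_derivative f' x) (at x)" "Ck L f'" using Suc.prems(1) by auto
    have f'0: "f' t = 0" if "\<bar>t\<bar> \<ge> R + 1" for t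
    proof -
      have "((\<lambda>x. 0) has_real_derivative f' t) (at t)"
        by (rule DERIV_cong_ev[THEN iffD1, OF refl _ refl d(1)])
           (use that in \<open>auto simp: dist_real_def intro!: eventually_mono[OF eventually_nhds_in_open[of "ball t 1" t]] Suc.prems(2)\<close>)
      then show ?thesis using DERIV_unique DERIV_const by blast
    qed
    obtain B where B: "B \<ge> 0" "\<And>h t. h > 0 \<Longrightarrow> \<bar>(bdiff h ^^ L) f' t\<bar> \<le> B * h ^ L"
      using Suc.IH[OF d(2) f'0] by blast
    have "\<bar>(bdiff h ^^ Suc L) f t\<bar> \<le> B * h ^ Suc L" if h: "h > 0" for h t
    proof -
      obtain z where z: "(bdiff h ^^ L) f t - (bdiff h ^^ L) f (t - h) = h * (bdiff h ^^ L) f' z"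
      proof -
        have "\<exists>z>t - h. z < t \<and> (bdiff h ^^ L) f t - (bdiff h ^^ L) f (t - h) = (t - (t - h)) * (bdiff h ^^ L) f' z"
          by (rule MVT2) (use h bdiff_deriv[OF d(1)] in simp_all)
        then show ?thesis by (elim exE conjE) (rule that, simp)
      qed
      have "\<bar>(bdiff h ^^ Suc L) f t\<bar> = h * \<bar>(bdiff h ^^ L) f' z\<bar>"
        using z h unfolding bdiff_Suc by (simp add: abs_mult)
      also have "\<dots> \<le> h * (B * h ^ L)" using B(2)[OF h] h by (intro mult_left_mono) auto
      finally show ?thesis by (simp add: algebra_simps)
    qed
    then show ?case using B(1) by blast
  qed
  then show thesis using that by blast
qed

lemma cis_of_int_power: "cis (of_int j * x) * cis x = cis (of_int (j + 1) * x)"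
  by (simp add: cis_mult algebra_simps)

lemma summation_by_parts:
  fixes a :: "int \<Rightarrow> complex"
  assumes "\<And>j. j < l \<or> j > u \<Longrightarrow> a j = 0" "l \<le> u"
  shows "(1 - cis x) * (\<Sum>j=l..u. a j * cis (of_int j * x)) = (\<Sum>j=l..u+1. (a j - a (j - 1)) * cis (of_int j * x))"
proof -
  have "(\<Sum>j=l..u. a j * cis (of_int j * x)) = (\<Sum>j=l..u+1. a j * cis (of_int j * x))"
    by (rule sum.mono_neutral_left) (use assms in auto)
  moreover have "cis x * (\<Sum>j=l..u. a j * cis (of_int j * x)) = (\<Sum>j=l..u. a j * cis (of_int (j + 1) * x))"
    unfolding sum_distrib_left cis_of_int_power[symmetric] by (simp add: mult_ac)
  moreover have "(\<Sum>j=l..u. a j * cis (of_int (j + 1) * x)) = (\<Sum>j=l+1..u+1. a (j - 1) * cis (of_int j * x))"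
    by (rule sum.reindex_bij_witness[of _ "\<lambda>j. j - 1" "\<lambda>j. j + 1"]) auto
  moreover have "(\<Sum>j=l+1..u+1. a (j - 1) * cis (of_int j * x)) = (\<Sum>j=l..u+1. a (j - 1) * cis (of_int j * x))"
    by (rule sum.mono_neutral_left) (use assms in auto)
  ultimately show ?thesis by (simp add: algebra_simps sum_subtractf)
qed

lemma summation_by_parts_iterate:
  fixes f :: "real \<Rightarrow> real"
  assumes "\<And>t. \<bar>t\<bar> > of_int J * h \<Longrightarrow> f t = 0" "J \<ge> 0" "h > 0"
  shows "(1 - cis x) ^ L * (\<Sum>j=-J..J. of_real (f (of_int j * h)) * cis (of_int j * x))
    = (\<Sum>j=-J..J+int L. of_real ((bdiff h ^^ L) f (of_int j * h)) * cis (of_int j * x))"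
proof (induction L)
  case (Suc L)
  have supp: "(bdiff h ^^ L) f (of_int j * h) = 0" if "j < -J \<or> j > J + int L" for j
    using that
  proof (induction L arbitrary: j)
    case 0
    then have "real_of_int \<bar>j\<bar> > real_of_int J" by linarith
    then have "of_int J * h < \<bar>of_int j * h\<bar>" using assms(3) by (simp add: abs_mult)
    then show ?case using assms(1) by simp
  next
    case (Suc L)
    have 1: "(bdiff h ^^ L) f (of_int (j - 1) * h) = 0" by (rule Suc.IH) (use Suc.prems in auto)
    have 2: "(bdiff h ^^ L) f (of_int j * h) = 0" by (rule Suc.IH) (use Suc.prems in auto)
    have 3: "of_int (j - 1) * h = of_int j * h - h" by (simp add: algebra_simps)
    show ?case using 1 2 unfolding 3 bdiff_Suc by simp
  qed
  have "(1 - cis x) ^ Suc L * (\<Sum>j=-J..J. of_real (f (of_int j * h)) * cis (of_int j * x))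
     = (1 - cis x) * (\<Sum>j=-J..J+int L. of_real ((bdiff h ^^ L) f (of_int j * h)) * cis (of_int j * x))"
    using Suc by (simp add: mult_ac)
  also have "\<dots> = (\<Sum>j=-J..J+int L+1. (of_real ((bdiff h ^^ L) f (of_int j * h)) - of_real ((bdiff h ^^ L) f (of_int (j - 1) * h))) * cis (of_int j * x))"
    by (rule summation_by_parts) (use supp assms(2) in auto)
  also have "\<dots> = (\<Sum>j=-J..J+int (Suc L). of_real ((bdiff h ^^ Suc L) f (of_int j * h)) * cis (of_int j * x))"
    unfolding bdiff_Suc by (rule sum.cong) (auto simp: algebra_simps)
  finally show ?case .
qed simp

abbreviation smooth_kernel :: "(real \<Rightarrow> real) \<Rightarrow> nat \<Rightarrow> real \<Rightarrow> complex" where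
  "smooth_kernel f m x \<equiv> \<Sum>j=-int (2*m)..int (2*m). of_real (f (of_int j / real m)) * cis (of_int j * x)"

text \<open>
  There are about \<open>4 m\<close> coefficients, of size \<open>O(1)\<close> and with \<open>L\<close>-th differences of size \<open>O(m\<^sup>-\<^sup>L)\<close>. So
  the kernel has height \<open>O(m)\<close> and, away from the origin, decays like \<open>(m \<bar>x\<bar>)\<^sup>-\<^sup>L\<close> relative to this.
\<close>
lemma kernel_pointwise:
  fixes f :: "real \<Rightarrow> real"
  assumes "Ck L f" and supp: "\<And>t. \<bar>t\<bar> \<ge> 2 \<Longrightarrow> f t = 0"
  obtains B where "B > 0" "\<And>m x. m \<ge> (1::nat) \<Longrightarrow>
     norm (smooth_kernel f m x) \<le> B * real m"
   "\<And>m x. m \<ge> (1::nat) \<Longrightarrow>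
     norm (1 - cis x) ^ L * norm (smooth_kernel f m x) \<le> B * real m / real m ^ L"
proof -
  have step: "\<exists>B\<ge>0. \<forall>m x. m \<ge> (1::nat) \<longrightarrow> norm (1 - cis x) ^ l * norm (smooth_kernel f m x) \<le> B * real m / real m ^ l"
    if Ckl: "Ck l f" for l
  proof -
    obtain B where B: "B \<ge> 0" "\<And>h t. h > 0 \<Longrightarrow> \<bar>(bdiff h ^^ l) f t\<bar> \<le> B * h ^ l"
      by (rule bdiff_bound[where R = 2, OF Ckl], erule supp, rule that)
    show ?thesis
    proof (intro exI[of _ "B * (5 + real l)"] conjI allI impI)
      show "0 \<le> B * (5 + real l)" using B(1) by simp
      fix m :: nat and x :: real assume m: "m \<ge> 1"
      define h where "h = 1 / real m"
      have h: "h > 0" "of_int (int (2 * m)) * h = 2" using m by (auto simp: h_def)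
      have "norm (1 - cis x) ^ l * norm (smooth_kernel f m x)
        = norm ((1 - cis x) ^ l * (\<Sum>j=-int (2*m)..int (2*m). of_real (f (of_int j * h)) * cis (of_int j * x)))"
        by (simp add: norm_mult norm_power h_def)
      also have "(1 - cis x) ^ l * (\<Sum>j=-int (2*m)..int (2*m). of_real (f (of_int j * h)) * cis (of_int j * x))
        = (\<Sum>j=-int (2*m)..int (2*m)+int l. of_real ((bdiff h ^^ l) f (of_int j * h)) * cis (of_int j * x))"
        by (rule summation_by_parts_iterate) (use h supp in auto)
      also have "norm \<dots> \<le> (\<Sum>j=-int (2*m)..int (2*m)+int l. B * h ^ l)"
        by (rule sum_norm_le) (use B(2)[OF h(1)] in \<open>auto simp: norm_mult\<close>)
      also have "\<dots> = (4 * real m + 1 + real l) * (B * h ^ l)" by simp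
      also have "\<dots> \<le> ((5 + real l) * real m) * (B * h ^ l)"
      proof (rule mult_right_mono)
        have "1 * (1 + real l) \<le> real m * (1 + real l)" using m by (intro mult_right_mono) auto
        then show "4 * real m + 1 + real l \<le> (5 + real l) * real m" by (simp add: algebra_simps)
      qed (use B(1) h in auto)
      finally show "norm (1 - cis x) ^ l * norm (smooth_kernel f m x) \<le> B * (5 + real l) * real m / real m ^ l"
        by (simp add: h_def power_one_over divide_simps mult_ac)
    qed
  qed
  have "Ck 0 f" using Ck_continuous[OF assms(1)] by simp
  from step[OF this] obtain B0 where B0: "B0 \<ge> 0" "\<And>m x. m \<ge> (1::nat) \<Longrightarrow>
     norm (smooth_kernel f m x) \<le> B0 * real m" by auto
  from step[OF assms(1)] obtain B1 where B1: "B1 \<ge> 0" "\<And>m x. m \<ge> (1::nat) \<Longrightarrow>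
     norm (1 - cis x) ^ L * norm (smooth_kernel f m x) \<le> B1 * real m / real m ^ L" by auto
  show thesis
  proof (rule that[of "B0 + B1 + 1"])
    fix m :: nat and x :: real assume m: "m \<ge> 1"
    have "B0 * real m \<le> (B0 + B1 + 1) * real m" using B1(1) by (intro mult_right_mono) auto
    then show "norm (smooth_kernel f m x) \<le> (B0 + B1 + 1) * real m"
      using B0(2)[OF m, of x] by linarith
    have "B1 * real m / real m ^ L \<le> (B0 + B1 + 1) * real m / real m ^ L" using B0(1) by (intro divide_right_mono mult_right_mono) auto
    then show "norm (1 - cis x) ^ L * norm (smooth_kernel f m x) \<le> (B0 + B1 + 1) * real m / real m ^ L"
      using B1(2)[OF m, of x] by linarith
  qed (use B0(1) B1(1) in auto)
qed

lemma sin_ge_half: "0 \<le> y \<Longrightarrow> y \<le> pi / 2 \<Longrightarrow> y / 2 \<le> sin y"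
proof (cases "y \<le> pi / 3")
  case True
  assume y: "0 \<le> y"
  have "sin 0 - 0 / 2 \<le> sin y - y / 2"
  proof (rule DERIV_nonneg_imp_nondecreasing[OF y])
    fix x assume x: "0 \<le> x" "x \<le> y"
    have "cos (pi / 3) \<le> cos x" 
      by (rule cos_monotone_0_pi_le) (use x True pi_gt_zero in linarith)+
    then have "0 \<le> cos x - 1 / 2" by (simp add: cos_60)
    then show "\<exists>D. ((\<lambda>x. sin x - x / 2) has_real_derivative D) (at x) \<and> 0 \<le> D"
      by (intro exI[of _ "cos x - 1 / 2"]) (auto intro!: derivative_eq_intros)
  qed
  then show ?thesis by simp
next
  case False
  assume y: "y \<le> pi / 2"
  have "sin (pi / 3) \<le> sin y" using y False by (intro sin_monotone_2pi_le) auto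
  moreover have "1.6 \<le> sqrt 3" by (rule real_le_rsqrt) (simp add: power2_eq_square)
  ultimately have "sin y \<ge> 0.8" unfolding sin_60 by linarith
  moreover have "y / 2 \<le> 0.8" using y pi_approx by simp
  ultimately show ?thesis by linarith
qed

lemma norm_one_minus_cis: "norm (1 - cis x) = 2 * \<bar>sin (x / 2)\<bar>"
proof -
  have "(norm (1 - cis x))\<^sup>2 = (1 - cos x)\<^sup>2 + (sin x)\<^sup>2" by (simp add: cmod_power2)
  also have "\<dots> = 2 - 2 * cos x" using sin_cos_squared_add[of x] by (simp add: power2_eq_square algebra_simps)
  also have "\<dots> = (2 * \<bar>sin (x / 2)\<bar>)\<^sup>2" using cos_double_sin[of "x / 2"] by (simp add: power2_eq_square algebra_simps)
  finally show ?thesis by (rule power2_eq_imp_eq) auto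
qed

lemma norm_one_minus_cis_ge:
  assumes "0 \<le> x" "x \<le> 2 * pi"
  shows "norm (1 - cis x) \<ge> min x (2 * pi - x) / 2"
proof (cases "x \<le> pi")
  case True
  then have "x / 2 / 2 \<le> sin (x / 2)" using assms by (intro sin_ge_half) auto
  then show ?thesis using True unfolding norm_one_minus_cis by linarith
next
  case False
  then have "(pi - x / 2) / 2 \<le> sin (pi - x / 2)" using assms by (intro sin_ge_half) auto
  moreover have "min x (2 * pi - x) \<le> 2 * pi - x" by simp
  ultimately show ?thesis unfolding norm_one_minus_cis sin_pi_minus by argo
qed

lemma lebesgue_circle_integral:
  fixes f :: "real \<Rightarrow> 'b::euclidean_space"
  assumes "continuous_on {0..2 * pi} f"
  shows "integrable (lebesgue_on {0..2 * pi}) f" "integral\<^sup>L (lebesgue_on {0..2 * pi}) f = integral {0..2 * pi} f"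
proof -
  show 1: "integrable (lebesgue_on {0..2 * pi}) f" using assms by (rule continuous_imp_integrable_real)
  show "integral\<^sup>L (lebesgue_on {0..2 * pi}) f = integral {0..2 * pi} f"
    by (rule lebesgue_integral_eq_integral[OF 1]) simp
qed

text \<open>
  The majorant for the kernel: one bump of width \<open>1/m\<close> at each of the end points \<open>0\<close> and \<open>2\<pi>\<close>, which
  are the same point of the circle.
\<close>
lemma double_bump_integral:
  fixes m :: real
  assumes m: "m > 0"
  defines "g \<equiv> \<lambda>x. 1 / (1 + (m * x / 2)\<^sup>2) + 1 / (1 + (m * (2 * pi - x) / 2)\<^sup>2)"
  shows "continuous_on {0..2 * pi} g" "integral {0..2 * pi} g \<le> 2 * pi / m"
proof -
  have pos: "1 + y\<^sup>2 \<noteq> 0" for y :: real using zero_le_power2[of y] by linarith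
  show "continuous_on {0..2 * pi} g" unfolding g_def by (intro continuous_intros ballI pos) simp_all
  define G where "G = (\<lambda>x. 2 / m * arctan (m * x / 2) - 2 / m * arctan (m * (2 * pi - x) / 2))"
  have "(g has_integral (G (2 * pi) - G 0)) {0..2 * pi}"
  proof (rule fundamental_theorem_of_calculus)
    fix x assume "x \<in> {0..2 * pi}"
    have "(G has_real_derivative g x) (at x within {0..2 * pi})"
    proof (rule DERIV_cong)
      have 1: "((\<lambda>x. arctan (m * x / 2)) has_real_derivative inverse (1 + (m * x / 2)\<^sup>2) * (m / 2)) (at x within {0..2 * pi})"
        by (rule DERIV_chain2[where f = arctan and g = "\<lambda>x. m * x / 2", OF DERIV_arctan])
           (auto intro!: derivative_eq_intros)
      have 2: "((\<lambda>x. arctan (m * (2 * pi - x) / 2)) has_real_derivative inverse (1 + (m * (2 * pi - x) / 2)\<^sup>2) * (- m / 2)) (at x within {0..2 * pi})"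
        by (rule DERIV_chain2[where f = arctan and g = "\<lambda>x. m * (2 * pi - x) / 2", OF DERIV_arctan])
           (auto intro!: derivative_eq_intros)
      show "(G has_real_derivative (2 / m * (inverse (1 + (m * x / 2)\<^sup>2) * (m / 2))
         - 2 / m * (inverse (1 + (m * (2 * pi - x) / 2)\<^sup>2) * (- m / 2)))) (at x within {0..2 * pi})"
        unfolding G_def by (rule DERIV_diff[OF DERIV_cmult[OF 1] DERIV_cmult[OF 2]])
      show "2 / m * (inverse (1 + (m * x / 2)\<^sup>2) * (m / 2))
         - 2 / m * (inverse (1 + (m * (2 * pi - x) / 2)\<^sup>2) * (- m / 2)) = g x"
      proof -
        have "2 / m * (i * (m / 2)) - 2 / m * (k * (- m / 2)) = i + k" for i k :: real
          using m by (simp add: field_simps)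
        then show ?thesis unfolding g_def by (simp only: inverse_eq_divide)
      qed
    qed
    then show "(G has_vector_derivative g x) (at x within {0..2 * pi})"
      unfolding has_real_derivative_iff_has_vector_derivative .
  qed simp
  then have "integral {0..2 * pi} g = G (2 * pi) - G 0" by (rule integral_unique)
  also have "\<dots> = 4 / m * arctan (m * pi)" 
  proof -
    have "m * (2 * pi) / 2 = m * pi" by simp
    then show ?thesis unfolding G_def by simp
  qed
  also have "\<dots> \<le> 4 / m * (pi / 2)"
    using arctan_ubound[of "m * pi"] m by (intro mult_left_mono) auto
  finally show "integral {0..2 * pi} g \<le> 2 * pi / m" by simp
qed

text \<open>
  For \<open>L p \<ge> 2\<close> the \<open>p\<close>-th power of the kernel decays at least like an inverse square, so its integral
  is of the order of height to the power \<open>p\<close> times width, that is \<open>m\<^sup>p / m\<close>.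
\<close>
lemma kernel_p_integral:
  fixes f :: "real \<Rightarrow> real"
  assumes p: "0 < p" "2 \<le> p * real L" and f: "Ck L f" "\<And>t. \<bar>t\<bar> \<ge> 2 \<Longrightarrow> f t = 0"
  obtains C where "C > 0" "\<And>m. m \<ge> (1::nat) \<Longrightarrow>
     (LINT x|lebesgue_on {0..2 * pi}. norm (smooth_kernel f m x) powr p)
       \<le> C * real m powr (p - 1)"
proof -
  define H where "H = (\<lambda>(m::nat) x. \<Sum>j=-int (2*m)..int (2*m). of_real (f (of_int j / real m)) * cis (of_int j * x))"
  obtain B where B: "B > 0" "\<And>m x. m \<ge> 1 \<Longrightarrow> norm (H m x) \<le> B * real m"
    "\<And>m x. m \<ge> 1 \<Longrightarrow> norm (1 - cis x) ^ L * norm (H m x) \<le> B * real m / real m ^ L"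
    by (rule kernel_pointwise[OF f(1)], erule f(2), rule that, unfold H_def)
  show thesis
  proof (rule that[of "4 * pi * B powr p"])
    fix m :: nat assume m: "m \<ge> 1"
    define g where "g = (\<lambda>x. 1 / (1 + (real m * x / 2)\<^sup>2) + 1 / (1 + (real m * (2 * pi - x) / 2)\<^sup>2))"
    have mp: "real m > 0" using m by simp
    note g = double_bump_integral[OF mp, folded g_def]
    have cH: "continuous_on {0..2 * pi} (\<lambda>x. norm (H m x) powr p)"
      unfolding H_def using p(1) by (intro continuous_on_powr' continuous_intros) auto
    have bound: "norm (H m x) powr p \<le> (B * real m) powr p * 2 * g x" if x: "x \<in> {0..2 * pi}" for x
    proof -
      \<comment> \<open>the distance of \<open>x\<close> from the origin of the circle, measured in units of \<open>2 / m\<close>\<close>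
      define w where "w = real m * min x (2 * pi - x) / 2"
      have w0: "w \<ge> 0" using x by (simp add: w_def)
      have gw: "1 / (1 + w\<^sup>2) \<le> g x"
        unfolding g_def w_def by (cases "x \<le> 2 * pi - x") (auto simp: min_def)
      have Bm: "B * real m \<ge> 0" using B(1) by simp
      have "norm (H m x) powr p \<le> (B * real m) powr p * (2 * (1 / (1 + w\<^sup>2)))"
      proof (cases "w \<le> 1")
        case True
        have "w\<^sup>2 \<le> 1" using True w0 by (simp add: power_le_one)
        then have "1 \<le> 2 * (1 / (1 + w\<^sup>2))" by (simp add: field_simps add_pos_nonneg)
        then have "(B * real m) powr p * 1 \<le> (B * real m) powr p * (2 * (1 / (1 + w\<^sup>2)))"
          by (intro mult_left_mono) auto
        moreover have "norm (H m x) powr p \<le> (B * real m) powr p"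
          using B(2)[OF m] p(1) by (intro powr_mono2) auto
        ultimately show ?thesis by linarith
      next
        case False
        have "w ^ L * norm (H m x) \<le> (real m * norm (1 - cis x)) ^ L * norm (H m x)"
          using norm_one_minus_cis_ge[of x] x mp w0 unfolding w_def
          by (intro mult_right_mono power_mono) (auto simp: field_simps)
        also have "\<dots> = real m ^ L * (norm (1 - cis x) ^ L * norm (H m x))" by (simp add: power_mult_distrib)
        also have "\<dots> \<le> real m ^ L * (B * real m / real m ^ L)" using B(3)[OF m] by (intro mult_left_mono) auto
        also have "\<dots> = B * real m" using mp by simp
        finally have "norm (H m x) \<le> (B * real m) / w ^ L" using False by (simp add: field_simps)
        then have "norm (H m x) powr p \<le> ((B * real m) / w ^ L) powr p" using p(1) by (intro powr_mono2) auto
        also have "\<dots> = (B * real m) powr p / w powr (p * real L)"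
          using False Bm by (simp add: powr_divide powr_realpow[symmetric] powr_powr mult.commute)
        also have "\<dots> \<le> (B * real m) powr p / w\<^sup>2"
        proof (rule divide_left_mono)
          have "w powr 2 \<le> w powr (p * real L)" using False p(2) by (intro powr_mono) auto
          then show "w\<^sup>2 \<le> w powr (p * real L)" using False by (simp add: powr_numeral)
          show "0 < w powr (p * real L) * w\<^sup>2" using False by simp
        qed simp
        also have "\<dots> = (B * real m) powr p * (1 / w\<^sup>2)" by simp
        also have "\<dots> \<le> (B * real m) powr p * (2 * (1 / (1 + w\<^sup>2)))"
        proof (rule mult_left_mono)
          have "w\<^sup>2 \<ge> 1" using False by (simp add: one_le_power)
          then have "2 / (2 * w\<^sup>2) \<le> 2 / (1 + w\<^sup>2)" 
            by (intro divide_left_mono mult_pos_pos) (use \<open>w\<^sup>2 \<ge> 1\<close> in linarith)+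
          then show "1 / w\<^sup>2 \<le> 2 * (1 / (1 + w\<^sup>2))" by simp
        qed simp
        finally show ?thesis .
      qed
      also have "\<dots> \<le> (B * real m) powr p * (2 * g x)" using gw by (intro mult_left_mono) auto
      finally show ?thesis by simp
    qed
    have "(LINT x|lebesgue_on {0..2 * pi}. norm (H m x) powr p) = integral {0..2 * pi} (\<lambda>x. norm (H m x) powr p)"
      using lebesgue_circle_integral(2)[OF cH] .
    also have "\<dots> \<le> integral {0..2 * pi} (\<lambda>x. (B * real m) powr p * 2 * g x)"
      using bound by (intro integral_le integrable_continuous_real cH continuous_intros g(1)) auto
    also have "\<dots> = (B * real m) powr p * 2 * integral {0..2 * pi} g" by simp
    also have "\<dots> \<le> (B * real m) powr p * 2 * (2 * pi / real m)"
      using g(2) by (intro mult_left_mono) auto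
    also have "\<dots> = 4 * pi * B powr p * real m powr (p - 1)"
      using B(1) mp by (simp add: powr_mult powr_diff field_simps)
    finally show "(LINT x|lebesgue_on {0..2 * pi}. norm (smooth_kernel f m x) powr p)
       \<le> 4 * pi * B powr p * real m powr (p - 1)" unfolding H_def .
  qed (use B(1) in simp)
qed

section \<open>Trigonometric polynomials and exact quadrature\<close>

text \<open>
  The \<open>p\<close>-th power of the quasi-norm, which for \<open>p \<le> 1\<close> is subadditive.
\<close>
definition p_integral :: "real \<Rightarrow> (real \<Rightarrow> complex) \<Rightarrow> real" where
  "p_integral p f = (LINT x|lebesgue_on {0..2 * pi}. norm (f x) powr p)"

definition tpoly :: "nat \<Rightarrow> (int \<Rightarrow> complex) \<Rightarrow> real \<Rightarrow> complex" where
  "tpoly N c x = (\<Sum>k=-int N..int N. c k * cis (of_int k * x))"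

lemma tpoly_continuous: "continuous_on S (tpoly N c)"
  unfolding tpoly_def[abs_def] by (intro continuous_intros)

lemma cis_of_int_periodic: "cis (of_int k * (x + 2 * pi)) = cis (of_int k * x)"
proof -
  have "cis (of_int k * (x + 2 * pi)) = cis (of_int k * x) * cis (2 * pi * of_int k)"
    by (simp add: cis_mult algebra_simps)
  then show ?thesis by simp
qed

lemma tpoly_periodic: "tpoly N c (x + 2 * pi) = tpoly N c x"
  unfolding tpoly_def cis_of_int_periodic ..

lemma tpoly_diff: "tpoly N c x - tpoly N d x = tpoly N (\<lambda>k. c k - d k) x"
  by (simp add: tpoly_def sum_subtractf algebra_simps)

lemma tpoly_sum: "(\<Sum>i\<in>A. tpoly N (c i) x) = tpoly N (\<lambda>k. \<Sum>i\<in>A. c i k) x"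
  unfolding tpoly_def by (subst sum.swap) (simp add: sum_distrib_right)

lemma tpoly_cmult: "a * tpoly N c x = tpoly N (\<lambda>k. a * c k) x"
  by (simp add: tpoly_def sum_distrib_left mult.assoc)

lemma tpoly_extend:
  assumes "N \<le> M" "\<And>k. \<bar>k\<bar> > int N \<Longrightarrow> c k = 0"
  shows "tpoly M c x = tpoly N c x"
  unfolding tpoly_def by (rule sum.mono_neutral_right) (use assms in auto)

lemma tpoly_cong: "(\<And>k. \<bar>k\<bar> \<le> int N \<Longrightarrow> c k = d k) \<Longrightarrow> tpoly N c x = tpoly N d x"
  unfolding tpoly_def by (rule sum.cong) auto

lemma tpoly_in_trig_polys: "tpoly N c \<in> trig_polys N"
  unfolding trig_polys_def tpoly_def by auto

lemma trig_polysE: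
  assumes "T \<in> trig_polys N"
  obtains c where "T = tpoly N c" "\<And>k. \<bar>k\<bar> > int N \<Longrightarrow> c k = 0"
proof -
  obtain c where c: "\<And>x. T x = tpoly N c x"
    using assms unfolding trig_polys_def tpoly_def by blast
  show thesis
  proof (rule that[of "\<lambda>k. if \<bar>k\<bar> \<le> int N then c k else 0"])
    show "T = tpoly N (\<lambda>k. if \<bar>k\<bar> \<le> int N then c k else 0)"
      unfolding c by (intro ext) (auto simp: c intro: tpoly_cong)
  qed auto
qed

text \<open>
  After division by the sum, every term lies in \<open>[0, 1]\<close> and is thus at most its own \<open>p\<close>-th power.
\<close>
lemma powr_sum_le:
  fixes a :: "'a \<Rightarrow> real"
  assumes "0 < p" "p \<le> 1" "\<And>i. i \<in> I \<Longrightarrow> a i \<ge> 0"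
  shows "(\<Sum>i\<in>I. a i) powr p \<le> (\<Sum>i\<in>I. a i powr p)"
proof (cases "finite I \<and> (\<Sum>i\<in>I. a i) > 0")
  case False
  then have "infinite I \<or> (\<Sum>i\<in>I. a i) = 0" using sum_nonneg[of I a] assms(3) by force
  then have "(\<Sum>i\<in>I. a i) powr p = 0" by auto
  then show ?thesis by (simp add: sum_nonneg)
next
  case True
  define s where "s = (\<Sum>i\<in>I. a i)"
  have s: "s > 0" using True by (simp add: s_def)
  have "a i / s \<le> (a i / s) powr p" if i: "i \<in> I" for i
  proof (cases "a i = 0")
    case False
    then have "a i > 0" using assms(3)[OF i] by simp
    moreover have "a i \<le> s" unfolding s_def using True i assms(3) by (intro member_le_sum) auto
    ultimately have "(a i / s) powr 1 \<le> (a i / s) powr p" using s assms(2) by (intro powr_mono') auto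
    then show ?thesis using \<open>a i > 0\<close> s by simp
  qed simp
  then have "(\<Sum>i\<in>I. a i / s) \<le> (\<Sum>i\<in>I. (a i / s) powr p)" by (rule sum_mono)
  moreover have "(\<Sum>i\<in>I. a i / s) = 1" using s by (simp add: s_def sum_divide_distrib[symmetric])
  moreover have "(\<Sum>i\<in>I. (a i / s) powr p) = (\<Sum>i\<in>I. a i powr p) / s powr p"
    unfolding sum_divide_distrib by (rule sum.cong) (use assms(3) s in \<open>auto simp: powr_divide\<close>)
  ultimately show ?thesis using s by (simp add: s_def[symmetric] field_simps)
qed

lemma powr_add_le:
  fixes a b :: real
  assumes "0 < p" "p \<le> 1" "a \<ge> 0" "b \<ge> 0"
  shows "(a + b) powr p \<le> a powr p + b powr p"
  using powr_sum_le[OF assms(1,2), of "{False, True}" "\<lambda>i. if i then a else b"] assms(3,4) by (simp add: add.commute)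

lemma integral_periodic_shift:
  fixes f :: "real \<Rightarrow> real"
  assumes cont: "continuous_on UNIV f" and per: "\<And>x. f (x + 2 * pi) = f x"
  shows "integral {0..2 * pi} (\<lambda>x. f (x + a)) = integral {0..2 * pi} f"
proof -
  define lo where "lo = - \<bar>a\<bar> - 1"
  define hi where "hi = \<bar>a\<bar> + 2 * pi + 1"
  obtain g where g: "\<And>x. x \<in> {lo..hi} \<Longrightarrow> (g has_vector_derivative f x) (at x within {lo..hi})"
    using antiderivative_continuous[OF continuous_on_subset[OF cont], of lo hi] by blast
  have gd: "(g has_real_derivative f x) (at x)" if "x \<in> {lo<..<hi}" for x
    using g[of x] that at_within_Icc_at[of lo x hi]
    by (simp add: has_real_derivative_iff_has_vector_derivative)
  have shift: "integral {0..2 * pi} (\<lambda>x. f (x + b)) = g (2 * pi + b) - g b" if "\<bar>b\<bar> \<le> \<bar>a\<bar>" for b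
  proof -
    have "((\<lambda>x. f (x + b)) has_integral (g (2 * pi + b) - g (0 + b))) {0..2 * pi}"
    proof (rule fundamental_theorem_of_calculus)
      fix x assume x: "x \<in> {0..2 * pi}"
      then have "x + b \<in> {lo<..<hi}" using that by (auto simp: lo_def hi_def)
      from gd[OF this] have "((\<lambda>x. g (x + b)) has_real_derivative f (x + b)) (at x)" by (simp add: DERIV_shift)
      then show "((\<lambda>x. g (x + b)) has_vector_derivative f (x + b)) (at x within {0..2 * pi})"
        unfolding has_real_derivative_iff_has_vector_derivative by (rule has_vector_derivative_at_within)
    qed simp
    then show ?thesis by (simp add: integral_unique)
  qed
  define K where "K = (\<lambda>u. g (u + 2 * pi) - g u)"
  have dK: "(K has_real_derivative 0) (at u)" if "\<bar>u\<bar> \<le> \<bar>a\<bar>" for u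
  proof -
    have 1: "u + 2 * pi \<in> {lo<..<hi}" "u \<in> {lo<..<hi}" using that pi_gt_zero unfolding lo_def hi_def by (auto simp del: pi_gt_zero)
    have "((\<lambda>u. g (u + 2 * pi)) has_real_derivative f (u + 2 * pi)) (at u)" using gd[OF 1(1)] by (simp add: DERIV_shift)
    from DERIV_diff[OF this gd[OF 1(2)]] show ?thesis by (simp add: K_def per)
  qed
  have "K a = K 0"
  proof -
    have "\<exists>c. \<forall>x\<in>{- \<bar>a\<bar>..\<bar>a\<bar>}. K x = c"
      by (rule has_field_derivative_zero_constant) (auto intro!: has_field_derivative_at_within dK)
    then obtain c where "\<And>x. x \<in> {- \<bar>a\<bar>..\<bar>a\<bar>} \<Longrightarrow> K x = c" by blast
    moreover have "a \<in> {- \<bar>a\<bar>..\<bar>a\<bar>}" "0 \<in> {- \<bar>a\<bar>..\<bar>a\<bar>}" unfolding atLeastAtMost_iff by linarith+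
    ultimately show ?thesis by metis
  qed
  then show ?thesis using shift[of a] shift[of 0] by (simp add: K_def add.commute)
qed

lemma continuous_powr_norm:
  fixes f :: "real \<Rightarrow> complex"
  shows "0 < p \<Longrightarrow> continuous_on S f \<Longrightarrow> continuous_on S (\<lambda>x. norm (f x) powr p)"
  by (intro continuous_on_powr' continuous_intros) auto

lemma p_integral_shift:
  assumes "0 < p" "continuous_on UNIV f" "\<And>x. f (x + 2 * pi) = f x"
  shows "p_integral p (\<lambda>x. f (x + a)) = p_integral p f"
proof -
  have c: "continuous_on UNIV (\<lambda>x. f (x + a))"
    by (rule continuous_on_compose2[OF assms(2)]) (auto intro: continuous_intros)
  have "integral {0..2 * pi} (\<lambda>x. norm (f (x + a)) powr p) = integral {0..2 * pi} (\<lambda>x. norm (f x) powr p)"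
    by (rule integral_periodic_shift[of "\<lambda>x. norm (f x) powr p"]) (use assms continuous_powr_norm in auto)
  then show ?thesis unfolding p_integral_def
    using lebesgue_circle_integral(2)[OF continuous_powr_norm[OF assms(1) continuous_on_subset[OF c]]]
      lebesgue_circle_integral(2)[OF continuous_powr_norm[OF assms(1) continuous_on_subset[OF assms(2)]]]
    by simp
qed

lemma p_integral_nonneg: "p_integral p f \<ge> 0"
  unfolding p_integral_def by (intro Bochner_Integration.integral_nonneg) auto

lemma roots_of_unity_sum:
  fixes d :: int
  assumes "\<bar>d\<bar> < int M"
  shows "(\<Sum>l<M. cis (of_int d * (2 * pi * real l / real M))) = (if d = 0 then of_nat M else 0)"
proof (cases "d = 0")
  case False
  define w where "w = cis (of_int d * (2 * pi / real M))"
  have M: "M > 0" using assms by auto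
  have wl: "cis (of_int d * (2 * pi * real l / real M)) = w ^ l" for l
  proof -
    have "of_int d * (2 * pi * real l / real M) = real l * (of_int d * (2 * pi / real M))" by simp
    then show ?thesis unfolding w_def Complex.DeMoivre by (rule arg_cong)
  qed
  have "w ^ M = 1" unfolding wl[symmetric] using M by (simp add: mult.commute[of "of_int d"])
  moreover have "w \<noteq> 1"
  proof
    assume "w = 1"
    then obtain n where "of_int d * (2 * pi / real M) = of_int n * (2 * pi)" unfolding w_def cis_eq_1_iff by blast
    then have "of_int d = of_int n * real M" using M by (simp add: field_simps)
    then have "d = n * int M" by (metis of_int_eq_iff of_int_mult of_int_of_nat_eq)
    then show False using assms False by (cases "n = 0") (auto simp: abs_mult dest: zdvd_imp_le)
  qed
  ultimately show ?thesis using False unfolding wl by (simp add: sum_gp_strict)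
qed simp

text \<open>
  A rule with \<open>M\<close> equidistant nodes integrates exponentials of frequency below \<open>M\<close> exactly, and the
  product of the two polynomials has only such frequencies. The offset \<open>s\<close> of the nodes stays free;
  it is averaged over later.
\<close>
lemma quadrature:
  fixes c h :: "int \<Rightarrow> complex"
  assumes M: "M > N + J" and h: "\<forall>k. \<bar>k\<bar> > int J \<longrightarrow> h k = 0"
  shows "(1 / of_nat M) * (\<Sum>l<M. tpoly N c (s + 2 * pi * real l / real M) * tpoly J h (x - (s + 2 * pi * real l / real M)))
     = tpoly N (\<lambda>k. c k * h k) x"
proof -
  define t where "t = (\<lambda>l. 2 * pi * real l / real M)"
  have M0: "of_nat M \<noteq> (0::complex)" using M by auto
  have tm: "tpoly N c (s + t l) * tpoly J h (x - (s + t l)) =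
     (\<Sum>k=-int N..int N. \<Sum>j=-int J..int J. c k * h j * (cis (of_int j * x) * cis (of_int (k - j) * s)) * cis (of_int (k - j) * t l))" for l
  proof -
    have "cis (of_int k * (s + t l)) * cis (of_int j * (x - (s + t l)))
       = cis (of_int j * x) * cis (of_int (k - j) * s) * cis (of_int (k - j) * t l)" for k j :: int
      by (simp add: cis_mult algebra_simps)
    then have "c k * cis (of_int k * (s + t l)) * (h j * cis (of_int j * (x - (s + t l))))
       = c k * h j * (cis (of_int j * x) * cis (of_int (k - j) * s)) * cis (of_int (k - j) * t l)" for k j :: int
      by (simp add: mult_ac)
    then show ?thesis unfolding tpoly_def sum_product by (intro sum.cong refl)
  qed
  have "(\<Sum>l<M. tpoly N c (s + t l) * tpoly J h (x - (s + t l)))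
     = (\<Sum>k=-int N..int N. \<Sum>j=-int J..int J. \<Sum>l<M. c k * h j * (cis (of_int j * x) * cis (of_int (k - j) * s)) * cis (of_int (k - j) * t l))"
    unfolding tm by (subst sum.swap) (subst (2) sum.swap, rule refl)
  also have "\<dots> = (\<Sum>k=-int N..int N. \<Sum>j=-int J..int J. if j = k then of_nat M * (c k * h k * cis (of_int k * x)) else 0)"
  proof (intro sum.cong refl)
    fix k j assume kj: "k \<in> {-int N..int N}" "j \<in> {-int J..int J}"
    have "(\<Sum>l<M. cis (of_int (k - j) * t l)) = (if k - j = 0 then of_nat M else 0)"
      unfolding t_def by (rule roots_of_unity_sum) (use kj M in auto)
    then show "(\<Sum>l<M. c k * h j * (cis (of_int j * x) * cis (of_int (k - j) * s)) * cis (of_int (k - j) * t l))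
       = (if j = k then of_nat M * (c k * h k * cis (of_int k * x)) else 0)"
      unfolding sum_distrib_left[symmetric] by simp
  qed
  also have "\<dots> = (\<Sum>k=-int N..int N. of_nat M * (c k * h k * cis (of_int k * x)))"
  proof (rule sum.cong[OF refl])
    fix k
    show "(\<Sum>j=-int J..int J. if j = k then of_nat M * (c k * h k * cis (of_int k * x)) else 0) = of_nat M * (c k * h k * cis (of_int k * x))"
      using h by (cases "\<bar>k\<bar> > int J") (auto simp: sum.delta)
  qed
  also have "\<dots> = of_nat M * tpoly N (\<lambda>k. c k * h k) x" by (simp add: tpoly_def sum_distrib_left)
  finally show ?thesis using M0 by (simp add: t_def)
qed

text \<open>
  Applied to the quadrature sum, subadditivity of the \<open>p\<close>-th power gives what it could not give for
  the convolution integral.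
\<close>
lemma convolution_pointwise:
  fixes c h :: "int \<Rightarrow> complex"
  assumes p: "0 < p" "p \<le> 1" and M: "M > N + J" and h: "\<forall>k. \<bar>k\<bar> > int J \<longrightarrow> h k = 0"
  shows "norm (tpoly N (\<lambda>k. c k * h k) x) powr p \<le>
    real M powr (-p) * (\<Sum>l<M. norm (tpoly N c (s + 2 * pi * real l / real M)) powr p * norm (tpoly J h (x - (s + 2 * pi * real l / real M))) powr p)"
proof -
  let ?t = "\<lambda>l. s + 2 * pi * real l / real M"
  have M0: "real M > 0" using M by simp
  have "norm (tpoly N (\<lambda>k. c k * h k) x) = (1 / real M) * norm (\<Sum>l<M. tpoly N c (?t l) * tpoly J h (x - ?t l))"
    unfolding quadrature[OF M h, of c s x, symmetric] by (simp add: norm_mult norm_divide)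
  also have "\<dots> \<le> (1 / real M) * (\<Sum>l<M. norm (tpoly N c (?t l)) * norm (tpoly J h (x - ?t l)))"
    by (intro mult_left_mono sum_norm_le) (auto simp: norm_mult)
  finally have "norm (tpoly N (\<lambda>k. c k * h k) x) powr p \<le> ((1 / real M) * (\<Sum>l<M. norm (tpoly N c (?t l)) * norm (tpoly J h (x - ?t l)))) powr p"
    using p(1) by (intro powr_mono2) auto
  also have "\<dots> = real M powr (-p) * (\<Sum>l<M. norm (tpoly N c (?t l)) * norm (tpoly J h (x - ?t l))) powr p"
    using M0 by (subst powr_mult) (auto intro: sum_nonneg simp: powr_minus powr_divide divide_simps)
  also have "\<dots> \<le> real M powr (-p) * (\<Sum>l<M. (norm (tpoly N c (?t l)) * norm (tpoly J h (x - ?t l))) powr p)"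
    using p by (intro mult_left_mono powr_sum_le) auto
  finally show ?thesis by (simp add: powr_mult)
qed

text \<open>
  When the offset runs through a period, each node does so too, and the sampled sum turns into the
  full \<open>p\<close>-integral.
\<close>
lemma grid_average:
  assumes p: "0 < p" and le: "\<And>s. A \<le> B * (\<Sum>l<M. norm (tpoly N c (s + 2 * pi * real l / real M)) powr p)"
  shows "2 * pi * A \<le> B * real M * p_integral p (tpoly N c)"
proof -
  define f where "f = (\<lambda>l s. norm (tpoly N c (s + 2 * pi * real l / real M)) powr p)"
  have cf: "continuous_on {0..2 * pi} (f l)" for l
    unfolding f_def using p
    by (intro continuous_powr_norm continuous_on_compose2[OF tpoly_continuous[of UNIV]] continuous_intros) auto
  have "2 * pi * A = integral {0..2 * pi} (\<lambda>s. A)" by simp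
  also have "\<dots> \<le> integral {0..2 * pi} (\<lambda>s. B * (\<Sum>l<M. f l s))"
    using le by (intro integral_le integrable_continuous_real continuous_intros cf) (auto simp: f_def)
  also have "\<dots> = B * (\<Sum>l<M. integral {0..2 * pi} (f l))"
    using cf by (simp add: integral_sum integrable_continuous_real)
  also have "(\<Sum>l<M. integral {0..2 * pi} (f l)) = (\<Sum>l<M. p_integral p (tpoly N c))"
  proof (rule sum.cong[OF refl])
    fix l
    have "integral {0..2 * pi} (f l) = p_integral p (\<lambda>s. tpoly N c (s + 2 * pi * real l / real M))"
      by (subst lebesgue_circle_integral(2)[OF cf, symmetric]) (simp only: p_integral_def f_def)
    also have "\<dots> = p_integral p (tpoly N c)"
      by (rule p_integral_shift[OF p tpoly_continuous tpoly_periodic])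
    finally show "integral {0..2 * pi} (f l) = p_integral p (tpoly N c)" .
  qed
  finally show ?thesis by (simp add: mult.assoc)
qed

text \<open>
  A substitute for Young's inequality. The factor \<open>M\<^sup>1\<^sup>-\<^sup>p\<close> is the price for \<open>p < 1\<close>; it is the source of
  the weights in the theorem.
\<close>
lemma convolution_p_integral:
  fixes c h :: "int \<Rightarrow> complex"
  assumes p: "0 < p" "p \<le> 1" and M: "M > N + J" and h: "\<forall>k. \<bar>k\<bar> > int J \<longrightarrow> h k = 0"
  shows "2 * pi * p_integral p (tpoly N (\<lambda>k. c k * h k)) \<le>
    real M powr (1 - p) * p_integral p (tpoly N c) * p_integral p (tpoly J h)"
proof -
  let ?A = "p_integral p (tpoly N (\<lambda>k. c k * h k))" and ?H = "p_integral p (tpoly J h)"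
  have M0: "real M > 0" using M by simp
  have "?A \<le> (real M powr (-p) * ?H) * (\<Sum>l<M. norm (tpoly N c (s + 2 * pi * real l / real M)) powr p)" for s
  proof -
    let ?t = "\<lambda>l. s + 2 * pi * real l / real M"
    define H where "H = (\<lambda>l x. norm (tpoly J h (x - ?t l)) powr p)"
    have cH: "continuous_on {0..2 * pi} (H l)" for l
      unfolding H_def using p(1)
      by (intro continuous_powr_norm continuous_on_compose2[OF tpoly_continuous[of UNIV]] continuous_intros) auto
    have iH: "integral {0..2 * pi} (H l) = ?H" for l
    proof -
      have "integral {0..2 * pi} (H l) = p_integral p (\<lambda>x. tpoly J h (x + (- ?t l)))"
        by (subst lebesgue_circle_integral(2)[OF cH, symmetric])
           (simp only: p_integral_def H_def diff_conv_add_uminus)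
      also have "\<dots> = ?H" by (rule p_integral_shift[OF p(1) tpoly_continuous tpoly_periodic])
      finally show ?thesis .
    qed
    have "?A = integral {0..2 * pi} (\<lambda>x. norm (tpoly N (\<lambda>k. c k * h k) x) powr p)"
      unfolding p_integral_def by (rule lebesgue_circle_integral(2)) (intro continuous_powr_norm p tpoly_continuous)
    also have "\<dots> \<le> integral {0..2 * pi} (\<lambda>x. real M powr (-p) * (\<Sum>l<M. norm (tpoly N c (?t l)) powr p * H l x))"
      using convolution_pointwise[OF p M h, of c _ s] unfolding H_def[symmetric]
      by (intro integral_le integrable_continuous_real continuous_intros cH continuous_powr_norm p tpoly_continuous) (auto simp: H_def)
    also have "\<dots> = real M powr (-p) * (\<Sum>l<M. norm (tpoly N c (?t l)) powr p * ?H)"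
    proof -
      have "integral {0..2 * pi} (\<lambda>x. \<Sum>l<M. norm (tpoly N c (?t l)) powr p * H l x)
         = (\<Sum>l<M. integral {0..2 * pi} (\<lambda>x. norm (tpoly N c (?t l)) powr p * H l x))"
        by (rule integral_sum) (auto intro!: integrable_continuous_real continuous_intros cH)
      then show ?thesis by (simp add: iH)
    qed
    finally have "?A \<le> real M powr (-p) * ((\<Sum>l<M. norm (tpoly N c (?t l)) powr p) * ?H)"
      unfolding sum_distrib_right .
    then show ?thesis by (simp only: mult_ac)
  qed
  from grid_average[OF p(1) this] have "2 * pi * ?A \<le> real M powr (-p) * ?H * real M * p_integral p (tpoly N c)" .
  moreover have E: "real M powr (-p) * real M = real M powr (1 - p)" using M0 by (simp add: powr_diff powr_minus divide_simps)
  ultimately show ?thesis unfolding E[symmetric] by (simp only: mult_ac)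
qed

text \<open>
  A polynomial of degree \<open>N\<close> is reproduced by convolution with the Dirichlet kernel, which is bounded
  by the number \<open>2 N + 1\<close> of nodes.
\<close>
lemma nikolskii_pointwise:
  assumes p: "0 < p" "p \<le> 1"
  shows "2 * pi * norm (tpoly N c x) powr p \<le> real (2 * N + 1) * p_integral p (tpoly N c)"
proof -
  define h where "h = (\<lambda>k. if \<bar>k\<bar> \<le> int N then 1 else 0 :: complex)"
  define M where "M = 2 * N + 1"
  have M: "M > N + N" "real M > 0" by (auto simp: M_def)
  have H: "norm (tpoly N h y) \<le> real M" for y
  proof -
    have "norm (tpoly N h y) \<le> (\<Sum>k=-int N..int N. 1)"
      unfolding tpoly_def by (rule sum_norm_le) (simp add: norm_mult h_def)
    then show ?thesis by (simp add: M_def)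
  qed
  have "norm (tpoly N c x) powr p \<le> 1 * (\<Sum>l<M. norm (tpoly N c (s + 2 * pi * real l / real M)) powr p)" for s
  proof -
    let ?t = "\<lambda>l. s + 2 * pi * real l / real M"
    have "norm (tpoly N c x) powr p = norm (tpoly N (\<lambda>k. c k * h k) x) powr p"
      by (subst tpoly_cong[of N c "\<lambda>k. c k * h k"]) (auto simp: h_def)
    also have "\<dots> \<le> real M powr (-p) * (\<Sum>l<M. norm (tpoly N c (?t l)) powr p * norm (tpoly N h (x - ?t l)) powr p)"
      by (rule convolution_pointwise[OF p M(1)]) (simp add: h_def)
    also have "\<dots> \<le> real M powr (-p) * (\<Sum>l<M. norm (tpoly N c (?t l)) powr p * real M powr p)"
      using p H by (intro mult_left_mono sum_mono powr_mono2) auto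
    also have "\<dots> = (\<Sum>l<M. norm (tpoly N c (?t l)) powr p)"
      using M(2) by (simp add: sum_distrib_right[symmetric] powr_minus)
    finally show ?thesis by simp
  qed
  from grid_average[OF p(1) this] show ?thesis by (simp add: M_def)
qed

section \<open>Antiderivatives of trigonometric polynomials\<close>
lemma p_integral_tpoly_sum:
  assumes p: "0 < p" "p \<le> 1" and fin: "finite A"
  shows "p_integral p (\<lambda>x. \<Sum>i\<in>A. tpoly (N i) (c i) x) \<le> (\<Sum>i\<in>A. p_integral p (tpoly (N i) (c i)))"
proof -
  have c1: "continuous_on {0..2 * pi} (\<lambda>x. norm (\<Sum>i\<in>A. tpoly (N i) (c i) x) powr p)"
    by (intro continuous_powr_norm p continuous_intros tpoly_continuous)
  have c2: "continuous_on {0..2 * pi} (\<lambda>x. norm (tpoly (N i) (c i) x) powr p)" for i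
    by (intro continuous_powr_norm p tpoly_continuous)
  have "p_integral p (\<lambda>x. \<Sum>i\<in>A. tpoly (N i) (c i) x) \<le> (LINT x|lebesgue_on {0..2 * pi}. (\<Sum>i\<in>A. norm (tpoly (N i) (c i) x) powr p))"
    unfolding p_integral_def
  proof (rule integral_mono)
    show "integrable (lebesgue_on {0..2 * pi}) (\<lambda>x. norm (\<Sum>i\<in>A. tpoly (N i) (c i) x) powr p)"
      by (rule lebesgue_circle_integral(1)[OF c1])
    show "integrable (lebesgue_on {0..2 * pi}) (\<lambda>x. \<Sum>i\<in>A. norm (tpoly (N i) (c i) x) powr p)"
      by (intro Bochner_Integration.integrable_sum lebesgue_circle_integral(1) c2)
    fix x
    have "norm (\<Sum>i\<in>A. tpoly (N i) (c i) x) powr p \<le> (\<Sum>i\<in>A. norm (tpoly (N i) (c i) x)) powr p"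
      using p by (intro powr_mono2 norm_sum) auto
    also have "\<dots> \<le> (\<Sum>i\<in>A. norm (tpoly (N i) (c i) x) powr p)" by (rule powr_sum_le) (use p in auto)
    finally show "norm (\<Sum>i\<in>A. tpoly (N i) (c i) x) powr p \<le> (\<Sum>i\<in>A. norm (tpoly (N i) (c i) x) powr p)" .
  qed
  also have "\<dots> = (\<Sum>i\<in>A. p_integral p (tpoly (N i) (c i)))"
    unfolding p_integral_def by (intro Bochner_Integration.integral_sum lebesgue_circle_integral(1) c2)
  finally show ?thesis .
qed

lemma p_integral_cmult: "p_integral p (\<lambda>x. a * f x) = norm a powr p * p_integral p f"
  unfolding p_integral_def by (simp add: norm_mult powr_mult)

lemma geometric_powr_sum:
  fixes e :: real
  assumes "e \<le> -1" "n \<ge> (1::nat)"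
  shows "(\<Sum>i<K. real (n * 2 ^ i) powr e) \<le> 2 * real n powr e"
proof -
  have "(\<Sum>i<K. real (n * 2 ^ i) powr e) \<le> (\<Sum>i<K. real n powr e * (1 / 2) ^ i)"
  proof (rule sum_mono)
    fix i
    have "real (2 ^ i) powr e \<le> real (2 ^ i) powr (-1)" using assms(1) by (intro powr_mono) auto
    also have "\<dots> = (1 / 2) ^ i" by (simp add: powr_minus power_one_over inverse_eq_divide)
    finally show "real (n * 2 ^ i) powr e \<le> real n powr e * (1 / 2) ^ i"
      by (simp add: powr_mult mult_left_mono)
  qed
  also have "\<dots> = real n powr e * (\<Sum>i<K. (1 / 2) ^ i)" by (simp add: sum_distrib_left)
  also have "\<dots> \<le> real n powr e * 2" by (intro mult_left_mono) (auto simp: sum_gp_strict)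
  finally show ?thesis by simp
qed

text \<open>
  The polynomial \<open>P\<close> is a smooth truncation of the antiderivative at frequency \<open>n\<close>. What is cut off
  splits into the bands at \<open>m = n, 2n, \<dots>, 2\<^sup>K n\<close>, and the piece on each band is the convolution of the
  given polynomial with a kernel whose \<open>p\<close>-integral is \<open>O(m\<^sup>(\<^sup>1\<^sup>-\<^sup>r\<^sup>)\<^sup>p\<^sup>-\<^sup>1)\<close>. The exponent is at most \<open>-1\<close>,
  so the sum over the bands is at most twice its first term. The zeroth coefficient of the
  antiderivative is arbitrary, because the truncation leaves it unchanged.
\<close>
theorem antiderivative_approximation:
  fixes p :: real and r :: nat
  assumes p: "0 < p" "p < 1" and r: "1 \<le> r"
  obtains C where "C > 0"
    "\<And>n K c d. 1 \<le> n \<Longrightarrow> \<forall>k. k \<noteq> 0 \<longrightarrow> d k = c k / (\<i> * of_int k) ^ r \<Longrightarrow>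
      \<exists>P\<in>trig_polys n. p_integral p (\<lambda>x. tpoly (n * 2 ^ K) d x - P x)
        \<le> C * real n powr ((1 - real r) * p - 1) * real (n * 2 ^ K) powr (1 - p) * p_integral p (tpoly (n * 2 ^ K) c)"
proof -
  \<comment> \<open>smoothness sufficient for \<open>L p \<ge> 2\<close>, hence for an integrable \<open>p\<close>-th power of the kernels\<close>
  define L where "L = nat \<lceil>2 / p\<rceil>"
  have "2 / p \<le> real L" unfolding L_def by linarith
  then have L: "2 \<le> p * real L" using p by (simp add: field_simps)
  obtain \<kappa> \<Phi> where \<kappa>: "\<And>t. \<bar>t\<bar> \<le> 1 \<Longrightarrow> \<kappa> t = 1" "\<And>t. \<bar>t\<bar> \<ge> 2 \<Longrightarrow> \<kappa> t = 0"
    and \<Phi>: "Ck L \<Phi>" "\<And>t. \<bar>t\<bar> \<ge> 2 \<Longrightarrow> \<Phi> t = 0" "\<Phi> 0 = 0" "\<And>t. t \<noteq> 0 \<Longrightarrow> \<Phi> t = (\<kappa> t - \<kappa> (2 * t)) / t ^ r"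
    by (rule smooth_dyadic_multiplier[of L r]) blast
  define H where "H = (\<lambda>(m::nat) (k::int). complex_of_real (\<Phi> (of_int k / real m)))"
  obtain C0 where C0: "C0 > 0" "\<And>m. m \<ge> 1 \<Longrightarrow> p_integral p (tpoly (2 * m) (H m)) \<le> C0 * real m powr (p - 1)"
    by (rule kernel_p_integral[OF p(1) L \<Phi>(1)], erule \<Phi>(2), rule that, unfold p_integral_def tpoly_def H_def)
  show thesis
  proof (rule that[of "8 * C0"])
    fix n K :: nat and c d :: "int \<Rightarrow> complex"
    assume n: "1 \<le> n" and d: "\<forall>k. k \<noteq> 0 \<longrightarrow> d k = c k / (\<i> * of_int k) ^ r"
    define N where "N = n * 2 ^ K"
    define m where "m = (\<lambda>i. n * 2 ^ i :: nat)"
    define e where "e = (\<lambda>i k. (1 / (\<i> ^ r * of_nat (m i) ^ r)) * (c k * H (m i) k))"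
    define U where "U = p_integral p (tpoly N c)"
    have U0: "U \<ge> 0" unfolding U_def by (rule p_integral_nonneg)
    have N: "N \<ge> 1" "n \<le> N" using n by (auto simp: N_def)
    have m1: "m i \<ge> 1" for i using n by (simp add: m_def)
    have mN: "m i \<le> N" if "i < Suc K" for i using that by (simp add: m_def N_def)
    have piece: "p_integral p (tpoly N (e i)) \<le> 4 * C0 * real N powr (1 - p) * U * real (m i) powr ((1 - real r) * p - 1)" if i: "i < Suc K" for i
    proof -
      have "2 * pi * p_integral p (tpoly N (\<lambda>k. c k * H (m i) k)) \<le>
        real (4 * N) powr (1 - p) * U * p_integral p (tpoly (2 * m i) (H (m i)))"
        unfolding U_def
        \<comment> \<open>\<open>4 N\<close> nodes suffice, since the kernel has degree \<open>2 m \<le> 2 N\<close>\<close>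
      proof (rule convolution_p_integral)
        show "N + 2 * m i < 4 * N" using mN[OF i] N by simp
        show "\<forall>k. \<bar>k\<bar> > int (2 * m i) \<longrightarrow> H (m i) k = 0"
        proof (intro allI impI)
          fix k :: int assume "\<bar>k\<bar> > int (2 * m i)"
          then have "real_of_int \<bar>k\<bar> \<ge> 2 * real (m i)" by linarith
          then have "2 \<le> \<bar>real_of_int k / real (m i)\<bar>" using m1[of i] by (simp add: field_simps)
          then show "H (m i) k = 0" unfolding H_def using \<Phi>(2) by simp
        qed
      qed (use p in auto)
      also have "\<dots> \<le> real (4 * N) powr (1 - p) * U * (C0 * real (m i) powr (p - 1))"
        using C0(2)[OF m1] U0 by (intro mult_left_mono) auto
      also have "real (4 * N) powr (1 - p) \<le> 4 * real N powr (1 - p)"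
      proof -
        have "4 powr (1 - p) \<le> 4 powr 1" using p by (intro powr_mono) auto
        then show ?thesis by (simp add: powr_mult mult_right_mono)
      qed
      finally have 1: "2 * pi * p_integral p (tpoly N (\<lambda>k. c k * H (m i) k)) \<le> 4 * real N powr (1 - p) * U * (C0 * real (m i) powr (p - 1))"
        using U0 C0(1) by (simp add: mult_right_mono)
      have "1 * p_integral p (tpoly N (\<lambda>k. c k * H (m i) k)) \<le> 2 * pi * p_integral p (tpoly N (\<lambda>k. c k * H (m i) k))"
        using pi_ge_two by (intro mult_right_mono p_integral_nonneg) linarith
      with 1 have 2: "p_integral p (tpoly N (\<lambda>k. c k * H (m i) k)) \<le> 4 * real N powr (1 - p) * U * (C0 * real (m i) powr (p - 1))"
        by linarith
      have "p_integral p (tpoly N (e i)) = p_integral p (\<lambda>x. (1 / (\<i> ^ r * of_nat (m i) ^ r)) * tpoly N (\<lambda>k. c k * H (m i) k) x)"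
        unfolding e_def tpoly_cmult ..
      also have "\<dots> = (1 / real (m i) ^ r) powr p * p_integral p (tpoly N (\<lambda>k. c k * H (m i) k))"
        unfolding p_integral_cmult by (simp add: norm_divide norm_mult norm_power)
      also have "(1 / real (m i) ^ r) powr p = real (m i) powr (- real r * p)"
        using m1[of i] by (simp add: powr_divide powr_realpow[symmetric] powr_powr powr_minus_divide)
      also have "\<dots> * p_integral p (tpoly N (\<lambda>k. c k * H (m i) k)) \<le> real (m i) powr (- real r * p) * (4 * real N powr (1 - p) * U * (C0 * real (m i) powr (p - 1)))"
        using 2 by (intro mult_left_mono) auto
      also have "\<dots> = 4 * C0 * real N powr (1 - p) * U * (real (m i) powr (- real r * p) * real (m i) powr (p - 1))"
        by (simp only: mult_ac)
      also have "real (m i) powr (- real r * p) * real (m i) powr (p - 1) = real (m i) powr ((1 - real r) * p - 1)"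
        by (simp add: powr_add[symmetric] algebra_simps)
      finally show ?thesis .
    qed
    define P where "P = tpoly n (\<lambda>k. d k * of_real (\<kappa> (2 * of_int k / real n)))"
    have P: "P x = tpoly N (\<lambda>k. d k * of_real (\<kappa> (2 * of_int k / real n))) x" for x
      unfolding P_def
    proof (rule tpoly_extend[OF N(2), symmetric])
      fix k :: int assume "\<bar>k\<bar> > int n"
      then have "real_of_int \<bar>k\<bar> \<ge> real n" by linarith
      then have "2 \<le> \<bar>2 * real_of_int k / real n\<bar>" using n by (simp add: field_simps)
      then show "d k * of_real (\<kappa> (2 * of_int k / real n)) = 0" using \<kappa>(2) by simp
    qed
    \<comment> \<open>the dilated cutoffs telescope, and the last one is 1 on all frequencies up to \<open>N\<close>\<close>
    have coeff: "d k - d k * of_real (\<kappa> (2 * of_int k / real n)) = (\<Sum>i<Suc K. e i k)" if k: "\<bar>k\<bar> \<le> int N" for k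
    proof (cases "k = 0")
      case True
      then show ?thesis using \<kappa>(1)[of 0] \<Phi>(3) by (simp add: e_def H_def)
    next
      case False
      define g where "g = (\<lambda>i. \<kappa> (2 * of_int k / real (m i)))"
      have "e i k = d k * of_real (g (Suc i) - g i)" for i
      proof -
        have mi: "real (m i) \<noteq> 0" "of_nat (m i) \<noteq> (0::complex)" using m1[of i] by auto
        have "\<Phi> (of_int k / real (m i)) = (\<kappa> (of_int k / real (m i)) - \<kappa> (2 * (of_int k / real (m i)))) / (of_int k / real (m i)) ^ r"
          using False mi by (intro \<Phi>(4)) simp
        also have "of_int k / real (m i) = 2 * of_int k / real (m (Suc i))" by (simp add: m_def)
        finally have "\<Phi> (of_int k / real (m i)) = (g (Suc i) - g i) / (of_int k / real (m i)) ^ r"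
          by (simp add: g_def m_def)
        then have "H (m i) k = of_real (g (Suc i) - g i) / (of_int k / of_nat (m i)) ^ r"
          unfolding H_def by simp
        moreover have "(1 / (A * B)) * (x * (D / (Q / B))) = x / (A * Q) * D"
          if "A \<noteq> 0" "B \<noteq> 0" "Q \<noteq> 0" for A B Q x D :: complex
          using that by (simp add: field_simps)
        ultimately show ?thesis unfolding e_def d[rule_format, OF False] power_divide power_mult_distrib
          using mi False by simp
      qed
      then have "(\<Sum>i<Suc K. e i k) = d k * of_real (\<Sum>i<Suc K. g (Suc i) - g i)"
        by (simp only: sum_distrib_left of_real_sum)
      also have "(\<Sum>i<Suc K. g (Suc i) - g i) = g (Suc K) - g 0" by (rule sum_lessThan_telescope)
      also have "g (Suc K) = 1"
      proof -
        have "2 * real_of_int k / real (m (Suc K)) = real_of_int k / real N" by (simp add: m_def N_def)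
        moreover have "\<bar>real_of_int k / real N\<bar> \<le> 1"
        proof -
          have "real_of_int \<bar>k\<bar> \<le> real N" using k by linarith
          then show ?thesis using N by (simp add: field_simps)
        qed
        ultimately show ?thesis unfolding g_def using \<kappa>(1) by simp
      qed
      also have "g 0 = \<kappa> (2 * of_int k / real n)" by (simp add: g_def m_def)
      finally show ?thesis by (simp add: algebra_simps)
    qed
    have diff: "tpoly N d x - P x = (\<Sum>i<Suc K. tpoly N (e i) x)" for x
      unfolding P tpoly_diff tpoly_sum by (rule tpoly_cong) (use coeff in auto)
    have "p_integral p (\<lambda>x. tpoly N d x - P x) \<le> (\<Sum>i<Suc K. p_integral p (tpoly N (e i)))"
      unfolding diff by (rule p_integral_tpoly_sum) (use p in auto)
    also have "\<dots> \<le> (\<Sum>i<Suc K. 4 * C0 * real N powr (1 - p) * U * real (m i) powr ((1 - real r) * p - 1))"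
      by (rule sum_mono) (use piece in auto)
    also have "\<dots> = 4 * C0 * real N powr (1 - p) * U * (\<Sum>i<Suc K. real (m i) powr ((1 - real r) * p - 1))"
      by (simp only: sum_distrib_left)
    also have "\<dots> \<le> 4 * C0 * real N powr (1 - p) * U * (2 * real n powr ((1 - real r) * p - 1))"
    proof (rule mult_left_mono)
      have "(1 - real r) * p \<le> 0" using r p by (intro mult_nonpos_nonneg) auto
      then show "(\<Sum>i<Suc K. real (m i) powr ((1 - real r) * p - 1)) \<le> 2 * real n powr ((1 - real r) * p - 1)"
        unfolding m_def using n by (intro geometric_powr_sum) auto
    qed (use U0 C0 in auto)
    also have "\<dots> = 8 * C0 * real n powr ((1 - real r) * p - 1) * real N powr (1 - p) * U" by simp
    finally show "\<exists>P\<in>trig_polys n. p_integral p (\<lambda>x. tpoly (n * 2 ^ K) d x - P x)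
        \<le> 8 * C0 * real n powr ((1 - real r) * p - 1) * real (n * 2 ^ K) powr (1 - p) * p_integral p (tpoly (n * 2 ^ K) c)"
      unfolding N_def[symmetric] U_def[symmetric] by (intro bexI[of _ P]) (auto simp: P_def tpoly_in_trig_polys)
  qed (use C0 in simp)
qed

section \<open>Integrating an approximation repeatedly\<close>

text \<open>
  Only the integral relation is recorded: it holds alike for derivatives that exist everywhere and
  for the almost everywhere derivative of an absolutely continuous function.
\<close>
definition primitive_on_circle :: "(real \<Rightarrow> complex) \<Rightarrow> (real \<Rightarrow> complex) \<Rightarrow> bool" where
  "primitive_on_circle \<phi> \<psi> \<longleftrightarrow> \<phi> (2 * pi) = \<phi> 0 \<and> \<psi> absolutely_integrable_on {0..2 * pi} \<and>
     (\<forall>x\<in>{0..2 * pi}. (\<psi> has_integral \<phi> x - \<phi> 0) {0..x})"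

lemma abs_cont_continuous:
  fixes F :: "real \<Rightarrow> complex"
  assumes "abs_cont s t F"
  shows "continuous_on {s..t} F"
proof (cases "s \<le> t")
  case True
  define F' where "F' = (\<lambda>x. vector_derivative F (at x))"
  note D = abs_cont_derivative[OF assms, folded F'_def]
  have eq: "F x = F s + integral {s..x} F'" if "x \<in> {s..t}" for x
    using integral_unique[OF D(1)[of s x]] that by simp
  have "F' integrable_on {s..t}" using D(1)[OF order_refl True order_refl] by (rule has_integral_integrable)
  then have "continuous_on {s..t} (\<lambda>x. F s + integral {s..x} F')"
    by (intro continuous_intros indefinite_integral_continuous_1)
  then show ?thesis by (rule continuous_on_eq) (rule eq[symmetric])
qed simp

lemma primitive_continuous:
  assumes "primitive_on_circle \<phi> \<psi>"
  shows "continuous_on {0..2 * pi} \<phi>"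
proof -
  have h: "(\<psi> has_integral \<phi> x - \<phi> 0) {0..x}" if "x \<in> {0..2 * pi}" for x
    using assms that by (simp add: primitive_on_circle_def)
  have eq: "\<phi> x = \<phi> 0 + integral {0..x} \<psi>" if "x \<in> {0..2 * pi}" for x
    using integral_unique[OF h[OF that]] by simp
  have "\<psi> integrable_on {0..2 * pi}" by (rule has_integral_integrable[OF h]) simp
  then have "continuous_on {0..2 * pi} (\<lambda>x. \<phi> 0 + integral {0..x} \<psi>)"
    by (intro continuous_intros indefinite_integral_continuous_1)
  then show ?thesis by (rule continuous_on_eq) (rule eq[symmetric])
qed

lemma nth_derivative_Suc: "nth_derivative (Suc k) f = (\<lambda>x. vector_derivative (nth_derivative k f) (at x))"
  by (simp add: nth_derivative_def)

text \<open>
  A primitive on the circle must have equal values at \<open>0\<close> and \<open>2\<pi>\<close>, so periodicity has to be carried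
  through all derivatives.
\<close>
lemma nth_derivative_periodic:
  assumes "derivative_in_AC r f" "j \<le> r - 1"
  shows "nth_derivative j f (x + 2 * pi) = nth_derivative j f x"
  using assms(2)
proof (induction j arbitrary: x)
  case 0
  then show ?case using assms(1) by (simp add: derivative_in_AC_def periodic2pi_def nth_derivative_def)
next
  case (Suc j)
  define \<phi> where "\<phi> = nth_derivative j f"
  have per: "\<phi> (y + 2 * pi) = \<phi> y" for y unfolding \<phi>_def using Suc by auto
  have "\<phi> differentiable (at (x + 2 * pi))"
    using assms(1) Suc.prems unfolding derivative_in_AC_def \<phi>_def by auto
  then have "(\<phi> has_vector_derivative nth_derivative (Suc j) f (x + 2 * pi)) (at (x + 2 * pi))"
    unfolding nth_derivative_Suc \<phi>_def[symmetric] vector_derivative_works .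
  moreover have "((\<lambda>y. y + 2 * pi) has_vector_derivative 1) (at x)"
    by (auto intro!: derivative_eq_intros)
  ultimately have "((\<phi> \<circ> (\<lambda>y. y + 2 * pi)) has_vector_derivative 1 *\<^sub>R nth_derivative (Suc j) f (x + 2 * pi)) (at x)"
    by (intro vector_diff_chain_at) auto
  then have "(\<phi> has_vector_derivative nth_derivative (Suc j) f (x + 2 * pi)) (at x)"
    using per by (simp add: o_def)
  then show ?case unfolding nth_derivative_Suc[of j f] \<phi>_def[symmetric]
    by (simp add: vector_derivative_at)
qed

lemma nth_derivative_primitive:
  assumes f: "derivative_in_AC r f" and r: "1 \<le> r" and j: "j < r"
  shows "primitive_on_circle (nth_derivative j f) (nth_derivative (Suc j) f)"
proof -
  define \<phi> where "\<phi> = nth_derivative j f"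
  define \<psi> where "\<psi> = nth_derivative (Suc j) f"
  have per: "\<phi> (2 * pi) = \<phi> 0"
    using nth_derivative_periodic[OF f, of j 0] j by (simp add: \<phi>_def)
  have \<psi>: "\<psi> = (\<lambda>x. vector_derivative \<phi> (at x))" unfolding \<psi>_def \<phi>_def nth_derivative_Suc ..
  have AC: "abs_cont 0 (2 * pi) (nth_derivative (r - 1) f)"
    using f by (simp add: derivative_in_AC_def AC_circle_def abs_cont_on_eq)
  have "primitive_on_circle \<phi> \<psi>"
  proof (cases "j = r - 1")
    case True
    note D = abs_cont_derivative[OF AC, folded True \<phi>_def, folded \<psi>]
    show ?thesis unfolding primitive_on_circle_def
    proof (intro conjI ballI)
      show "(\<psi> has_integral \<phi> x - \<phi> 0) {0..x}" if "x \<in> {0..2 * pi}" for x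
        using D(1)[of 0 x] that by simp
    qed (rule per D(2))+
  next
    case False
    have d: "(\<phi> has_vector_derivative \<psi> x) (at x)" for x
      unfolding \<psi> vector_derivative_works[symmetric]
      using f j False unfolding derivative_in_AC_def \<phi>_def by auto
    have cont: "continuous_on {0..2 * pi} \<psi>"
    proof (cases "Suc j = r - 1")
      case True
      then show ?thesis unfolding \<psi>_def using abs_cont_continuous[OF AC] by simp
    next
      case nlast: False
      then have "\<psi> differentiable (at x)" for x
        using f j False unfolding derivative_in_AC_def \<psi>_def by auto
      then show ?thesis by (intro continuous_at_imp_continuous_on ballI differentiable_imp_continuous_within)
    qed
    show ?thesis unfolding primitive_on_circle_def
    proof (intro conjI ballI)
      show "(\<psi> has_integral \<phi> x - \<phi> 0) {0..x}" if "x \<in> {0..2 * pi}" for x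
        by (rule fundamental_theorem_of_calculus) (use that d in \<open>auto intro: has_vector_derivative_at_within\<close>)
    qed (rule per absolutely_integrable_continuous_real[OF cont])+
  qed
  then show ?thesis by (simp add: \<phi>_def \<psi>_def)
qed

lemma tpoly_antiderivative:
  fixes c :: "int \<Rightarrow> complex"
  defines "e \<equiv> \<lambda>k. if k = 0 then 0 else c k / (\<i> * of_int k)"
  shows "(tpoly N e has_vector_derivative tpoly N c x - c 0) (at x)"
proof -
  have "((\<lambda>x. \<Sum>k=-int N..int N. e k * cis (of_int k * x)) has_vector_derivative
       (\<Sum>k=-int N..int N. e k * (of_int k *\<^sub>R (\<i> * cis (of_int k * x))))) (at x)"
  proof (intro has_vector_derivative_sum has_vector_derivative_mult_right)
    fix k :: int
    have "((\<lambda>x. cis (of_int k * x)) has_derivative (\<lambda>t. (of_int k * t) *\<^sub>R (\<i> * cis (of_int k * x)))) (at x)"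
      by (rule has_derivative_cis) (rule has_derivative_mult_right[OF has_derivative_ident])
    then show "((\<lambda>x. cis (of_int k * x)) has_vector_derivative of_int k *\<^sub>R (\<i> * cis (of_int k * x))) (at x)"
      unfolding has_vector_derivative_def by (simp add: mult.commute)
  qed
  moreover have "(\<Sum>k=-int N..int N. e k * (of_int k *\<^sub>R (\<i> * cis (of_int k * x)))) = tpoly N c x - c 0"
  proof -
    have "e k * (of_int k *\<^sub>R (\<i> * cis (of_int k * x))) = c k * cis (of_int k * x) - (if k = 0 then c 0 else 0)" for k
      by (simp add: e_def scaleR_conv_of_real field_simps)
    then show ?thesis by (simp add: tpoly_def sum_subtractf)
  qed
  ultimately show ?thesis unfolding tpoly_def[abs_def] by simp
qed

text \<open>
  Integrating \<open>T = \<Sum> c\<^sub>k e\<^sup>i\<^sup>k\<^sup>x\<close> term by term within the polynomials requires dropping \<open>c\<^sub>0\<close>. Since \<open>\<psi>\<close> has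
  mean value zero, \<open>2\<pi> \<bar>c\<^sub>0\<bar>\<close> is at most the \<open>L\<^sub>1\<close>-distance of \<open>\<psi>\<close> and \<open>T\<close>, hence the factor \<open>2\<close>. The
  constant of integration matches the values at \<open>0\<close>.
\<close>
lemma primitive_approximation:
  assumes prim: "primitive_on_circle \<phi> \<psi>" and \<epsilon>: "integral {0..2 * pi} (\<lambda>x. norm (\<psi> x - tpoly N c x)) \<le> \<epsilon>"
  obtains d where "\<And>k. k \<noteq> 0 \<Longrightarrow> d k = c k / (\<i> * of_int k)"
    "\<And>x. x \<in> {0..2 * pi} \<Longrightarrow> norm (\<phi> x - tpoly N d x) \<le> 2 * \<epsilon>"
proof -
  define e where "e = (\<lambda>k. if k = 0 then 0 else c k / (\<i> * of_int k))"
  define a where "a = \<phi> 0 - tpoly N e 0"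
  define d where "d = (\<lambda>k. e k + (if k = 0 then a else 0))"
  have d: "tpoly N d x = tpoly N e x + a" for x
  proof -
    have "d k * cis (of_int k * x) = e k * cis (of_int k * x) + (if k = 0 then a else 0)" for k
      by (simp add: d_def algebra_simps)
    then show ?thesis by (simp add: tpoly_def sum.distrib)
  qed
  define D where "D = (\<lambda>x. \<psi> x - tpoly N c x)"
  have "D absolutely_integrable_on {0..2 * pi}"
    unfolding D_def
  proof (rule set_integral_diff(1))
    show "\<psi> absolutely_integrable_on {0..2 * pi}" using prim by (simp add: primitive_on_circle_def)
    show "tpoly N c absolutely_integrable_on {0..2 * pi}"
      by (rule absolutely_integrable_continuous_real[OF tpoly_continuous])
  qed
  then have intD: "D integrable_on {0..2 * pi}" "(\<lambda>x. norm (D x)) integrable_on {0..2 * pi}"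
    by (auto simp: absolutely_integrable_on_def)
  have hasD: "(D has_integral (\<phi> x - \<phi> 0) - ((tpoly N e x - tpoly N e 0) + of_real x * c 0)) {0..x}" if x: "x \<in> {0..2 * pi}" for x
  proof -
    have "((\<lambda>x. tpoly N c x - c 0) has_integral tpoly N e x - tpoly N e 0) {0..x}"
      using x tpoly_antiderivative[of N c, folded e_def]
      by (intro fundamental_theorem_of_calculus) (auto intro: has_vector_derivative_at_within)
    moreover have "((\<lambda>x. c 0) has_integral of_real x * c 0) {0..x}"
      using has_integral_const_real[of "c 0" 0 x] x by (simp add: scaleR_conv_of_real)
    ultimately have "((\<lambda>x. (tpoly N c x - c 0) + c 0) has_integral (tpoly N e x - tpoly N e 0) + of_real x * c 0) {0..x}"
      by (rule has_integral_add)
    then have "(tpoly N c has_integral (tpoly N e x - tpoly N e 0) + of_real x * c 0) {0..x}" by simp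
    moreover have "(\<psi> has_integral \<phi> x - \<phi> 0) {0..x}" using prim x by (simp add: primitive_on_circle_def)
    ultimately show ?thesis unfolding D_def by (intro has_integral_diff)
  qed
  have bound: "norm ((\<phi> x - \<phi> 0) - ((tpoly N e x - tpoly N e 0) + of_real x * c 0)) \<le> \<epsilon>" if x: "x \<in> {0..2 * pi}" for x
  proof -
    have sub: "{0..x} \<subseteq> {0..2 * pi}" using x by auto
    have "(\<phi> x - \<phi> 0) - ((tpoly N e x - tpoly N e 0) + of_real x * c 0) = integral {0..x} D"
      using hasD[OF x] by (simp add: integral_unique)
    also have "norm \<dots> \<le> integral {0..x} (\<lambda>x. norm (D x))"
      by (rule Henstock_Kurzweil_Integration.integral_norm_bound_integral)
         (use integrable_on_subinterval[OF _ sub] intD in auto)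
    also have "\<dots> \<le> integral {0..2 * pi} (\<lambda>x. norm (D x))"
      by (rule integral_subset_le[OF sub]) (use integrable_on_subinterval[OF _ sub] intD in auto)
    finally show ?thesis using \<epsilon> by (simp add: D_def)
  qed
  have "tpoly N e (2 * pi) = tpoly N e 0" using tpoly_periodic[of N e 0] by simp
  then have c0: "2 * pi * norm (c 0) \<le> \<epsilon>"
    using bound[of "2 * pi"] prim by (simp add: primitive_on_circle_def norm_mult)
  show thesis
  proof (rule that[of d])
    show "d k = c k / (\<i> * of_int k)" if "k \<noteq> 0" for k using that by (simp add: d_def e_def)
    fix x :: real assume x: "x \<in> {0..2 * pi}"
    have "\<phi> x - tpoly N d x = ((\<phi> x - \<phi> 0) - ((tpoly N e x - tpoly N e 0) + of_real x * c 0)) + of_real x * c 0"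
      by (simp add: d a_def)
    then have "norm (\<phi> x - tpoly N d x) \<le> norm ((\<phi> x - \<phi> 0) - ((tpoly N e x - tpoly N e 0) + of_real x * c 0)) + norm (of_real x * c 0)"
      by (metis norm_triangle_ineq)
    moreover have "norm (of_real x * c 0) \<le> 2 * pi * norm (c 0)"
      using x by (simp add: norm_mult mult_right_mono)
    ultimately show "norm (\<phi> x - tpoly N d x) \<le> 2 * \<epsilon>" using bound[OF x] c0 by linarith
  qed
qed

text \<open>
  Each integration turns a uniform error into an \<open>L\<^sub>1\<close>-error, which costs the length \<open>2\<pi>\<close> of the
  circle, and that into a uniform error again, which costs a factor \<open>2\<close>.
\<close>
lemma iterated_primitive_approximation:
  assumes f: "derivative_in_AC r f" and r: "1 \<le> r"
    and \<epsilon>: "integral {0..2 * pi} (\<lambda>x. norm (nth_derivative r f x - tpoly N c x)) \<le> \<epsilon>"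
    and j: "j < r"
  shows "\<exists>d. (\<forall>k. k \<noteq> 0 \<longrightarrow> d k = c k / (\<i> * of_int k) ^ Suc j) \<and>
     (\<forall>x\<in>{0..2 * pi}. norm (nth_derivative (r - 1 - j) f x - tpoly N d x) \<le> 2 * (4 * pi) ^ j * \<epsilon>)"
  using j
proof (induction j)
  case 0
  have "primitive_on_circle (nth_derivative (r - 1) f) (nth_derivative r f)"
    using nth_derivative_primitive[OF f r, of "r - 1"] r by simp
  then obtain d where "\<And>k. k \<noteq> 0 \<Longrightarrow> d k = c k / (\<i> * of_int k)"
    "\<And>x. x \<in> {0..2 * pi} \<Longrightarrow> norm (nth_derivative (r - 1) f x - tpoly N d x) \<le> 2 * \<epsilon>"
    by (rule primitive_approximation[OF _ \<epsilon>]) (rule that)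
  then show ?case by (intro exI[of _ d]) auto
next
  case (Suc j)
  obtain d where "\<forall>k. k \<noteq> 0 \<longrightarrow> d k = c k / (\<i> * of_int k) ^ Suc j"
    "\<forall>x\<in>{0..2 * pi}. norm (nth_derivative (r - 1 - j) f x - tpoly N d x) \<le> 2 * (4 * pi) ^ j * \<epsilon>"
    using Suc.IH[OF Suc_lessD[OF Suc.prems]] by (elim exE conjE) (rule that)
  note d = this[rule_format]
  define \<psi> where "\<psi> = nth_derivative (r - 1 - j) f"
  have "Suc (r - 1 - Suc j) = r - 1 - j" using Suc.prems by simp
  then have prim: "primitive_on_circle (nth_derivative (r - 1 - Suc j) f) \<psi>"
    unfolding \<psi>_def using nth_derivative_primitive[OF f r, of "r - 1 - Suc j"] Suc.prems by simp
  have "(\<lambda>x. \<psi> x - tpoly N d x) absolutely_integrable_on {0..2 * pi}"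
  proof (rule set_integral_diff(1))
    show "\<psi> absolutely_integrable_on {0..2 * pi}" using prim by (simp add: primitive_on_circle_def)
    show "tpoly N d absolutely_integrable_on {0..2 * pi}"
      by (rule absolutely_integrable_continuous_real[OF tpoly_continuous])
  qed
  then have int: "(\<lambda>x. norm (\<psi> x - tpoly N d x)) integrable_on {0..2 * pi}"
    unfolding absolutely_integrable_on_def by (rule conjunct2)
  define B where "B = 2 * (4 * pi) ^ j * \<epsilon>"
  have "integral {0..2 * pi} (\<lambda>x. norm (\<psi> x - tpoly N d x)) \<le> integral {0..2 * pi} (\<lambda>x. B)"
  proof (rule integral_le[OF int integrable_const_ivl])
    fix x :: real assume "x \<in> {0..2 * pi}"
    from d(2)[OF this] show "norm (\<psi> x - tpoly N d x) \<le> B" unfolding \<psi>_def B_def .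
  qed
  also have "\<dots> = 2 * pi * B" by simp
  also have "\<dots> = (4 * pi) ^ Suc j * \<epsilon>" by (simp add: B_def)
  finally have small: "integral {0..2 * pi} (\<lambda>x. norm (\<psi> x - tpoly N d x)) \<le> (4 * pi) ^ Suc j * \<epsilon>" .
  obtain d' where d': "\<And>k. k \<noteq> 0 \<Longrightarrow> d' k = d k / (\<i> * of_int k)"
    "\<And>x. x \<in> {0..2 * pi} \<Longrightarrow> norm (nth_derivative (r - 1 - Suc j) f x - tpoly N d' x) \<le> 2 * ((4 * pi) ^ Suc j * \<epsilon>)"
    by (rule primitive_approximation[OF prim small]) (rule that)
  show ?case
  proof (intro exI[of _ d'] conjI allI impI ballI)
    fix k :: int assume k: "k \<noteq> 0"
    show "d' k = c k / (\<i> * of_int k) ^ Suc (Suc j)"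
      unfolding d'(1)[OF k] d(1)[OF k] divide_divide_eq_left power_Suc2[symmetric] ..
  next
    fix x :: real assume "x \<in> {0..2 * pi}"
    from d'(2)[OF this] show "norm (nth_derivative (r - 1 - Suc j) f x - tpoly N d' x) \<le> 2 * (4 * pi) ^ Suc j * \<epsilon>"
      by (simp only: mult.assoc)
  qed
qed

section \<open>Near-best approximations converge in the mean\<close>

text \<open>
  In \<open>\<bar>U\<bar> = \<bar>U\<bar>\<^sup>1\<^sup>-\<^sup>p \<bar>U\<bar>\<^sup>p\<close> the first factor is bounded pointwise and the second is integrated.
\<close>
lemma nikolskii_L1:
  assumes p: "0 < p" "p \<le> 1" and N: "N \<ge> 1"
  shows "(LINT x|lebesgue_on {0..2 * pi}. norm (tpoly N c x)) \<le> (real N powr (1 - p) * p_integral p (tpoly N c)) powr (1 / p)"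
proof -
  define I where "I = p_integral p (tpoly N c)"
  have I0: "I \<ge> 0" unfolding I_def by (rule p_integral_nonneg)
  have sup: "norm (tpoly N c x) \<le> (real N * I) powr (1 / p)" for x
  proof -
    have "2 * pi * norm (tpoly N c x) powr p \<le> real (2 * N + 1) * I"
      unfolding I_def by (rule nikolskii_pointwise[OF p])
    also have "\<dots> \<le> (2 * pi) * (real N * I)"
    proof -
      have "real (2 * N + 1) \<le> 3 * real N" using N by simp
      also have "\<dots> \<le> 2 * pi * real N" using pi_gt3 by (intro mult_right_mono) auto
      finally show ?thesis using I0 by (simp add: mult_right_mono mult.assoc[symmetric])
    qed
    finally have "norm (tpoly N c x) powr p \<le> real N * I" by simp
    then have "(norm (tpoly N c x) powr p) powr (1 / p) \<le> (real N * I) powr (1 / p)"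
      using p by (intro powr_mono2) auto
    then show ?thesis using p by (simp add: powr_powr)
  qed
  have split: "norm (tpoly N c x) \<le> (real N * I) powr ((1 - p) / p) * norm (tpoly N c x) powr p" for x
  proof (cases "tpoly N c x = 0")
    case False
    have "norm (tpoly N c x) = norm (tpoly N c x) powr (1 - p) * norm (tpoly N c x) powr p"
      using False by (simp add: powr_add[symmetric])
    also have "\<dots> \<le> ((real N * I) powr (1 / p)) powr (1 - p) * norm (tpoly N c x) powr p"
      using sup p by (intro mult_right_mono powr_mono2) auto
    finally show ?thesis by (simp add: powr_powr)
  qed simp
  have "(LINT x|lebesgue_on {0..2 * pi}. norm (tpoly N c x)) \<le>
      (LINT x|lebesgue_on {0..2 * pi}. (real N * I) powr ((1 - p) / p) * norm (tpoly N c x) powr p)"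
  proof (rule integral_mono)
    show "integrable (lebesgue_on {0..2 * pi}) (\<lambda>x. norm (tpoly N c x))"
      by (intro lebesgue_circle_integral(1) continuous_intros tpoly_continuous)
    show "integrable (lebesgue_on {0..2 * pi}) (\<lambda>x. (real N * I) powr ((1 - p) / p) * norm (tpoly N c x) powr p)"
      by (intro lebesgue_circle_integral(1) continuous_intros continuous_powr_norm p tpoly_continuous)
  qed (rule split)
  also have "\<dots> = (real N * I) powr ((1 - p) / p) * I" by (simp add: I_def p_integral_def)
  also have "\<dots> = (real N powr (1 - p) * I) powr (1 / p)"
  proof (cases "I = 0")
    case False
    then have "I > 0" using I0 by simp
    have "(real N * I) powr ((1 - p) / p) * I = real N powr ((1 - p) / p) * (I powr ((1 - p) / p) * I powr 1)"
      using \<open>I > 0\<close> by (simp add: powr_mult)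
    also have "I powr ((1 - p) / p) * I powr 1 = I powr (1 / p)"
      using p by (simp only: powr_add[symmetric]) (simp add: diff_divide_distrib)
    finally show ?thesis using \<open>I > 0\<close> by (simp add: powr_mult powr_powr)
  qed (use p in simp)
  finally show ?thesis by (simp add: I_def)
qed

text \<open>
  Summability of the \<open>p\<close>-integrals forces \<open>T\<^sub>k \<rightarrow> g\<close> almost everywhere. Then \<open>g - T\<^sub>K\<close> is almost
  everywhere the sum of the differences of consecutive \<open>T\<^sub>k\<close>, which is dominated in \<open>L\<^sub>1\<close> by \<open>\<Sum> b\<^sub>k\<close>.
\<close>
lemma L1_limit_from_p_convergence:
  fixes g :: "'a \<Rightarrow> complex" and T :: "nat \<Rightarrow> 'a \<Rightarrow> complex"
  assumes p: "0 < p" and [measurable]: "g \<in> borel_measurable M" "\<And>k. T k \<in> borel_measurable M"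
    and int: "\<And>k. integrable M (\<lambda>x. norm (g x - T k x) powr p)"
    and summ: "summable (\<lambda>k. LINT x|M. norm (g x - T k x) powr p)"
    and intT: "\<And>k. integrable M (\<lambda>x. norm (T (Suc k) x - T k x))"
    and b: "\<And>k. (LINT x|M. norm (T (Suc k) x - T k x)) \<le> b k" "summable b"
  shows "(\<integral>\<^sup>+x. ennreal (norm (g x - T K x)) \<partial>M) \<le> ennreal (\<Sum>k. b (k + K))"
proof -
  have "(\<integral>\<^sup>+x. (\<Sum>k. ennreal (norm (g x - T k x) powr p)) \<partial>M) = (\<Sum>k. \<integral>\<^sup>+x. ennreal (norm (g x - T k x) powr p) \<partial>M)"
    by (rule nn_integral_suminf) measurable
  also have "\<dots> = (\<Sum>k. ennreal (LINT x|M. norm (g x - T k x) powr p))"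
    using int by (simp add: nn_integral_eq_integral)
  also have "\<dots> \<noteq> \<infinity>"
    using summ by (subst suminf_ennreal2) (auto intro: Bochner_Integration.integral_nonneg)
  finally have "AE x in M. (\<Sum>k. ennreal (norm (g x - T k x) powr p)) \<noteq> \<infinity>"
    by (intro nn_integral_PInf_AE) measurable
  then have AE: "AE x in M. ennreal (norm (g x - T K x)) \<le> (\<Sum>k. ennreal (norm (T (Suc (k + K)) x - T (k + K) x)))"
  proof eventually_elim
    case (elim x)
    then have "summable (\<lambda>k. norm (g x - T k x) powr p)" by (intro summable_suminf_not_top) auto
    then have "(\<lambda>k. norm (g x - T k x) powr p) \<longlonglongrightarrow> 0" by (rule summable_LIMSEQ_zero)
    then have "(\<lambda>k. (norm (g x - T k x) powr p) powr (1 / p)) \<longlonglongrightarrow> 0"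
      by (rule tendsto_zero_powrI[where b = "1 / p"]) (use p in auto)
    then have "(\<lambda>k. norm (g x - T k x)) \<longlonglongrightarrow> 0" using p by (simp add: powr_powr)
    then have "(\<lambda>k. g x - T k x) \<longlonglongrightarrow> 0" by (simp only: tendsto_norm_zero_iff)
    from tendsto_diff[OF tendsto_const[of "g x"] this] have Tg: "(\<lambda>k. T k x) \<longlonglongrightarrow> g x" by simp
    have le: "ennreal (norm (T (L + K) x - T K x)) \<le> (\<Sum>k. ennreal (norm (T (Suc (k + K)) x - T (k + K) x)))" for L
    proof -
      have "T (L + K) x - T K x = (\<Sum>k<L. T (Suc (k + K)) x - T (k + K) x)"
        using sum_lessThan_telescope[of "\<lambda>k. T (k + K) x" L] by simp
      then have "norm (T (L + K) x - T K x) \<le> (\<Sum>k<L. norm (T (Suc (k + K)) x - T (k + K) x))"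
        by (simp add: norm_sum)
      then have "ennreal (norm (T (L + K) x - T K x)) \<le> (\<Sum>k<L. ennreal (norm (T (Suc (k + K)) x - T (k + K) x)))"
        by (subst sum_ennreal) (auto intro: ennreal_leI)
      also have "\<dots> \<le> (\<Sum>k. ennreal (norm (T (Suc (k + K)) x - T (k + K) x)))" by (rule sum_le_suminf) auto
      finally show ?thesis .
    qed
    have lim: "(\<lambda>L. ennreal (norm (T (L + K) x - T K x))) \<longlonglongrightarrow> ennreal (norm (g x - T K x))"
      using LIMSEQ_ignore_initial_segment[OF Tg, of K] by (intro tendsto_intros tendsto_ennrealI)
    show ?case by (rule LIMSEQ_le_const2[OF lim]) (use le in blast)
  qed
  have "(\<integral>\<^sup>+x. ennreal (norm (g x - T K x)) \<partial>M) \<le> (\<integral>\<^sup>+x. (\<Sum>k. ennreal (norm (T (Suc (k + K)) x - T (k + K) x))) \<partial>M)"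
    using AE by (rule nn_integral_mono_AE)
  also have "\<dots> = (\<Sum>k. \<integral>\<^sup>+x. ennreal (norm (T (Suc (k + K)) x - T (k + K) x)) \<partial>M)"
    by (rule nn_integral_suminf) measurable
  also have "\<dots> = (\<Sum>k. ennreal (LINT x|M. norm (T (Suc (k + K)) x - T (k + K) x)))"
    using intT by (simp add: nn_integral_eq_integral)
  also have "\<dots> \<le> (\<Sum>k. ennreal (b (k + K)))"
    by (intro suminf_le ennreal_leI b) auto
  also have "\<dots> = ennreal (\<Sum>k. b (k + K))"
  proof (rule suminf_ennreal2)
    show "0 \<le> b (k + K)" for k using b(1)[of "k + K"] by (meson Bochner_Integration.integral_nonneg norm_ge_zero order_trans)
    show "summable (\<lambda>k. b (k + K))" using b(2) by (rule summable_ignore_initial_segment)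
  qed
  finally show ?thesis .
qed

lemma Lp_norm_powr: "0 < p \<Longrightarrow> Lp_norm p f powr p = p_integral p f"
  unfolding Lp_norm_def p_integral_def[symmetric] by (simp add: powr_powr p_integral_nonneg)

lemma Lp_norm_nonneg: "Lp_norm p f \<ge> 0"
  by (simp add: Lp_norm_def)

lemma bdd_below_Lp: "bdd_below ((\<lambda>T. Lp_norm p (\<lambda>x. f x - T x)) ` A)"
  by (rule bdd_belowI2[of _ 0]) (rule Lp_norm_nonneg)

lemma trig_polys_nonempty: "trig_polys n \<noteq> {}"
  using tpoly_in_trig_polys by blast

lemma best_approx_nonneg: "best_approx p n f \<ge> 0"
  unfolding best_approx_def by (rule cINF_greatest[OF trig_polys_nonempty]) (rule Lp_norm_nonneg)

lemma best_approx_powr_le: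
  assumes "0 < p" "T \<in> trig_polys n"
  shows "best_approx p n f powr p \<le> p_integral p (\<lambda>x. f x - T x)"
proof -
  have "best_approx p n f \<le> Lp_norm p (\<lambda>x. f x - T x)"
    unfolding best_approx_def using assms by (intro cINF_lower bdd_below_Lp)
  then have "best_approx p n f powr p \<le> Lp_norm p (\<lambda>x. f x - T x) powr p"
    using assms(1) best_approx_nonneg by (intro powr_mono2) auto
  then show ?thesis using Lp_norm_powr[OF assms(1)] by simp
qed

text \<open>
  The slack \<open>\<delta>\<close> is additive and not a factor, since the best approximation may be \<open>0\<close>.
\<close>
lemma near_best_approximation:
  assumes p: "0 < p" "p \<le> 1" and \<delta>: "\<delta> > 0"
  obtains T where "T \<in> trig_polys n" "p_integral p (\<lambda>x. f x - T x) \<le> best_approx p n f powr p + \<delta>"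
proof -
  have "best_approx p n f < best_approx p n f + \<delta> powr (1 / p)" using \<delta> by simp
  then obtain T where T: "T \<in> trig_polys n" "Lp_norm p (\<lambda>x. f x - T x) < best_approx p n f + \<delta> powr (1 / p)"
    using cInf_lessD[of "(\<lambda>T. Lp_norm p (\<lambda>x. f x - T x)) ` trig_polys n"] trig_polys_nonempty
    unfolding best_approx_def by blast
  have "p_integral p (\<lambda>x. f x - T x) = Lp_norm p (\<lambda>x. f x - T x) powr p" by (rule Lp_norm_powr[OF p(1), symmetric])
  also have "\<dots> \<le> (best_approx p n f + \<delta> powr (1 / p)) powr p"
    using T(2) p(1) Lp_norm_nonneg by (intro powr_mono2) auto
  also have "\<dots> \<le> best_approx p n f powr p + (\<delta> powr (1 / p)) powr p"
    using p best_approx_nonneg by (intro powr_add_le) auto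
  also have "(\<delta> powr (1 / p)) powr p = \<delta>" using p \<delta> by (simp add: powr_powr)
  finally show thesis using that T(1) by blast
qed

lemma trig_polys_mono: "n \<le> m \<Longrightarrow> trig_polys n \<subseteq> trig_polys m"
proof
  fix T assume "n \<le> m" and T: "T \<in> trig_polys n"
  obtain c where "T = tpoly n c" "\<And>k. \<bar>k\<bar> > int n \<Longrightarrow> c k = 0" by (rule trig_polysE[OF T]) (rule that)
  then have "T = tpoly m c" using tpoly_extend[OF \<open>n \<le> m\<close>] by (intro ext) simp
  then show "T \<in> trig_polys m" using tpoly_in_trig_polys by simp
qed

lemma best_approx_mono: "n \<le> m \<Longrightarrow> best_approx p m f \<le> best_approx p n f"
  unfolding best_approx_def
  by (rule cINF_superset_mono[OF trig_polys_nonempty bdd_below_Lp trig_polys_mono]) auto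

lemma integrable_norm_powr:
  fixes h :: "real \<Rightarrow> complex"
  assumes p: "0 < p" "p \<le> 1" and h: "integrable (lebesgue_on {0..2 * pi}) h"
  shows "integrable (lebesgue_on {0..2 * pi}) (\<lambda>x. norm (h x) powr p)"
proof (rule Bochner_Integration.integrable_bound)
  have [measurable]: "h \<in> borel_measurable (lebesgue_on {0..2 * pi})" using h by simp
  show "(\<lambda>x. norm (h x) powr p) \<in> borel_measurable (lebesgue_on {0..2 * pi})" by measurable
  show "integrable (lebesgue_on {0..2 * pi}) (\<lambda>x. 1 + norm (h x))"
    by (intro Bochner_Integration.integrable_add integrable_norm h lebesgue_circle_integral(1) continuous_intros)
  have "norm (norm (h x) powr p) \<le> norm (1 + norm (h x))" for x
  proof (cases "norm (h x) \<le> 1")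
    case True
    then have "norm (h x) powr p \<le> 1 powr p" using p by (intro powr_mono2) auto
    then show ?thesis by (simp add: add_increasing2)
  next
    case False
    then have "norm (h x) powr p \<le> norm (h x) powr 1" using p by (intro powr_mono) auto
    then show ?thesis by simp
  qed
  then show "AE x in lebesgue_on {0..2 * pi}. norm (norm (h x) powr p) \<le> norm (1 + norm (h x))" by simp
qed

lemma p_integral_add:
  assumes p: "0 < p" "p \<le> 1" and "integrable (lebesgue_on {0..2 * pi}) h" "integrable (lebesgue_on {0..2 * pi}) k"
  shows "p_integral p (\<lambda>x. h x + k x) \<le> p_integral p h + p_integral p k"
proof -
  have "p_integral p (\<lambda>x. h x + k x) \<le> (LINT x|lebesgue_on {0..2 * pi}. norm (h x) powr p + norm (k x) powr p)"
    unfolding p_integral_def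
  proof (rule integral_mono)
    fix x
    have "norm (h x + k x) powr p \<le> (norm (h x) + norm (k x)) powr p"
      using p norm_triangle_ineq by (intro powr_mono2) auto
    also have "\<dots> \<le> norm (h x) powr p + norm (k x) powr p" using p by (intro powr_add_le) auto
    finally show "norm (h x + k x) powr p \<le> norm (h x) powr p + norm (k x) powr p" .
  next
    show "integrable (lebesgue_on {0..2 * pi}) (\<lambda>x. norm (h x + k x) powr p)"
      by (intro integrable_norm_powr p Bochner_Integration.integrable_add assms)
    show "integrable (lebesgue_on {0..2 * pi}) (\<lambda>x. norm (h x) powr p + norm (k x) powr p)"
      by (intro Bochner_Integration.integrable_add integrable_norm_powr assms)
  qed
  also have "\<dots> = p_integral p h + p_integral p k"
    unfolding p_integral_def using assms by (intro Bochner_Integration.integral_add integrable_norm_powr)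
  finally show ?thesis .
qed

text \<open>
  The block \<open>m < \<nu> \<le> 2m\<close> has \<open>m\<close> terms, each at least as large as the last, because both factors
  decrease in \<open>\<nu>\<close>.
\<close>
lemma dyadic_sum_le:
  fixes E :: "nat \<Rightarrow> real"
  assumes p: "0 < p" and n: "1 \<le> n" and nonneg: "\<And>\<nu>. E \<nu> \<ge> 0" and anti: "\<And>a b. a \<le> b \<Longrightarrow> E b \<le> E a"
    and summ: "(\<lambda>\<nu>. real \<nu> powr (- p) * E \<nu> powr p) summable_on {1..}"
  shows "(\<Sum>k<K. real (n * 2 ^ Suc k) powr (1 - p) * E (n * 2 ^ Suc k) powr p)
     \<le> 2 * (\<Sum>\<^sub>\<infinity>\<nu>\<in>{n + 1..}. real \<nu> powr (- p) * E \<nu> powr p)"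
proof -
  define w where "w = (\<lambda>\<nu>. real \<nu> powr (- p) * E \<nu> powr p)"
  have w0: "w \<nu> \<ge> 0" for \<nu> by (simp add: w_def)
  have "(\<Sum>k<K. real (n * 2 ^ Suc k) powr (1 - p) * E (n * 2 ^ Suc k) powr p) \<le> 2 * (\<Sum>\<nu>\<in>{n<..n * 2 ^ K}. w \<nu>)"
  proof (induction K)
    case (Suc K)
    define m where "m = n * 2 ^ K"
    have m: "m \<ge> 1" "n \<le> m" using n by (auto simp: m_def)
    have blk: "real (2 * m) powr (- p) * E (2 * m) powr p \<le> w \<nu>" if "\<nu> \<in> {m<..2 * m}" for \<nu>
      unfolding w_def using that m p nonneg anti[of \<nu> "2 * m"]
      by (intro mult_mono powr_mono2' powr_mono2) auto
    have "real (2 * m) powr (1 - p) * E (2 * m) powr p = 2 * (real m * (real (2 * m) powr (- p) * E (2 * m) powr p))"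
      using m by (simp add: powr_diff powr_minus divide_simps)
    also have "real m * (real (2 * m) powr (- p) * E (2 * m) powr p) = (\<Sum>\<nu>\<in>{m<..2 * m}. real (2 * m) powr (- p) * E (2 * m) powr p)"
      by simp
    also have "\<dots> \<le> (\<Sum>\<nu>\<in>{m<..2 * m}. w \<nu>)" by (rule sum_mono) (use blk in auto)
    finally have 1: "real (2 * m) powr (1 - p) * E (2 * m) powr p \<le> 2 * (\<Sum>\<nu>\<in>{m<..2 * m}. w \<nu>)" by simp
    have e: "n * 2 ^ Suc K = 2 * m" by (simp add: m_def)
    have "{n<..2 * m} = {n<..m} \<union> {m<..2 * m}" using m(2) by auto
    then have "{n<..n * 2 ^ Suc K} = {n<..m} \<union> {m<..2 * m}" by (simp only: e)
    then have "(\<Sum>\<nu>\<in>{n<..n * 2 ^ Suc K}. w \<nu>) = (\<Sum>\<nu>\<in>{n<..m}. w \<nu>) + (\<Sum>\<nu>\<in>{m<..2 * m}. w \<nu>)"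
      by (simp only:) (rule sum.union_disjoint; simp add: ivl_disj_int_two)
    then have "2 * (\<Sum>\<nu>\<in>{n<..n * 2 ^ Suc K}. w \<nu>) = 2 * (\<Sum>\<nu>\<in>{n<..m}. w \<nu>) + 2 * (\<Sum>\<nu>\<in>{m<..2 * m}. w \<nu>)"
      by (simp only: distrib_left)
    moreover have "real (n * 2 ^ Suc K) powr (1 - p) * E (n * 2 ^ Suc K) powr p \<le> 2 * (\<Sum>\<nu>\<in>{m<..2 * m}. w \<nu>)"
      using 1 by (simp only: e)
    moreover note Suc.IH[folded m_def]
    ultimately show ?case unfolding sum.lessThan_Suc by linarith
  qed simp
  also have "(\<Sum>\<nu>\<in>{n<..n * 2 ^ K}. w \<nu>) \<le> (\<Sum>\<^sub>\<infinity>\<nu>\<in>{n + 1..}. w \<nu>)"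
  proof (rule finite_sum_le_infsum)
    show "w summable_on {n + 1..}" unfolding w_def by (rule summable_on_subset_banach[OF summ]) auto
  qed (use w0 in auto)
  finally show ?thesis unfolding w_def by simp
qed

section \<open>The inequality between best approximations\<close>

text \<open>
  With \<open>X = n\<^sup>1\<^sup>-\<^sup>p E\<^sub>n(g)\<^sup>p\<close> and \<open>S\<close> the tail of the series, the weighted errors \<open>w k\<close> at the degrees
  \<open>n 2\<^sup>k\<close> sum to at most \<open>X + 2 S\<close>, and the weighted \<open>p\<close>-integrals \<open>q k\<close> of the differences \<open>U k\<close> to at
  most four times this plus a term of order \<open>\<epsilon>\<close>. Antiderivative by antiderivative, the central
  estimate converts \<open>q k\<close> into an error for \<open>f\<close>. What remains is the distance \<open>B K\<close> of \<open>f\<close> from the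
  antiderivative of \<open>T K\<close>, which tends to \<open>0\<close>.
\<close>
lemma approximation_pth_power:
  fixes p :: real and r :: nat
  assumes p: "0 < p" "p < 1" and r: "1 \<le> r"
  obtains C where "C > 0"
    "\<And>f n. derivative_in_AC r f \<Longrightarrow>
       (\<lambda>\<nu>. real \<nu> powr (- p) * best_approx p \<nu> (nth_derivative r f) powr p) summable_on {1..} \<Longrightarrow> 1 \<le> n \<Longrightarrow>
       best_approx p n f powr p \<le> C * real n powr ((1 - real r) * p - 1) *
         (real n powr (1 - p) * best_approx p n (nth_derivative r f) powr p +
          (\<Sum>\<^sub>\<infinity>\<nu>\<in>{n + 1..}. real \<nu> powr (- p) * best_approx p \<nu> (nth_derivative r f) powr p))"
proof -
  have p': "p \<le> 1" using p by simp
  obtain C1 where C1: "C1 > 0"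
    "\<And>n K c d. 1 \<le> n \<Longrightarrow> \<forall>k. k \<noteq> 0 \<longrightarrow> d k = c k / (\<i> * of_int k) ^ r \<Longrightarrow>
      \<exists>P\<in>trig_polys n. p_integral p (\<lambda>x. tpoly (n * 2 ^ K) d x - P x)
        \<le> C1 * real n powr ((1 - real r) * p - 1) * real (n * 2 ^ K) powr (1 - p) * p_integral p (tpoly (n * 2 ^ K) c)"
    by (rule antiderivative_approximation[OF p r]) (rule that)
  show thesis
  proof (rule that[of "8 * C1"])
    fix f :: "real \<Rightarrow> complex" and n :: nat
    define g where "g = nth_derivative r f"
    define E where "E = (\<lambda>\<nu>. best_approx p \<nu> g)"
    assume f: "derivative_in_AC r f"
      and "(\<lambda>\<nu>. real \<nu> powr (- p) * best_approx p \<nu> (nth_derivative r f) powr p) summable_on {1..}"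
      and n: "1 \<le> n"
    then have summ: "(\<lambda>\<nu>. real \<nu> powr (- p) * E \<nu> powr p) summable_on {1..}"
      unfolding E_def g_def by blast
    define X where "X = real n powr (1 - p) * E n powr p"
    define S where "S = (\<Sum>\<^sub>\<infinity>\<nu>\<in>{n + 1..}. real \<nu> powr (- p) * E \<nu> powr p)"
    define Y where "Y = C1 * real n powr ((1 - real r) * p - 1)"
    define L where "L = lebesgue_on {0..2 * pi}"
    have Y0: "Y > 0" using C1(1) n by (simp add: Y_def)
    have E0: "E \<nu> \<ge> 0" for \<nu> unfolding E_def by (rule best_approx_nonneg)
    have Eanti: "E b \<le> E a" if "a \<le> b" for a b unfolding E_def using that by (rule best_approx_mono)
    have X0: "X \<ge> 0" by (simp add: X_def)
    have S0: "S \<ge> 0" unfolding S_def by (rule infsum_nonneg) simp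
    have prim: "primitive_on_circle (nth_derivative (r - 1) f) g"
      using nth_derivative_primitive[OF f r, of "r - 1"] r by (simp add: g_def)
    then have gint: "integrable L g"
      unfolding L_def primitive_on_circle_def by (intro absolutely_integrable_imp_integrable) auto
    have fint: "integrable L f"
    proof -
      have "primitive_on_circle f (nth_derivative (Suc 0) f)"
        using nth_derivative_primitive[OF f r, of 0] r by (simp add: nth_derivative_def)
      then show ?thesis unfolding L_def by (intro lebesgue_circle_integral(1) primitive_continuous)
    qed
    have Tint: "integrable L (tpoly N c)" for N c
      unfolding L_def by (rule lebesgue_circle_integral(1)[OF tpoly_continuous])
    have main: "best_approx p n f powr p \<le> Y * (4 * X + 8 * S + 8 * (real n * \<epsilon>))" if \<epsilon>: "\<epsilon> > 0" for \<epsilon>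
    proof -
      \<comment> \<open>the slack \<open>\<epsilon> / 4\<^sup>k\<close> stays summable after multiplication by the degrees \<open>n 2\<^sup>k\<close>\<close>
      have "\<exists>c. (\<forall>j. \<bar>j\<bar> > int (n * 2 ^ k) \<longrightarrow> c j = 0) \<and>
          p_integral p (\<lambda>x. g x - tpoly (n * 2 ^ k) c x) \<le> E (n * 2 ^ k) powr p + \<epsilon> / 4 ^ k" for k
      proof -
        have pos: "\<epsilon> / 4 ^ k > 0" using \<epsilon> by simp
        obtain T where T: "T \<in> trig_polys (n * 2 ^ k)" "p_integral p (\<lambda>x. g x - T x) \<le> best_approx p (n * 2 ^ k) g powr p + \<epsilon> / 4 ^ k"
          by (rule near_best_approximation[OF p(1) p' pos]) (rule that)
        obtain c where c: "T = tpoly (n * 2 ^ k) c" "\<And>j. \<bar>j\<bar> > int (n * 2 ^ k) \<Longrightarrow> c j = 0"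
          by (rule trig_polysE[OF T(1)]) (rule that)
        show ?thesis
          by (intro exI[of _ c] conjI allI impI) (use c(2) T(2) in \<open>simp_all only: c(1) E_def\<close>)
      qed
      then obtain c where c0: "\<And>k j. \<bar>j\<bar> > int (n * 2 ^ k) \<Longrightarrow> c k j = 0"
        and cI: "\<And>k. p_integral p (\<lambda>x. g x - tpoly (n * 2 ^ k) (c k) x) \<le> E (n * 2 ^ k) powr p + \<epsilon> / 4 ^ k"
        by metis
      define T where "T = (\<lambda>k. tpoly (n * 2 ^ k) (c k))"
      define u where "u = (\<lambda>k j. c (Suc k) j - c k j)"
      define U where "U = (\<lambda>k. tpoly (n * 2 ^ Suc k) (u k))"
      define a where "a = (\<lambda>k. p_integral p (\<lambda>x. g x - T k x))"
      define q where "q = (\<lambda>k. real (n * 2 ^ Suc k) powr (1 - p) * p_integral p (U k))"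
      define w where "w = (\<lambda>k. real (n * 2 ^ k) powr (1 - p) * E (n * 2 ^ k) powr p)"
      define b where "b = (\<lambda>k. q k powr (1 / p))"
      have u0: "u k j = 0" if "\<bar>j\<bar> > int (n * 2 ^ Suc k)" for k j
      proof -
        have "\<bar>j\<bar> > int (n * 2 ^ k)" using that by simp
        then show ?thesis using c0 that unfolding u_def by simp
      qed
      have UT: "U k x = T (Suc k) x - T k x" for k x
      proof -
        have "T k x = tpoly (n * 2 ^ Suc k) (c k) x"
          unfolding T_def by (rule tpoly_extend[symmetric]) (use c0 in auto)
        then show ?thesis unfolding U_def u_def by (simp only: T_def tpoly_diff)
      qed
      have gT: "integrable L (\<lambda>x. g x - T k x)" for k
        unfolding T_def by (intro Bochner_Integration.integrable_diff gint Tint)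
      have IU: "p_integral p (U k) \<le> a k + a (Suc k)" for k
      proof -
        have "U k = (\<lambda>x. (g x - T k x) + - (g x - T (Suc k) x))" by (intro ext) (simp add: UT)
        then have "p_integral p (U k) \<le> p_integral p (\<lambda>x. g x - T k x) + p_integral p (\<lambda>x. - (g x - T (Suc k) x))"
          using p_integral_add[OF p(1) p' gT[unfolded L_def] Bochner_Integration.integrable_minus[OF gT[unfolded L_def]]] by simp
        also have "p_integral p (\<lambda>x. - (g x - T (Suc k) x)) = a (Suc k)"
          unfolding a_def p_integral_def norm_minus_cancel ..
        finally show ?thesis by (simp add: a_def)
      qed
      have ak: "a k \<le> E (n * 2 ^ k) powr p + \<epsilon> / 4 ^ k" for k unfolding a_def T_def by (rule cI)
      have a0: "a k \<ge> 0" for k unfolding a_def by (rule p_integral_nonneg)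
      have w0: "w k \<ge> 0" for k by (simp add: w_def)
      have q0: "q k \<ge> 0" for k by (simp add: q_def p_integral_nonneg)
      have n2: "real (n * 2 ^ k) \<ge> 1" for k
      proof -
        have "1 \<le> n * 2 ^ k" using n by simp
        then show ?thesis by linarith
      qed
      have wsum: "(\<Sum>k<K. w k) \<le> X + 2 * S" for K
      proof (cases K)
        case 0
        then show ?thesis using X0 S0 by simp
      next
        case (Suc K')
        have "(\<Sum>k<K. w k) = w 0 + (\<Sum>k<K'. w (Suc k))" unfolding Suc by (rule sum.lessThan_Suc_shift)
        also have "w 0 = X" by (simp add: w_def X_def)
        also have "(\<Sum>k<K'. w (Suc k)) \<le> 2 * S"
          unfolding w_def S_def by (rule dyadic_sum_le[OF p(1) n E0 Eanti summ])
        finally show ?thesis by simp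
      qed
      have geo: "(\<Sum>k<K. (1 / 2 :: real) ^ k) \<le> 2" for K by (simp add: sum_gp_strict)
      have qb: "q k \<le> 4 * w k + 4 * (real n * \<epsilon>) * (1 / 2) ^ k" for k
      proof -
        define N where "N = real (n * 2 ^ k)"
        have N: "N \<ge> 1" unfolding N_def by (rule n2)
        have N2: "real (n * 2 ^ Suc k) = 2 * N" by (simp add: N_def)
        have pw: "(2 * N) powr (1 - p) \<le> 2 * N powr (1 - p)"
        proof -
          have "(2::real) powr (1 - p) \<le> 2 powr 1" using p by (intro powr_mono) auto
          then show ?thesis using N by (simp add: powr_mult mult_right_mono)
        qed
        have pw2: "(2 * N) powr (1 - p) \<le> 2 * N"
        proof -
          have "(2 * N) powr (1 - p) \<le> (2 * N) powr 1" using p N by (intro powr_mono) auto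
          then show ?thesis using N by simp
        qed
        have "E (n * 2 ^ Suc k) powr p \<le> E (n * 2 ^ k) powr p"
          using p E0 Eanti by (intro powr_mono2) auto
        moreover have "\<epsilon> / 4 ^ Suc k \<le> \<epsilon> / 4 ^ k" using \<epsilon> by (simp add: field_simps)
        ultimately have "p_integral p (U k) \<le> 2 * E (n * 2 ^ k) powr p + 2 * (\<epsilon> / 4 ^ k)"
          using IU[of k] ak[of k] ak[of "Suc k"] by linarith
        then have "q k \<le> (2 * N) powr (1 - p) * (2 * E (n * 2 ^ k) powr p + 2 * (\<epsilon> / 4 ^ k))"
          unfolding q_def N2 by (rule mult_left_mono) simp
        also have "\<dots> = (2 * N) powr (1 - p) * (2 * E (n * 2 ^ k) powr p) + (2 * N) powr (1 - p) * (2 * (\<epsilon> / 4 ^ k))"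
          by (rule distrib_left)
        also have "\<dots> \<le> 2 * N powr (1 - p) * (2 * E (n * 2 ^ k) powr p) + 2 * N * (2 * (\<epsilon> / 4 ^ k))"
          using pw pw2 \<epsilon> by (intro add_mono mult_right_mono) auto
        also have "2 * N powr (1 - p) * (2 * E (n * 2 ^ k) powr p) = 4 * w k" by (simp add: w_def N_def)
        also have "2 * N * (2 * (\<epsilon> / 4 ^ k)) = 4 * (real n * \<epsilon>) * (1 / 2) ^ k"
        proof -
          have "(4::real) ^ k = 2 ^ k * 2 ^ k" by (simp add: power_mult_distrib[symmetric])
          then show ?thesis by (simp add: N_def power_one_over field_simps)
        qed
        finally show ?thesis .
      qed
      have qsum: "(\<Sum>k<K. q k) \<le> 4 * X + 8 * S + 8 * (real n * \<epsilon>)" for K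
      proof -
        have "(\<Sum>k<K. q k) \<le> (\<Sum>k<K. 4 * w k + 4 * (real n * \<epsilon>) * (1 / 2) ^ k)" by (rule sum_mono) (rule qb)
        also have "\<dots> = 4 * (\<Sum>k<K. w k) + 4 * (real n * \<epsilon>) * (\<Sum>k<K. (1 / 2) ^ k)"
          by (simp only: sum.distrib sum_distrib_left)
        also have "\<dots> \<le> 4 * (X + 2 * S) + 4 * (real n * \<epsilon>) * 2"
          using wsum geo \<epsilon> by (intro add_mono mult_left_mono) auto
        finally show ?thesis by simp
      qed
      have summq: "summable q" by (rule summableI_nonneg_bounded[OF q0 qsum])
      have summa: "summable a"
      proof (rule summableI_nonneg_bounded[OF a0])
        fix K
        have "a k \<le> w k + \<epsilon> * (1 / 2) ^ k" for k
        proof -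
          have "1 powr (1 - p) \<le> real (n * 2 ^ k) powr (1 - p)" using p n2 by (intro powr_mono2) auto
          then have "1 * E (n * 2 ^ k) powr p \<le> w k" unfolding w_def by (intro mult_right_mono) auto
          moreover have "\<epsilon> / 4 ^ k \<le> \<epsilon> * (1 / 2) ^ k"
          proof -
            have "(1 / 4 :: real) ^ k \<le> (1 / 2) ^ k" by (rule power_mono) auto
            then have "\<epsilon> * (1 / 4) ^ k \<le> \<epsilon> * (1 / 2) ^ k" using \<epsilon> by (intro mult_left_mono) auto
            moreover have "\<epsilon> / 4 ^ k = \<epsilon> * (1 / 4) ^ k"
              by (simp only: power_one_over times_divide_eq_right mult_1_right)
            ultimately show ?thesis by (simp only:)
          qed
          ultimately show ?thesis using ak[of k] by linarith
        qed
        then have "(\<Sum>k<K. a k) \<le> (\<Sum>k<K. w k + \<epsilon> * (1 / 2) ^ k)" by (rule sum_mono)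
        also have "\<dots> = (\<Sum>k<K. w k) + \<epsilon> * (\<Sum>k<K. (1 / 2) ^ k)" by (simp only: sum.distrib sum_distrib_left)
        also have "\<dots> \<le> (X + 2 * S) + \<epsilon> * 2" using wsum geo \<epsilon> by (intro add_mono mult_left_mono) auto
        finally show "(\<Sum>k<K. a k) \<le> (X + 2 * S) + \<epsilon> * 2" .
      qed
      have summb: "summable b"
      proof (rule summable_comparison_test_ev[OF _ summq])
        have "\<forall>\<^sub>F k in sequentially. q k < 1"
          by (rule order_tendstoD(2)[OF summable_LIMSEQ_zero[OF summq]]) simp
        then show "\<forall>\<^sub>F k in sequentially. norm (b k) \<le> q k"
        proof eventually_elim
          case (elim k)
          have "q k powr (1 / p) \<le> q k powr 1" using p elim q0[of k] by (intro powr_mono') auto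
          then show ?case using q0[of k] by (simp add: b_def)
        qed
      qed
      have bU: "(LINT x|L. norm (T (Suc k) x - T k x)) \<le> b k" for k
      proof -
        have "(LINT x|L. norm (T (Suc k) x - T k x)) = (LINT x|lebesgue_on {0..2 * pi}. norm (tpoly (n * 2 ^ Suc k) (u k) x))"
          unfolding L_def UT[symmetric] U_def ..
        also have "\<dots> \<le> b k"
          unfolding b_def q_def U_def by (rule nikolskii_L1[OF p(1) p']) (use n in simp)
        finally show ?thesis .
      qed
      define \<eta> where "\<eta> = (\<lambda>K. \<Sum>k. b (k + K))"
      have \<eta>0: "\<eta> K \<ge> 0" for K
        unfolding \<eta>_def by (rule suminf_nonneg[OF summable_ignore_initial_segment[OF summb]]) (simp add: b_def)
      have \<eta>lim: "\<eta> \<longlonglongrightarrow> 0"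
      proof -
        have "\<eta> = (\<lambda>K. suminf b - (\<Sum>i<K. b i))"
          unfolding \<eta>_def using suminf_minus_initial_segment[OF summb] by blast
        moreover have "(\<lambda>K. suminf b - (\<Sum>i<K. b i)) \<longlonglongrightarrow> suminf b - suminf b"
          by (intro tendsto_diff tendsto_const summable_LIMSEQ[OF summb])
        ultimately show ?thesis by simp
      qed
      have L1: "integral {0..2 * pi} (\<lambda>x. norm (g x - T K x)) \<le> \<eta> K" for K
      proof -
        have int: "integrable L (\<lambda>x. norm (g x - T K x))" by (rule integrable_norm[OF gT])
        have "(\<integral>\<^sup>+x. ennreal (norm (g x - T K x)) \<partial>L) \<le> ennreal (\<eta> K)"
          unfolding \<eta>_def
        proof (rule L1_limit_from_p_convergence[OF p(1)])
          show "g \<in> borel_measurable L" using gint by simp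
          show "T k \<in> borel_measurable L" for k unfolding T_def using Tint by simp
          show "integrable L (\<lambda>x. norm (g x - T k x) powr p)" for k
            unfolding L_def by (rule integrable_norm_powr[OF p(1) p' gT[unfolded L_def]])
          show "summable (\<lambda>k. LINT x|L. norm (g x - T k x) powr p)"
            using summa unfolding a_def p_integral_def L_def .
          show "integrable L (\<lambda>x. norm (T (Suc k) x - T k x))" for k
            unfolding UT[symmetric] U_def by (rule integrable_norm[OF Tint])
        qed (rule bU summb)+
        then have "ennreal (LINT x|L. norm (g x - T K x)) \<le> ennreal (\<eta> K)"
          using int by (simp add: nn_integral_eq_integral)
        then have "(LINT x|L. norm (g x - T K x)) \<le> \<eta> K" using \<eta>0 by simp
        then show ?thesis using lebesgue_integral_eq_integral[OF int[unfolded L_def]] by (simp add: L_def)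
      qed
      define B where "B = (\<lambda>K. 2 * pi * (2 * (4 * pi) ^ (r - 1) * \<eta> K) powr p)"
      have est: "best_approx p n f powr p \<le> B K + Y * (4 * X + 8 * S + 8 * (real n * \<epsilon>))" for K
      proof -
        have "r - 1 < r" using r by simp
        from iterated_primitive_approximation[OF f r L1[of K, unfolded g_def T_def] this]
        obtain d where d: "\<forall>j. j \<noteq> 0 \<longrightarrow> d j = c K j / (\<i> * of_int j) ^ Suc (r - 1)"
          "\<forall>x\<in>{0..2 * pi}. norm (nth_derivative (r - 1 - (r - 1)) f x - tpoly (n * 2 ^ K) d x) \<le> 2 * (4 * pi) ^ (r - 1) * \<eta> K"
          by (elim exE conjE) (rule that)
        define F where "F = tpoly (n * 2 ^ K) d"
        have Suc_r: "Suc (r - 1) = r" using r by simp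
        have dF: "norm (f x - F x) \<le> 2 * (4 * pi) ^ (r - 1) * \<eta> K" if "x \<in> {0..2 * pi}" for x
          using d(2)[rule_format, OF that] by (simp add: F_def nth_derivative_def)
        \<comment> \<open>coefficients of the antiderivatives of \<open>U k\<close> and of \<open>T 0\<close>; the free constant goes to the latter\<close>
        define v where "v = (\<lambda>k j. if j = 0 then 0 else u k j / (\<i> * of_int j) ^ r)"
        define v0 where "v0 = (\<lambda>j. if j = 0 then d 0 else c 0 j / (\<i> * of_int j) ^ r)"
        have v_zero: "v k j = 0" if "\<bar>j\<bar> > int (n * 2 ^ Suc k)" for k j using u0[OF that] by (simp add: v_def)
        have v0_zero: "v0 j = 0" if "\<bar>j\<bar> > int n" for j using c0[of 0 j] that by (auto simp: v0_def)
        have Fdec: "F x = tpoly n v0 x + (\<Sum>k<K. tpoly (n * 2 ^ Suc k) (v k) x)" for x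
        proof -
          have 1: "tpoly (n * 2 ^ Suc k) (v k) x = tpoly (n * 2 ^ K) (v k) x" if "k < K" for k
          proof (rule tpoly_extend[symmetric])
            have "(2::nat) ^ Suc k \<le> 2 ^ K" using that by (intro power_increasing) auto
            then show "n * 2 ^ Suc k \<le> n * 2 ^ K" by (rule mult_le_mono2)
          qed (rule v_zero)
          have 2: "tpoly n v0 x = tpoly (n * 2 ^ K) v0 x"
            by (rule tpoly_extend[symmetric]) (use v0_zero in auto)
          have 3: "d j = v0 j + (\<Sum>k<K. v k j)" for j
          proof (cases "j = 0")
            case False
            have "(\<Sum>k<K. v k j) = (\<Sum>k<K. u k j) / (\<i> * of_int j) ^ r"
              using False by (simp add: v_def sum_divide_distrib)
            also have "(\<Sum>k<K. u k j) = c K j - c 0 j"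
              unfolding u_def by (rule sum_lessThan_telescope)
            finally have "v0 j + (\<Sum>k<K. v k j) = c K j / (\<i> * of_int j) ^ r"
              using False by (simp add: v0_def add_divide_distrib[symmetric])
            then show ?thesis using d(1) False unfolding Suc_r by simp
          qed (simp add: v_def v0_def)
          have "F x = tpoly (n * 2 ^ K) v0 x + tpoly (n * 2 ^ K) (\<lambda>j. \<Sum>k<K. v k j) x"
            unfolding F_def 3[abs_def] by (simp add: tpoly_def sum.distrib distrib_right)
          also have "tpoly (n * 2 ^ K) (\<lambda>j. \<Sum>k<K. v k j) x = (\<Sum>k<K. tpoly (n * 2 ^ K) (v k) x)"
            by (rule tpoly_sum[symmetric])
          also have "\<dots> = (\<Sum>k<K. tpoly (n * 2 ^ Suc k) (v k) x)"
            by (rule sum.cong[OF refl]) (use 1 in simp)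
          finally show ?thesis unfolding 2 .
        qed
        have "\<exists>s. (\<forall>j. \<bar>j\<bar> > int n \<longrightarrow> s j = 0) \<and>
            p_integral p (\<lambda>x. tpoly (n * 2 ^ Suc k) (v k) x - tpoly n s x) \<le> Y * q k" for k
        proof -
          have "\<exists>P\<in>trig_polys n. p_integral p (\<lambda>x. tpoly (n * 2 ^ Suc k) (v k) x - P x)
            \<le> C1 * real n powr ((1 - real r) * p - 1) * real (n * 2 ^ Suc k) powr (1 - p) * p_integral p (tpoly (n * 2 ^ Suc k) (u k))"
            by (rule C1(2)[OF n]) (simp add: v_def)
          then obtain P where P: "P \<in> trig_polys n"
            "p_integral p (\<lambda>x. tpoly (n * 2 ^ Suc k) (v k) x - P x) \<le> Y * q k"
            unfolding Y_def q_def U_def by (auto simp only: mult.assoc)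
          obtain s where s: "P = tpoly n s" "\<And>j. \<bar>j\<bar> > int n \<Longrightarrow> s j = 0"
            by (rule trig_polysE[OF P(1)]) (rule that)
          show ?thesis
            by (intro exI[of _ s] conjI allI impI) (use s(2) P(2) in \<open>simp_all only: s(1)\<close>)
        qed
        then obtain s where s0: "\<And>k j. \<bar>j\<bar> > int n \<Longrightarrow> s k j = 0"
          and sI: "\<And>k. p_integral p (\<lambda>x. tpoly (n * 2 ^ Suc k) (v k) x - tpoly n (s k) x) \<le> Y * q k"
          by metis
        define e where "e = (\<lambda>k j. v k j - s k j)"
        have ediff: "tpoly (n * 2 ^ Suc k) (v k) x - tpoly n (s k) x = tpoly (n * 2 ^ Suc k) (e k) x" for k x
        proof -
          have "tpoly n (s k) x = tpoly (n * 2 ^ Suc k) (s k) x"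
            by (rule tpoly_extend[symmetric]) (use s0 in auto)
          then show ?thesis unfolding e_def by (simp only: tpoly_diff)
        qed
        define Q where "Q = tpoly n (\<lambda>j. v0 j + (\<Sum>k<K. s k j))"
        have Q: "Q x = tpoly n v0 x + (\<Sum>k<K. tpoly n (s k) x)" for x
          unfolding Q_def tpoly_sum by (simp add: tpoly_def sum.distrib distrib_right)
        have FQ: "F x - Q x = (\<Sum>k<K. tpoly (n * 2 ^ Suc k) (e k) x)" for x
          unfolding ediff[symmetric] by (simp add: Fdec Q sum_subtractf)
        have Fint: "integrable L F" unfolding F_def by (rule Tint)
        have Qint: "integrable L Q" unfolding Q_def by (rule Tint)
        have "best_approx p n f powr p \<le> p_integral p (\<lambda>x. f x - Q x)"
          by (rule best_approx_powr_le[OF p(1)]) (simp add: Q_def tpoly_in_trig_polys)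
        also have "(\<lambda>x. f x - Q x) = (\<lambda>x. (f x - F x) + (F x - Q x))" by simp
        also have "p_integral p \<dots> \<le> p_integral p (\<lambda>x. f x - F x) + p_integral p (\<lambda>x. F x - Q x)"
          by (rule p_integral_add[OF p(1) p']; fold L_def; intro Bochner_Integration.integrable_diff fint Fint Qint)
        also have "p_integral p (\<lambda>x. f x - F x) \<le> B K"
        proof -
          have "p_integral p (\<lambda>x. f x - F x) \<le> (LINT x|lebesgue_on {0..2 * pi}. (2 * (4 * pi) ^ (r - 1) * \<eta> K) powr p)"
            unfolding p_integral_def
          proof (rule integral_mono)
            show "integrable (lebesgue_on {0..2 * pi}) (\<lambda>x. norm (f x - F x) powr p)"
              by (rule integrable_norm_powr[OF p(1) p']; fold L_def; intro Bochner_Integration.integrable_diff fint Fint)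
            show "integrable (lebesgue_on {0..2 * pi}) (\<lambda>x. (2 * (4 * pi) ^ (r - 1) * \<eta> K) powr p)"
              by (intro lebesgue_circle_integral(1) continuous_intros)
            fix x assume "x \<in> space (lebesgue_on {0..2 * pi})"
            then have "x \<in> {0..2 * pi}" by simp
            from dF[OF this] show "norm (f x - F x) powr p \<le> (2 * (4 * pi) ^ (r - 1) * \<eta> K) powr p"
              using p(1) by (intro powr_mono2) auto
          qed
          also have "\<dots> = B K"
            by (subst lebesgue_circle_integral(2)) (simp_all add: B_def)
          finally show ?thesis .
        qed
        also have "p_integral p (\<lambda>x. F x - Q x) \<le> (\<Sum>k<K. p_integral p (tpoly (n * 2 ^ Suc k) (e k)))"
          unfolding FQ by (rule p_integral_tpoly_sum[OF p(1) p']) simp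
        also have "\<dots> \<le> (\<Sum>k<K. Y * q k)"
        proof (rule sum_mono)
          fix k
          show "p_integral p (tpoly (n * 2 ^ Suc k) (e k)) \<le> Y * q k"
            using sI[of k] unfolding ediff .
        qed
        also have "\<dots> = Y * (\<Sum>k<K. q k)" by (rule sum_distrib_left[symmetric])
        also have "\<dots> \<le> Y * (4 * X + 8 * S + 8 * (real n * \<epsilon>))"
          using qsum Y0 by (intro mult_left_mono) auto
        finally show ?thesis by simp
      qed
      have "B \<longlonglongrightarrow> 0"
      proof -
        have "(\<lambda>K. 2 * (4 * pi) ^ (r - 1) * \<eta> K) \<longlonglongrightarrow> 0" using tendsto_mult_right_zero[OF \<eta>lim] .
        then have "(\<lambda>K. (2 * (4 * pi) ^ (r - 1) * \<eta> K) powr p) \<longlonglongrightarrow> 0"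
          by (rule tendsto_zero_powrI[OF _ tendsto_const]) (use \<eta>0 p in auto)
        then show ?thesis unfolding B_def by (rule tendsto_mult_right_zero)
      qed
      then have "(\<lambda>K. B K + Y * (4 * X + 8 * S + 8 * (real n * \<epsilon>))) \<longlonglongrightarrow> 0 + Y * (4 * X + 8 * S + 8 * (real n * \<epsilon>))"
        by (intro tendsto_add tendsto_const)
      then have "best_approx p n f powr p \<le> 0 + Y * (4 * X + 8 * S + 8 * (real n * \<epsilon>))"
        by (rule LIMSEQ_le_const) (use est in blast)
      then show ?thesis by simp
    qed
    have "best_approx p n f powr p \<le> Y * (4 * X + 8 * S)"
    proof (rule field_le_epsilon)
      fix \<delta> :: real assume \<delta>: "\<delta> > 0"
      define \<epsilon> where "\<epsilon> = \<delta> / (8 * Y * real n)"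
      have "\<epsilon> > 0" using \<delta> Y0 n by (simp add: \<epsilon>_def)
      from main[OF this] have "best_approx p n f powr p \<le> Y * (4 * X + 8 * S) + Y * (8 * (real n * \<epsilon>))"
        by (simp add: distrib_left)
      also have "Y * (8 * (real n * \<epsilon>)) = \<delta>" using Y0 n by (simp add: \<epsilon>_def)
      finally show "best_approx p n f powr p \<le> Y * (4 * X + 8 * S) + \<delta>" .
    qed
    also have "\<dots> \<le> Y * (8 * X + 8 * S)" using X0 Y0 by (intro mult_left_mono) auto
    also have "\<dots> = 8 * C1 * real n powr ((1 - real r) * p - 1) * (X + S)" by (simp add: Y_def)
    finally show "best_approx p n f powr p \<le> 8 * C1 * real n powr ((1 - real r) * p - 1) *
         (real n powr (1 - p) * best_approx p n (nth_derivative r f) powr p +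
          (\<Sum>\<^sub>\<infinity>\<nu>\<in>{n + 1..}. real \<nu> powr (- p) * best_approx p \<nu> (nth_derivative r f) powr p))"
      unfolding X_def S_def E_def g_def .
  qed (use C1(1) in simp)
qed

lemma add_powr_le:
  fixes X S :: real
  assumes "X \<ge> 0" "S \<ge> 0" "q \<ge> 0"
  shows "(X + S) powr q \<le> 2 powr q * (X powr q + S powr q)"
proof -
  have "(X + S) powr q \<le> (2 * max X S) powr q" using assms by (intro powr_mono2) auto
  also have "\<dots> = 2 powr q * max X S powr q" using assms by (simp add: powr_mult)
  also have "\<dots> \<le> 2 powr q * (X powr q + S powr q)"
    by (intro mult_left_mono) (auto simp: max_def)
  finally show ?thesis .
qed

theorem theorem2p1:
  fixes p :: real and r :: nat
  assumes "0 < p" and "p < 1" and "1 \<le> r"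
  shows "\<exists>C::real. \<forall>f :: real \<Rightarrow> complex.
    derivative_in_AC r f \<longrightarrow>
    (\<lambda>\<nu>. real \<nu> powr (- p) * best_approx p \<nu> (nth_derivative r f) powr p) summable_on {1..} \<longrightarrow>
    (\<forall>n::nat. 1 \<le> n \<longrightarrow>
      best_approx p n f \<le> C / real n ^ r *
        (best_approx p n (nth_derivative r f) +
         real n powr (1 - 1 / p) *
           (\<Sum>\<^sub>\<infinity>\<nu>\<in>{n + 1..}. real \<nu> powr (- p) * best_approx p \<nu> (nth_derivative r f) powr p)
             powr (1 / p)))"
proof -
  obtain C where C: "C > 0"
    "\<And>f n. derivative_in_AC r f \<Longrightarrow>
       (\<lambda>\<nu>. real \<nu> powr (- p) * best_approx p \<nu> (nth_derivative r f) powr p) summable_on {1..} \<Longrightarrow> 1 \<le> n \<Longrightarrow>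
       best_approx p n f powr p \<le> C * real n powr ((1 - real r) * p - 1) *
         (real n powr (1 - p) * best_approx p n (nth_derivative r f) powr p +
          (\<Sum>\<^sub>\<infinity>\<nu>\<in>{n + 1..}. real \<nu> powr (- p) * best_approx p \<nu> (nth_derivative r f) powr p))"
    by (rule approximation_pth_power[OF assms]) (rule that)
  show ?thesis
  proof (intro exI[of _ "C powr (1 / p) * 2 powr (1 / p)"] allI impI)
    fix f :: "real \<Rightarrow> complex" and n :: nat
    assume f: "derivative_in_AC r f"
      and summ: "(\<lambda>\<nu>. real \<nu> powr (- p) * best_approx p \<nu> (nth_derivative r f) powr p) summable_on {1..}"
      and n: "1 \<le> n"
    define E where "E = best_approx p n (nth_derivative r f)"
    define S where "S = (\<Sum>\<^sub>\<infinity>\<nu>\<in>{n + 1..}. real \<nu> powr (- p) * best_approx p \<nu> (nth_derivative r f) powr p)"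
    define X where "X = real n powr (1 - p) * E powr p"
    define Z where "Z = real n powr ((1 - real r) * p - 1)"
    have E0: "E \<ge> 0" unfolding E_def by (rule best_approx_nonneg)
    have S0: "S \<ge> 0" unfolding S_def by (rule infsum_nonneg) simp
    have X0: "X \<ge> 0" by (simp add: X_def)
    have n0: "real n > 0" using n by simp
    have Zp: "Z powr (1 / p) = real n powr (1 - real r - 1 / p)"
      using assms(1) by (simp add: Z_def powr_powr diff_divide_distrib)
    have Xp: "X powr (1 / p) = real n powr (1 / p - 1) * E"
      using assms(1) E0 by (simp add: X_def powr_mult powr_powr diff_divide_distrib)
    have ZX: "Z powr (1 / p) * X powr (1 / p) = E / real n ^ r"
    proof -
      have "(1 - real r - 1 / p) + (1 / p - 1) = - real r" by simp
      then have "real n powr (1 - real r - 1 / p) * real n powr (1 / p - 1) = real n powr (- real r)"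
        by (simp only: powr_add[symmetric])
      then have "Z powr (1 / p) * X powr (1 / p) = real n powr (- real r) * E"
        unfolding Zp Xp mult.assoc[symmetric] by (simp only:)
      then show ?thesis using n0 by (simp add: powr_minus powr_realpow divide_simps)
    qed
    have ZS: "Z powr (1 / p) = real n powr (1 - 1 / p) / real n ^ r"
    proof -
      have "1 - real r - 1 / p = (1 - 1 / p) + - real r" by simp
      then have "Z powr (1 / p) = real n powr (1 - 1 / p) * real n powr (- real r)"
        unfolding Zp by (simp only: powr_add)
      moreover have "real n powr (- real r) = 1 / real n ^ r"
        using n0 by (simp add: powr_minus powr_realpow divide_simps)
      ultimately show ?thesis by (simp only: times_divide_eq_right mult_1_right)
    qed
    have "best_approx p n f = (best_approx p n f powr p) powr (1 / p)"
      using assms(1) best_approx_nonneg by (simp add: powr_powr)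
    also have "\<dots> \<le> (C * Z * (X + S)) powr (1 / p)"
      using C(2)[OF f summ n] assms(1) unfolding X_def S_def E_def Z_def by (intro powr_mono2) auto
    also have "\<dots> = C powr (1 / p) * Z powr (1 / p) * (X + S) powr (1 / p)"
      using C(1) X0 S0 by (simp add: powr_mult Z_def)
    also have "\<dots> \<le> C powr (1 / p) * Z powr (1 / p) * (2 powr (1 / p) * (X powr (1 / p) + S powr (1 / p)))"
      using assms(1) X0 S0 by (intro mult_left_mono add_powr_le) auto
    also have "\<dots> = C powr (1 / p) * 2 powr (1 / p) * (Z powr (1 / p) * X powr (1 / p) + Z powr (1 / p) * S powr (1 / p))"
      by (simp add: algebra_simps)
    also have "\<dots> = C powr (1 / p) * 2 powr (1 / p) / real n ^ r * (E + real n powr (1 - 1 / p) * S powr (1 / p))"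
      unfolding ZX unfolding ZS using n0 by (simp add: field_simps)
    finally show "best_approx p n f \<le> C powr (1 / p) * 2 powr (1 / p) / real n ^ r *
        (best_approx p n (nth_derivative r f) +
         real n powr (1 - 1 / p) *
           (\<Sum>\<^sub>\<infinity>\<nu>\<in>{n + 1..}. real \<nu> powr (- p) * best_approx p \<nu> (nth_derivative r f) powr p)
             powr (1 / p))"
      unfolding E_def S_def .
  qed
qed

end
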